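(* Let $k_1$ be a VMO loop of type (I.1), $k_2$ a VMO loop of type (II.1), and $\chi=\chi_-+\chi_0+\chi_+\in VMO(S^1,i\mathbb R)$. Then, on the natural domain of the right hand side, $$A\Big(k_1^*\begin{pmatrix}e^{\chi}&0\\0&e^{-\chi}\end{pmatrix}k_2\Big)=A\Big(k_1^*\begin{pmatrix}e^{\chi_-}&0\\0&e^{-\chi_-}\end{pmatrix}\Big)\,A\Big(\begin{pmatrix}e^{\chi_0}&0\\0&e^{-\chi_0}\end{pmatrix}\Big)\,A\Big(\begin{pmatrix}e^{\chi_+}&0\\0&e^{-\chi_+}\end{pmatrix}k_2\Big).$$
   Context: $\Delta$ is the open unit disk and $H^0(\Delta)$ denotes holomorphic functions on $\Delta$. For $f=\sum f_nz^n$: $f_-=\sum_{n<0}f_nz^n$, $f_+=\sum_{n>0}f_nz^n$, $f_0$ the constant term, and $f^*(z)=\sum\overline{f_{-n}}z^n$ (complex conjugate on $S^1$). For loops into $SU(2)$, $k^*=k^{-1}$ is the pointwise adjoint. $VMO$ denotes vanishing mean oscillation. VMO loop of type (I.1): $k_1\in VMO(S^1,SU(2))$ of the form $k_1=\begin{pmatrix}a&b\\-b^*&a^*\end{pmatrix}$ with $a,b\in H^0(\Delta)$, $a(0)>0$, and $a,b$ not simultaneously vanishing at a point of $\Delta$. VMO loop of type (II.1): $k_2\in VMO(S^1,SU(2))$ of the form $k_2=\begin{pmatrix}d^*&-c^*\\c&d\end{pmatrix}$ with $c,d\in H^0(\Delta)$, $c(0)=0$, $d(0)>0$, and $c,d$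 not simultaneously vanishing at a point of $\Delta$. $H=L^2(S^1,\mathbb C^2)=H_+\oplus H_-$, where $H_+$ consists of $L^2$ boundary values of functions holomorphic in $\Delta$, with orthogonal projection $P_+$. For a measurable matrix symbol $G$ (possibly unbounded, since $e^{\chi_\pm}$ need not be bounded), the Toeplitz operator $A(G)$ has natural domain $\{f\in H_+: Gf\in H\}$ and acts by $A(G)f=P_+(Gf)$; a composition is defined on those $f$ for which each successive application is defined. *)

theory Defs
  imports "HOL-Complex_Analysis.Complex_Analysis" "HOL-Probability.Probability"
begin

text \<open>Normalised arc length on the unit circle.  Elements of function spaces on the circle are
  represented by functions, with equality almost everywhere.\<close>

definition circle_measure :: "complex measure" where
  "circle_measure =
     distr (uniform_measure lborel {0..2*pi}) (restrict_space borel (sphere 0 1)) cis"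

definition fourier_coeff :: "(complex \<Rightarrow> complex) \<Rightarrow> int \<Rightarrow> complex" where
  "fourier_coeff f n = (\<integral>z. z powi (- n) * f z \<partial>circle_measure)"

definition L2_circle :: "(complex \<Rightarrow> 'a::euclidean_space) set" where
  "L2_circle = {f \<in> borel_measurable circle_measure.
                 integrable circle_measure (\<lambda>z. (norm (f z))\<^sup>2)}"

text \<open>Only used for families and limits in \<open>L2_circle\<close>, where the integral is a genuine one.\<close>

definition L2_tendsto ::
  "('b \<Rightarrow> complex \<Rightarrow> 'a::euclidean_space) \<Rightarrow> (complex \<Rightarrow> 'a) \<Rightarrow> 'b filter \<Rightarrow> bool" where
  "L2_tendsto u g F \<longleftrightarrow>
     ((\<lambda>x. \<integral>z. (norm (u x z - g z))\<^sup>2 \<partial>circle_measure) \<longlongrightarrow> 0) F"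

text \<open>The Fourier series converge in \<open>L2_circle\<close> (uniquely up to null sets) for every square integrable
  function, hence, by the John--Nirenberg inequality, for every function in VMO.\<close>

definition pos_part :: "(complex \<Rightarrow> complex) \<Rightarrow> complex \<Rightarrow> complex" where
  "pos_part f = (SOME g. g \<in> L2_circle \<and>
     L2_tendsto (\<lambda>N z. \<Sum>n=1..N. fourier_coeff f (int n) * z powi (int n)) g sequentially)"

definition neg_part :: "(complex \<Rightarrow> complex) \<Rightarrow> complex \<Rightarrow> complex" where
  "neg_part f = (SOME g. g \<in> L2_circle \<and>
     L2_tendsto (\<lambda>N z. \<Sum>n=1..N. fourier_coeff f (- int n) * z powi (- int n)) g sequentially)"

definition circle_arc :: "real \<Rightarrow> real \<Rightarrow> complex set" where
  "circle_arc t h = cis ` {t - h..t + h}"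

definition arc_mean ::
  "(complex \<Rightarrow> 'a::{banach, second_countable_topology}) \<Rightarrow> complex set \<Rightarrow> 'a" where
  "arc_mean f I = (LINT z:I|circle_measure. f z) /\<^sub>R measure circle_measure I"

definition mean_oscillation ::
  "(complex \<Rightarrow> 'a::{banach, second_countable_topology}) \<Rightarrow> complex set \<Rightarrow> real" where
  "mean_oscillation f I = arc_mean (\<lambda>z. norm (f z - arc_mean f I)) I"

text \<open>On the circle, bounded mean oscillation over all arcs follows from integrability together with
  the vanishing condition, so it is not listed separately.\<close>

definition VMO :: "'a::{banach, second_countable_topology} set \<Rightarrow> (complex \<Rightarrow> 'a) set" where
  "VMO K = {f. integrable circle_measure f \<and>
              (AE z in circle_measure. f z \<in> K) \<and>
              (\<forall>\<epsilon>>0. \<exists>\<delta>>0. \<forall>t h. 0 < h \<and> h < \<delta> \<longrightarrow> mean_oscillation f (circle_arc t h) < \<epsilon>)}"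

definition mat2 :: "'a \<Rightarrow> 'a \<Rightarrow> 'a \<Rightarrow> 'a \<Rightarrow> 'a::zero^2^2" where
  "mat2 a b c d = vector [vector [a, b], vector [c, d]]"

definition adjoint_mat :: "complex^2^2 \<Rightarrow> complex^2^2" where
  "adjoint_mat A = (\<chi> i j. cnj (A $ j $ i))"

definition SU2 :: "(complex^2^2) set" where
  "SU2 = {A. adjoint_mat A ** A = mat 1 \<and> det A = 1}"

definition boundary_values :: "(complex \<Rightarrow> complex) \<Rightarrow> (complex \<Rightarrow> complex) \<Rightarrow> bool" where
  "boundary_values F f \<longleftrightarrow> F holomorphic_on ball 0 1 \<and> f \<in> L2_circle \<and>
     L2_tendsto (\<lambda>r z. F (of_real r * z)) f (at_left 1)"

text \<open>In the two types of loops, capital letters denote the holomorphic functions on the disk and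
  small letters their boundary values; on the circle \<open>f\<^sup>*\<close> is the complex conjugate of \<open>f\<close>.
  As the entries of an \<open>SU(2)\<close>-valued function are bounded, square integrable boundary values are no
  restriction.\<close>

definition VMO_type_I1 :: "(complex \<Rightarrow> complex^2^2) \<Rightarrow> bool" where
  "VMO_type_I1 k \<longleftrightarrow> k \<in> VMO SU2 \<and>
     (\<exists>A B a b. boundary_values A a \<and> boundary_values B b \<and>
        (AE z in circle_measure. k z = mat2 (a z) (b z) (- cnj (b z)) (cnj (a z))) \<and>
        (\<exists>r>0. A 0 = of_real r) \<and>
        \<not> (\<exists>w\<in>ball 0 1. A w = 0 \<and> B w = 0))"

definition VMO_type_II1 :: "(complex \<Rightarrow> complex^2^2) \<Rightarrow> bool" where
  "VMO_type_II1 k \<longleftrightarrow> k \<in> VMO SU2 \<and>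
     (\<exists>C D c d. boundary_values C c \<and> boundary_values D d \<and>
        (AE z in circle_measure. k z = mat2 (cnj (d z)) (- cnj (c z)) (c z) (d z)) \<and>
        C 0 = 0 \<and> (\<exists>r>0. D 0 = of_real r) \<and>
        \<not> (\<exists>w\<in>ball 0 1. C w = 0 \<and> D w = 0))"

definition hardy :: "(complex \<Rightarrow> complex^2) set" where
  "hardy = {f \<in> L2_circle.
     \<exists>F :: complex \<Rightarrow> complex^2. \<forall>i. boundary_values (\<lambda>w. F w $ i) (\<lambda>z. f z $ i)}"

definition inner_L2 :: "(complex \<Rightarrow> complex^2) \<Rightarrow> (complex \<Rightarrow> complex^2) \<Rightarrow> complex" where
  "inner_L2 f g = (\<integral>z. (\<Sum>i\<in>UNIV. f z $ i * cnj (g z $ i)) \<partial>circle_measure)"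

definition proj_plus :: "(complex \<Rightarrow> complex^2) \<Rightarrow> complex \<Rightarrow> complex^2" where
  "proj_plus f = (SOME g. g \<in> hardy \<and> (\<forall>h\<in>hardy. inner_L2 (\<lambda>z. f z - g z) h = 0))"

definition toeplitz_dom :: "(complex \<Rightarrow> complex^2^2) \<Rightarrow> (complex \<Rightarrow> complex^2) set" where
  "toeplitz_dom G = {f \<in> hardy. (\<lambda>z. G z *v f z) \<in> L2_circle}"

definition toeplitz ::
  "(complex \<Rightarrow> complex^2^2) \<Rightarrow> (complex \<Rightarrow> complex^2) \<Rightarrow> complex \<Rightarrow> complex^2" where
  "toeplitz G f = proj_plus (\<lambda>z. G z *v f z)"

definition exp_diag :: "(complex \<Rightarrow> complex) \<Rightarrow> complex \<Rightarrow> complex^2^2" where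
  "exp_diag u z = mat2 (exp (u z)) 0 0 (exp (- u z))"

end

theory Submission
  imports Defs
begin

text \<open>The two operators differ by \<open>P\<^sub>+\<close> applied to \<open>w = k\<^sub>1\<^sup>* e\<^bsup>\<chi>\<^sub>-\<^esup> e\<^bsup>\<chi>\<^sub>0\<^esup> (g - P\<^sub>+ g)\<close>, where
  \<open>g = e\<^bsup>\<chi>\<^sub>+\<^esup> k\<^sub>2 f\<close>.  The second row of \<open>k\<^sub>2\<close> is analytic, hence \<open>g - P\<^sub>+ g = (q, 0)\<close> with \<open>q\<close>
  antianalytic, and \<open>w\<close> is the product of \<open>q\<close> with the first column of \<open>k\<^sub>1\<^sup>*\<close> and \<open>e\<^bsup>\<chi>\<^sub>-\<^esup>\<close>, which are
  antianalytic as well.  Both steps need that \<open>e\<^bsup>x\<^esup> \<phi>\<close> lies in \<open>H\<^sup>2\<close> as soon as \<open>x\<close>, \<open>\<phi>\<close> do and the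
  product is square integrable.  This holds because \<open>Re x\<close> is the Poisson integral of its boundary
  values, so that \<open>e\<^bsup>x\<^esup>\<close> is outer; no exponential integrability of \<open>\<chi>\<close> is used.  The only consequence of
  vanishing mean oscillation that enters is that the Fourier coefficients of \<open>\<chi>\<close> are square summable.\<close>

subsection \<open>Integration over the circle\<close>

text \<open>Only \<open>exp_diag chi\<close> is unitary. The factors with
  \<open>pos_part chi\<close> and \<open>neg_part chi\<close> may be unbounded, and so may their
  inverses, so no argument with bounded operators applies. The natural domain supplies the missing
  square integrability: of \<open>g\<close> after the first factor and of \<open>k\<close> before
  the last projection. The left hand symbol is bounded, so \<open>f\<close> lies in its domain
  anyway. Square integrability on the circle alone does not put an analytic exponential into H^2:
  for x(z) = (1+z)/(1-z) the boundary values of e^x have modulus one, yet e^x is not in H^2. This x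
  is itself not in H^2; the hypothesis on x excludes such inverses of singular inner functions.
  \<open>pos_part\<close> and \<open>neg_part\<close> are chosen by \<open>SOME\<close> as L^2
  limits, so nothing is known about them until the Fourier coefficients of \<open>chi\<close> are
  square summable, while \<open>VMO\<close> offers only integrability and small oscillation on short
  arcs. Dyadic averages, paired with trigonometric polynomials, close this gap.\<close>

lemma measurable_cis_circle [measurable]:
  "cis \<in> measurable (uniform_measure lborel {0..2*pi}) (restrict_space borel (sphere 0 1))"
proof (rule measurable_restrict_space2)
  have "continuous_on UNIV cis"
    by (intro continuous_intros)
  then show "cis \<in> borel_measurable (uniform_measure lborel {0..2*pi})"
    by (auto dest: borel_measurable_continuous_onI cong: measurable_cong_sets)
qed auto

lemma space_circle [simp]: "space circle_measure = sphere 0 1"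
  by (simp add: circle_measure_def space_restrict_space)

lemma sets_circle: "sets circle_measure = sets (restrict_space borel (sphere 0 1))"
  by (simp add: circle_measure_def)

interpretation circle: prob_space circle_measure
  unfolding circle_measure_def
  by (intro prob_space.prob_space_distr prob_space_uniform_measure measurable_cis_circle) auto

lemma continuous_measurable_circle:
  fixes f :: "complex \<Rightarrow> 'a::topological_space"
  assumes "continuous_on (sphere 0 1) f"
  shows "f \<in> borel_measurable circle_measure"
  using borel_measurable_continuous_on_restrict[OF assms] sets_circle
  by (simp cong: measurable_cong_sets)

lemma continuous_integrable_circle:
  fixes f :: "complex \<Rightarrow> 'a::{banach, second_countable_topology}"
  assumes "continuous_on (sphere 0 1) f"
  shows "integrable circle_measure f"
proof -
  have "compact (f ` sphere 0 1)"
    using assms by (intro compact_continuous_image) auto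
  then obtain B where "\<And>z. z \<in> sphere 0 1 \<Longrightarrow> norm (f z) \<le> B"
    using compact_imp_bounded bounded_iff by (metis imageI)
  then show ?thesis
    using continuous_measurable_circle[OF assms]
    by (intro circle.integrable_const_bound[of f B]) (auto intro!: AE_I2)
qed

lemma measurable_comp_cis:
  assumes "f \<in> borel_measurable circle_measure"
  shows "(\<lambda>x. f (cis x)) \<in> borel_measurable lborel"
proof -
  have "cis \<in> measurable lborel (restrict_space borel (sphere 0 1))"
    using measurable_cis_circle by (simp cong: measurable_cong_sets)
  moreover have "f \<in> borel_measurable (restrict_space borel (sphere 0 1))"
    using assms sets_circle by (simp cong: measurable_cong_sets)
  ultimately show ?thesis
    using measurable_compose by blast
qed

lemma uniform_measure_density:
  "uniform_measure lborel {0..2*pi} = density lborel (\<lambda>x. ennreal (indicator {0..2*pi} x / (2*pi)))"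
  unfolding uniform_measure_def
  by (intro arg_cong[where f = "density lborel"] ext)
     (auto simp: indicator_def divide_ennreal simp flip: ennreal_1)

lemma integrable_circle_iff:
  fixes f :: "complex \<Rightarrow> 'a::{banach, second_countable_topology}"
  assumes [measurable]: "f \<in> borel_measurable circle_measure"
  shows "integrable circle_measure f \<longleftrightarrow> set_integrable lborel {0..2*pi} (\<lambda>x. f (cis x))"
proof -
  have [measurable]: "f \<in> borel_measurable (restrict_space borel (sphere 0 1))"
    using assms sets_circle by (simp cong: measurable_cong_sets)
  have [measurable]: "(\<lambda>x. f (cis x)) \<in> borel_measurable lborel"
    by (rule measurable_comp_cis) fact
  have "integrable circle_measure f \<longleftrightarrow> integrable (uniform_measure lborel {0..2*pi}) (\<lambda>x. f (cis x))"
    unfolding circle_measure_def by (rule integrable_distr_eq) measurable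
  also have "\<dots> \<longleftrightarrow> integrable lborel (\<lambda>x. (indicator {0..2*pi} x / (2*pi)) *\<^sub>R f (cis x))"
    unfolding uniform_measure_density by (intro integrable_density) auto
  also have "\<dots> \<longleftrightarrow> integrable lborel (\<lambda>x. (1/(2*pi)) *\<^sub>R (indicator {0..2*pi} x *\<^sub>R f (cis x)))"
    by (simp add: field_simps)
  also have "\<dots> \<longleftrightarrow> set_integrable lborel {0..2*pi} (\<lambda>x. f (cis x))"
    unfolding set_integrable_def
    using integrable_scaleR_right[of "2*pi" lborel "\<lambda>x. (1/(2*pi)) *\<^sub>R (indicator {0..2*pi} x *\<^sub>R f (cis x))"]
      integrable_scaleR_right[of "1/(2*pi)" lborel "\<lambda>x. indicator {0..2*pi} x *\<^sub>R f (cis x)"]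
    by auto
  finally show ?thesis .
qed

lemma integral_circle_eq:
  fixes f :: "complex \<Rightarrow> 'a::{banach, second_countable_topology}"
  assumes [measurable]: "f \<in> borel_measurable circle_measure"
  shows "(\<integral>z. f z \<partial>circle_measure) = (1/(2*pi)) *\<^sub>R (LINT x:{0..2*pi}|lborel. f (cis x))"
proof -
  have [measurable]: "f \<in> borel_measurable (restrict_space borel (sphere 0 1))"
    using assms sets_circle by (simp cong: measurable_cong_sets)
  have [measurable]: "(\<lambda>x. f (cis x)) \<in> borel_measurable lborel"
    by (rule measurable_comp_cis) fact
  have "(\<integral>z. f z \<partial>circle_measure) = (\<integral>x. f (cis x) \<partial>uniform_measure lborel {0..2*pi})"
    unfolding circle_measure_def by (rule integral_distr) measurable
  also have "\<dots> = (\<integral>x. (indicator {0..2*pi} x / (2*pi)) *\<^sub>R f (cis x) \<partial>lborel)"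
    unfolding uniform_measure_density by (intro integral_density) auto
  also have "\<dots> = (\<integral>x. (1/(2*pi)) *\<^sub>R (indicator {0..2*pi} x *\<^sub>R f (cis x)) \<partial>lborel)"
    by (rule arg_cong[where f = "integral\<^sup>L lborel"]) (auto simp: fun_eq_iff)
  also have "\<dots> = (1/(2*pi)) *\<^sub>R (LINT x:{0..2*pi}|lborel. f (cis x))"
    unfolding set_lebesgue_integral_def by (rule integral_scaleR_right)
  finally show ?thesis .
qed

lemma AE_sphere: "(\<And>z. norm z = 1 \<Longrightarrow> P z) \<Longrightarrow> AE z in circle_measure. P z"
  by (rule AE_I2) simp

lemma norm_powi_unit: "norm (z::complex) = 1 \<Longrightarrow> norm (z powi n) = 1"
  by (simp add: norm_power_int)

lemma cnj_powi_unit: 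
  assumes "norm (z::complex) = 1" 
  shows "cnj z powi n = z powi (-n)"
proof -
  have "cnj z * z = 1"
    using assms complex_norm_square[of z] by (simp add: mult.commute)
  then have "cnj z = inverse z"
    by (metis inverse_unique mult.commute)
  then show ?thesis
    by (simp add: power_int_inverse power_int_minus)
qed

lemma continuous_on_powi_sphere [continuous_intros]:
  "continuous_on (sphere (0::complex) 1) (\<lambda>z. z powi n)"
  by (intro continuous_on_power_int continuous_intros) auto

lemma measurable_powi_circle [measurable]: "(\<lambda>z. z powi n) \<in> borel_measurable circle_measure"
  by (intro continuous_measurable_circle continuous_intros)

lemma integral_powi_circle: "(\<integral>z. z powi n \<partial>circle_measure) = (if n = 0 then 1 else 0)"
proof (cases "n = 0")
  case False
  have "((\<lambda>x. cis (of_int n * x) / (\<i> * of_int n)) has_vector_derivative cis x powi n)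
      (at x within {0..2*pi})" for x
  proof -
    have "((\<lambda>w. exp (\<i> * of_int n * w) / (\<i> * of_int n)) has_field_derivative exp (\<i> * of_int n * of_real x))
        (at (of_real x))"
      using False by (auto intro!: derivative_eq_intros)
    then have "((\<lambda>x. exp (\<i> * of_int n * of_real x) / (\<i> * of_int n)) has_vector_derivative
        exp (\<i> * of_int n * of_real x)) (at x within {0..2*pi})"
      using has_vector_derivative_real_field has_vector_derivative_at_within by fastforce
    then show ?thesis
      by (simp add: cis_conv_exp power_int_def exp_of_nat_mult[symmetric] mult_ac exp_minus[symmetric])
  qed
  moreover have "continuous_on {0..2*pi} (\<lambda>x. cis x powi n)"
    by (intro continuous_intros continuous_on_power_int) auto
  ultimately have "(LINT x:{0..2*pi}|lborel. cis x powi n) =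
      cis (of_int n * (2*pi)) / (\<i> * of_int n) - cis (of_int n * 0) / (\<i> * of_int n)"
    unfolding set_lebesgue_integral_def by (intro integral_FTC_Icc) auto
  also have "cis (of_int n * (2*pi)) = 1"
    using cis_multiple_2pi[of "of_int n"] by (simp add: mult_ac)
  finally show ?thesis
    using False by (simp add: integral_circle_eq)
next
  case True
  then show ?thesis
    using circle.prob_space by (simp del: space_circle)
qed

subsection \<open>Square integrable functions\<close>

lemma L2_measurable: "f \<in> L2_circle \<Longrightarrow> f \<in> borel_measurable circle_measure"
  by (simp add: L2_circle_def)

lemma L2_sq_integrable: "f \<in> L2_circle \<Longrightarrow> integrable circle_measure (\<lambda>z. (norm (f z))\<^sup>2)"
  by (simp add: L2_circle_def)

lemma L2_dominated:
  fixes f :: "complex \<Rightarrow> 'a::euclidean_space" and g :: "complex \<Rightarrow> real"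
  assumes "f \<in> borel_measurable circle_measure" "integrable circle_measure g"
    and "AE z in circle_measure. (norm (f z))\<^sup>2 \<le> g z"
  shows "f \<in> L2_circle"
proof -
  have "integrable circle_measure (\<lambda>z. (norm (f z))\<^sup>2)"
    using assms by (intro Bochner_Integration.integrable_bound[OF assms(2)]) (auto elim!: eventually_mono)
  then show ?thesis
    using assms by (simp add: L2_circle_def)
qed

lemma norm_mult_le_sq: "norm a * norm b \<le> (norm a)\<^sup>2 + (norm b)\<^sup>2"
  using sum_squares_bound[of "norm a" "norm b"] zero_le_power2[of "norm a"] zero_le_power2[of "norm b"]
  by linarith

lemma norm_add_sq_le: "(norm (a + b))\<^sup>2 \<le> 2 * (norm a)\<^sup>2 + 2 * (norm b)\<^sup>2"
proof -
  have "(norm (a + b))\<^sup>2 \<le> (norm a + norm b)\<^sup>2"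
    by (intro power_mono norm_triangle_ineq) auto
  also have "\<dots> \<le> 2 * (norm a)\<^sup>2 + 2 * (norm b)\<^sup>2"
    using sum_squares_bound[of "norm a" "norm b"] by (simp add: power2_sum)
  finally show ?thesis .
qed

lemma L2_integrable:
  fixes f :: "complex \<Rightarrow> 'a::euclidean_space"
  assumes "f \<in> L2_circle"
  shows "integrable circle_measure f"
proof (rule Bochner_Integration.integrable_bound[of _ "\<lambda>z. 1 + (norm (f z))\<^sup>2"])
  show "AE z in circle_measure. norm (f z) \<le> norm (1 + (norm (f z))\<^sup>2)"
    using norm_mult_le_sq[of "1::real"] by (auto intro!: AE_I2)
qed (use assms in \<open>auto simp: L2_circle_def\<close>)

lemma L2_mult_integrable:
  fixes f g :: "complex \<Rightarrow> complex"
  assumes "f \<in> L2_circle" "g \<in> L2_circle"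
  shows "integrable circle_measure (\<lambda>z. f z * g z)"
proof (rule Bochner_Integration.integrable_bound[of _ "\<lambda>z. (norm (f z))\<^sup>2 + (norm (g z))\<^sup>2"])
  show "AE z in circle_measure. norm (f z * g z) \<le> norm ((norm (f z))\<^sup>2 + (norm (g z))\<^sup>2)"
    using norm_mult_le_sq by (intro AE_I2) (auto simp: norm_mult)
qed (use assms in \<open>auto simp: L2_circle_def\<close>)

lemma L2_add:
  fixes f g :: "complex \<Rightarrow> 'a::euclidean_space"
  assumes "f \<in> L2_circle" "g \<in> L2_circle"
  shows "(\<lambda>z. f z + g z) \<in> L2_circle"
proof (rule L2_dominated[of _ "\<lambda>z. 2 * (norm (f z))\<^sup>2 + 2 * (norm (g z))\<^sup>2"])
  show "AE z in circle_measure. (norm (f z + g z))\<^sup>2 \<le> 2 * (norm (f z))\<^sup>2 + 2 * (norm (g z))\<^sup>2"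
    by (intro AE_I2 norm_add_sq_le)
qed (use assms in \<open>auto simp: L2_circle_def\<close>)

lemma L2_cong_AE:
  fixes f g :: "complex \<Rightarrow> 'a::euclidean_space"
  assumes f: "f \<in> L2_circle" and g: "g \<in> borel_measurable circle_measure"
    and fg: "AE z in circle_measure. f z = g z"
  shows "g \<in> L2_circle"
proof (rule L2_dominated[OF g L2_sq_integrable[OF f]])
  show "AE z in circle_measure. (norm (g z))\<^sup>2 \<le> (norm (f z))\<^sup>2"
    using fg by eventually_elim (simp only: order_refl)
qed

lemma L2_bounded_mult:
  fixes f h :: "complex \<Rightarrow> complex"
  assumes "f \<in> L2_circle" "h \<in> borel_measurable circle_measure"
    and "AE z in circle_measure. norm (h z) \<le> K"
  shows "(\<lambda>z. h z * f z) \<in> L2_circle"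
proof (rule L2_dominated[of _ "\<lambda>z. K\<^sup>2 * (norm (f z))\<^sup>2"])
  show "AE z in circle_measure. (norm (h z * f z))\<^sup>2 \<le> K\<^sup>2 * (norm (f z))\<^sup>2"
    using assms(3) by eventually_elim (auto simp: norm_mult power_mult_distrib intro!: mult_right_mono power_mono)
qed (use assms in \<open>auto simp: L2_circle_def\<close>)

lemma L2_bounded:
  fixes h :: "complex \<Rightarrow> 'a::euclidean_space"
  assumes "h \<in> borel_measurable circle_measure"
    and "AE z in circle_measure. norm (h z) \<le> K"
  shows "h \<in> L2_circle"
proof (rule L2_dominated[of _ "\<lambda>z. K\<^sup>2"])
  show "AE z in circle_measure. (norm (h z))\<^sup>2 \<le> K\<^sup>2"
    using assms(2) by eventually_elim (auto intro!: power_mono)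
qed (use assms in auto)

lemma L2_continuous:
  fixes f :: "complex \<Rightarrow> 'a::euclidean_space"
  assumes "continuous_on (sphere 0 1) f"
  shows "f \<in> L2_circle"
  using assms by (auto simp: L2_circle_def intro!: continuous_measurable_circle continuous_integrable_circle continuous_intros)

lemma L2_cmult:
  fixes f :: "complex \<Rightarrow> complex"
  assumes "f \<in> L2_circle"
  shows "(\<lambda>z. c * f z) \<in> L2_circle"
  using L2_bounded_mult[OF assms, of "\<lambda>_. c" "norm c"] by simp

lemma L2_diff:
  fixes f g :: "complex \<Rightarrow> 'a::euclidean_space"
  assumes "f \<in> L2_circle" "g \<in> L2_circle"
  shows "(\<lambda>z. f z - g z) \<in> L2_circle"
  using L2_add[OF assms(1), of "\<lambda>z. - g z"] assms(2) by (simp add: L2_circle_def)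

lemma L2_powi_mult:
  assumes "f \<in> L2_circle"
  shows "(\<lambda>z. z powi n * f z) \<in> L2_circle"
  by (rule L2_bounded_mult[OF assms, of _ 1]) (auto intro!: AE_I2 simp: norm_powi_unit)

lemma measurable_cnj [measurable]:
  "f \<in> borel_measurable M \<Longrightarrow> (\<lambda>x. cnj (f x)) \<in> borel_measurable M"
  by (rule borel_measurable_continuous_on[where f = cnj]) (auto intro: continuous_intros)

lemma L2_cnj:
  assumes "f \<in> L2_circle"
  shows "(\<lambda>z. cnj (f z)) \<in> L2_circle"
  using assms measurable_cnj by (auto simp: L2_circle_def)

lemma L2_sum:
  fixes f :: "'b \<Rightarrow> complex \<Rightarrow> 'a::euclidean_space"
  assumes "\<And>i. i \<in> A \<Longrightarrow> f i \<in> L2_circle"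
  shows "(\<lambda>z. \<Sum>i\<in>A. f i z) \<in> L2_circle"
  using assms
proof (induction A rule: infinite_finite_induct)
  case (insert x F)
  then show ?case by (simp add: L2_add)
qed (auto intro!: L2_continuous continuous_intros)

text \<open>The circle has total mass one, so this is nonnegativity of a variance. It turns L^2
  closeness into the L^1 closeness that bounds Fourier coefficients.\<close>

lemma circle_integral_norm_sq_le:
  fixes f :: "complex \<Rightarrow> 'a::euclidean_space"
  assumes "f \<in> L2_circle"
  shows "(\<integral>z. norm (f z) \<partial>circle_measure)\<^sup>2 \<le> (\<integral>z. (norm (f z))\<^sup>2 \<partial>circle_measure)"
proof -
  have "circle.variance (\<lambda>z. norm (f z)) = (\<integral>z. (norm (f z))\<^sup>2 \<partial>circle_measure) - (\<integral>z. norm (f z) \<partial>circle_measure)\<^sup>2"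
    using L2_integrable[OF assms] L2_sq_integrable[OF assms] by (intro circle.variance_eq) auto
  then show ?thesis
    using circle.variance_positive[of "\<lambda>z. norm (f z)"] by linarith
qed

subsection \<open>Fourier coefficients\<close>

lemma powi_mult_integrable:
  fixes f :: "complex \<Rightarrow> complex"
  assumes "integrable circle_measure f"
  shows "integrable circle_measure (\<lambda>z. z powi n * f z)"
  using assms by (intro Bochner_Integration.integrable_bound[OF assms])
    (auto intro!: AE_I2 simp: norm_mult norm_powi_unit)

lemma fourier_coeff_norm_le:
  assumes "integrable circle_measure f"
  shows "norm (fourier_coeff f n) \<le> (\<integral>z. norm (f z) \<partial>circle_measure)"
proof -
  have "norm (fourier_coeff f n) \<le> (\<integral>z. norm (z powi (-n) * f z) \<partial>circle_measure)"
    unfolding fourier_coeff_def by (rule integral_norm_bound)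
  also have "\<dots> = (\<integral>z. norm (f z) \<partial>circle_measure)"
    by (rule Bochner_Integration.integral_cong) (auto simp: norm_mult norm_powi_unit)
  finally show ?thesis .
qed

lemma fourier_coeff_cong_AE:
  assumes "AE z in circle_measure. f z = g z"
    "f \<in> borel_measurable circle_measure" "g \<in> borel_measurable circle_measure"
  shows "fourier_coeff f n = fourier_coeff g n"
  unfolding fourier_coeff_def using assms by (intro integral_cong_AE) auto

lemma fourier_coeff_add:
  "integrable circle_measure f \<Longrightarrow> integrable circle_measure g \<Longrightarrow>
    fourier_coeff (\<lambda>z. f z + g z) n = fourier_coeff f n + fourier_coeff g n"
  by (simp add: fourier_coeff_def powi_mult_integrable distrib_left)

lemma fourier_coeff_diff:
  "integrable circle_measure f \<Longrightarrow> integrable circle_measure g \<Longrightarrow>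
    fourier_coeff (\<lambda>z. f z - g z) n = fourier_coeff f n - fourier_coeff g n"
  by (simp add: fourier_coeff_def powi_mult_integrable right_diff_distrib)

lemma fourier_coeff_cmult: "fourier_coeff (\<lambda>z. c * f z) n = c * fourier_coeff f n"
proof -
  have "fourier_coeff (\<lambda>z. c * f z) n = (\<integral>z. c * (z powi (-n) * f z) \<partial>circle_measure)"
    unfolding fourier_coeff_def by (simp add: mult_ac)
  then show ?thesis
    by (simp add: fourier_coeff_def)
qed

lemma fourier_coeff_sum:
  assumes "\<And>i. i \<in> A \<Longrightarrow> integrable circle_measure (f i)"
  shows "fourier_coeff (\<lambda>z. \<Sum>i\<in>A. f i z) n = (\<Sum>i\<in>A. fourier_coeff (f i) n)"
  unfolding fourier_coeff_def sum_distrib_left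
  by (rule Bochner_Integration.integral_sum) (auto intro: powi_mult_integrable assms)

lemma fourier_coeff_cnj: "fourier_coeff (\<lambda>z. cnj (f z)) n = cnj (fourier_coeff f (- n))"
proof -
  have "fourier_coeff (\<lambda>z. cnj (f z)) n = (\<integral>z. cnj (z powi n * f z) \<partial>circle_measure)"
    unfolding fourier_coeff_def by (rule Bochner_Integration.integral_cong) (auto simp: cnj_powi_unit)
  also have "\<dots> = cnj (\<integral>z. z powi n * f z \<partial>circle_measure)"
    by (rule Bochner_Integration.integral_cnj)
  finally show ?thesis
    by (simp add: fourier_coeff_def)
qed

lemma fourier_coeff_powi_mult: "fourier_coeff (\<lambda>z. z powi k * f z) n = fourier_coeff f (n - k)"
  unfolding fourier_coeff_def
proof (rule Bochner_Integration.integral_cong)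
  fix z :: complex assume "z \<in> space circle_measure"
  then have "z \<noteq> 0" by auto
  then show "z powi (-n) * (z powi k * f z) = z powi (- (n - k)) * f z"
    by (simp add: power_int_diff power_int_minus field_simps power_int_add)
qed simp

lemma fourier_coeff_powi: "fourier_coeff (\<lambda>z. z powi k) n = (if n = k then 1 else 0)"
  using fourier_coeff_powi_mult[of k "\<lambda>_. 1" n] integral_powi_circle[of "k - n"]
  by (simp add: fourier_coeff_def algebra_simps)

lemma powi_integrable: "integrable circle_measure (\<lambda>z. z powi k)"
  by (intro continuous_integrable_circle continuous_intros)

lemma fourier_coeff_trig_poly:
  assumes "finite A"
  shows "fourier_coeff (\<lambda>z. \<Sum>k\<in>A. c k * z powi k) n = (if n \<in> A then c n else 0)"
  using assms powi_integrable
  by (subst fourier_coeff_sum) (auto simp: fourier_coeff_cmult fourier_coeff_powi if_distrib cong: if_cong)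

lemma trig_poly_L2: "(\<lambda>z. \<Sum>k\<in>A. c k * z powi k) \<in> L2_circle"
  by (intro L2_sum L2_cmult L2_continuous continuous_intros)

lemma integral_mult_trig_poly:
  assumes "integrable circle_measure f"
  shows "(\<integral>z. f z * cnj (\<Sum>k\<in>A. c k * z powi k) \<partial>circle_measure) = (\<Sum>k\<in>A. fourier_coeff f k * cnj (c k))"
proof -
  have "(\<integral>z. f z * cnj (\<Sum>k\<in>A. c k * z powi k) \<partial>circle_measure) =
      (\<integral>z. (\<Sum>k\<in>A. cnj (c k) * (z powi (-k) * f z)) \<partial>circle_measure)"
    by (rule Bochner_Integration.integral_cong) (auto simp: cnj_powi_unit sum_distrib_left mult_ac intro!: sum.cong)
  also have "\<dots> = (\<Sum>k\<in>A. fourier_coeff f k * cnj (c k))"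
    using powi_mult_integrable[OF assms]
    by (subst Bochner_Integration.integral_sum) (simp_all add: fourier_coeff_def mult.commute)
  finally show ?thesis .
qed

lemma integral_norm_sq_trig_poly:
  assumes "finite A"
  shows "(\<integral>z. (norm (\<Sum>k\<in>A. c k * z powi k))\<^sup>2 \<partial>circle_measure) = (\<Sum>k\<in>A. (norm (c k))\<^sup>2)"
proof -
  let ?p = "\<lambda>z. \<Sum>k\<in>A. c k * z powi k"
  have "of_real (\<integral>z. (norm (?p z))\<^sup>2 \<partial>circle_measure) = (\<integral>z. ?p z * cnj (?p z) \<partial>circle_measure)"
    by (subst integral_complex_of_real[symmetric]) (simp add: complex_norm_square del: of_real_power cnj_sum)
  also have "\<dots> = (\<Sum>k\<in>A. fourier_coeff ?p k * cnj (c k))"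
    by (intro integral_mult_trig_poly L2_integrable trig_poly_L2)
  also have "\<dots> = of_real (\<Sum>k\<in>A. (norm (c k))\<^sup>2)"
    using assms by (simp add: fourier_coeff_trig_poly complex_norm_square del: of_real_power)
  finally show ?thesis
    using of_real_eq_iff by blast
qed

lemma norm_diff_sq: "(norm (a - b))\<^sup>2 = (norm a)\<^sup>2 + (norm b)\<^sup>2 - 2 * Re (a * cnj b)"
  unfolding cmod_power2 by (simp add: power2_eq_square algebra_simps)

lemma Bessel_inequality:
  assumes "f \<in> L2_circle" "finite A"
  shows "(\<Sum>k\<in>A. (norm (fourier_coeff f k))\<^sup>2) \<le> (\<integral>z. (norm (f z))\<^sup>2 \<partial>circle_measure)"
proof -
  let ?p = "\<lambda>z. \<Sum>k\<in>A. fourier_coeff f k * z powi k"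
  let ?S = "\<Sum>k\<in>A. (norm (fourier_coeff f k))\<^sup>2"
  have p: "?p \<in> L2_circle" by (rule trig_poly_L2)
  have "(\<integral>z. f z * cnj (?p z) \<partial>circle_measure) = of_real ?S"
    using integral_mult_trig_poly[OF L2_integrable[OF assms(1)], of "fourier_coeff f" A]
    by (simp only: complex_norm_square of_real_sum)
  moreover have I: "integrable circle_measure (\<lambda>z. f z * cnj (?p z))"
    using assms(1) L2_cnj[OF p] by (rule L2_mult_integrable)
  ultimately have R: "(\<integral>z. Re (f z * cnj (?p z)) \<partial>circle_measure) = ?S"
    by (simp del: times_complex.sel cnj_sum)
  have "0 \<le> (\<integral>z. (norm (f z - ?p z))\<^sup>2 \<partial>circle_measure)"
    by (rule Bochner_Integration.integral_nonneg) simp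
  also have "\<dots> = (\<integral>z. (norm (f z))\<^sup>2 + (norm (?p z))\<^sup>2 - 2 * Re (f z * cnj (?p z)) \<partial>circle_measure)"
    by (intro Bochner_Integration.integral_cong refl norm_diff_sq)
  also have "\<dots> = (\<integral>z. (norm (f z))\<^sup>2 \<partial>circle_measure) + ?S - 2 * ?S"
    using L2_sq_integrable[OF assms(1)] L2_sq_integrable[OF p] I R integral_norm_sq_trig_poly[OF assms(2), of "fourier_coeff f"]
    by (simp add: integrable_Re del: times_complex.sel cnj_sum)
  finally show ?thesis by simp
qed

subsection \<open>Uniqueness of Fourier coefficients\<close>

text \<open>On the circle Re z and Im z are combinations of z and its inverse. Multiplication by a
  real linear function therefore only shifts and mixes Fourier coefficients, which connects the
  polynomials of Stone--Weierstrass with Fourier series.\<close>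

lemma bounded_linear_on_circle:
  fixes p :: "complex \<Rightarrow> real"
  assumes "bounded_linear p"
  obtains \<alpha> \<beta> where "\<And>z. norm z = 1 \<Longrightarrow> of_real (p z) = \<alpha> * z powi 1 + \<beta> * z powi (-1)"
proof
  fix z :: complex assume z: "norm z = 1"
  interpret bounded_linear p by fact
  have "p z = p (Re z *\<^sub>R 1 + Im z *\<^sub>R \<i>)"
    by (rule arg_cong[where f = p]) (simp add: complex_eq_iff)
  also have "\<dots> = Re z * p 1 + Im z * p \<i>"
    by (simp only: add scaleR) simp
  finally have "p z = Re z * p 1 + Im z * p \<i>" .
  moreover have zc: "z powi (-1) = cnj z"
    using cnj_powi_unit[OF z, of 1] by simp
  ultimately show "of_real (p z) = (Complex (p 1 / 2) (- p \<i> / 2)) * z powi 1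
      + (Complex (p 1 / 2) (p \<i> / 2)) * z powi (-1)"
    unfolding zc by (simp add: complex_eq_iff field_simps)
qed

lemma integrable_continuous_mult:
  fixes f g :: "complex \<Rightarrow> complex"
  assumes "continuous_on (sphere 0 1) g" "integrable circle_measure f"
  shows "integrable circle_measure (\<lambda>z. g z * f z)"
proof -
  have "compact (g ` sphere 0 1)"
    using assms by (intro compact_continuous_image) auto
  then obtain B where B: "\<And>z. z \<in> sphere 0 1 \<Longrightarrow> norm (g z) \<le> B"
    using compact_imp_bounded bounded_iff by (metis imageI)
  have [measurable]: "g \<in> borel_measurable circle_measure"
    by (rule continuous_measurable_circle) fact
  show ?thesis
  proof (rule Bochner_Integration.integrable_bound)
    show "integrable circle_measure (\<lambda>z. of_real B * f z)"
      using assms by simp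
    show "AE z in circle_measure. norm (g z * f z) \<le> norm (of_real B * f z)"
      by (rule AE_I2) (use B in \<open>auto simp: norm_mult intro!: mult_right_mono dest: order_trans[OF _ abs_ge_self]\<close>)
  qed (use assms in measurable)
qed

lemma fourier_coeff_polynomial_mult_zero:
  fixes f :: "complex \<Rightarrow> complex"
  assumes "real_polynomial_function p" "integrable circle_measure f" "\<And>n. fourier_coeff f n = 0"
  shows "fourier_coeff (\<lambda>z. of_real (p z) * f z) n = 0"
  using assms
\<comment> \<open>In the product case the hypothesis for \<open>p\<close> is applied to
  \<open>q f\<close>, whose coefficients all vanish by the hypothesis for \<open>q\<close>; hence
  \<open>f\<close> and \<open>n\<close> must stay arbitrary.\<close>
proof (induction p arbitrary: f n rule: real_polynomial_function.induct)
  case (linear p)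
  obtain \<alpha> \<beta> where ab: "\<And>z. norm z = 1 \<Longrightarrow> of_real (p z) = \<alpha> * z powi 1 + \<beta> * z powi (-1)"
    using bounded_linear_on_circle linear.hyps by blast
  have "fourier_coeff (\<lambda>z. of_real (p z) * f z) n =
      fourier_coeff (\<lambda>z. \<alpha> * (z powi 1 * f z) + \<beta> * (z powi (-1) * f z)) n"
    unfolding fourier_coeff_def
    by (rule Bochner_Integration.integral_cong) (auto simp: ab algebra_simps simp del: power_int_1_right)
  also have "\<dots> = \<alpha> * fourier_coeff f (n - 1) + \<beta> * fourier_coeff f (n + 1)"
    using fourier_coeff_powi_mult[of 1 f n] fourier_coeff_powi_mult[of "-1" f n]
      powi_mult_integrable[OF linear.prems(1), of 1] powi_mult_integrable[OF linear.prems(1), of "-1"]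
    by (subst fourier_coeff_add) (auto simp: fourier_coeff_cmult simp del: power_int_1_right)
  finally show ?case
    using linear.prems by simp
next
  case (const c)
  then show ?case by (simp add: fourier_coeff_cmult)
next
  case (add p q)
  have c: "continuous_on (sphere (0::complex) 1) (\<lambda>z. complex_of_real (r z))"
    if "real_polynomial_function r" for r
    using that by (intro continuous_intros) (simp add: continuous_on_polymonial_function real_polynomial_function_eq)
  have "integrable circle_measure (\<lambda>z. of_real (p z) * f z)" "integrable circle_measure (\<lambda>z. of_real (q z) * f z)"
    using add by (auto intro!: integrable_continuous_mult c)
  with add show ?case
    by (simp add: distrib_right fourier_coeff_add)
next
  case (mult p q)
  have c: "continuous_on (sphere (0::complex) 1) (\<lambda>z. complex_of_real (q z))"
    using mult by (intro continuous_intros) (simp add: continuous_on_polymonial_function real_polynomial_function_eq)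
  have "integrable circle_measure (\<lambda>z. of_real (q z) * f z)"
    using mult by (auto intro!: integrable_continuous_mult c)
  then have "fourier_coeff (\<lambda>z. of_real (p z) * (of_real (q z) * f z)) n = 0"
    using mult.IH mult.prems by blast
  then show ?case
    by (simp add: mult.assoc)
qed

text \<open>Polynomials integrate to zero against \<open>f\<close>, and a uniform error e in
  approximating \<open>g\<close> costs at most e times the L^1 norm of \<open>f\<close>.\<close>

lemma integral_continuous_mult_zero:
  fixes f :: "complex \<Rightarrow> complex" and g :: "complex \<Rightarrow> real"
  assumes f: "integrable circle_measure f" "\<And>n. fourier_coeff f n = 0"
    and g: "continuous_on (sphere 0 1) g"
  shows "(\<integral>z. of_real (g z) * f z \<partial>circle_measure) = 0"
proof -
  let ?I = "\<integral>z. norm (f z) \<partial>circle_measure"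
  have "norm (\<integral>z. of_real (g z) * f z \<partial>circle_measure) \<le> e * ?I" if e: "e > 0" for e
  proof -
    obtain p where p: "real_polynomial_function p" "\<And>z. z \<in> sphere 0 1 \<Longrightarrow> \<bar>g z - p z\<bar> < e"
      using Stone_Weierstrass_real_polynomial_function[OF compact_sphere g e] by blast
    have cp: "continuous_on (sphere 0 1) p"
      using p(1) by (simp add: continuous_on_polymonial_function real_polynomial_function_eq)
    have ip: "integrable circle_measure (\<lambda>z. of_real (p z) * f z)"
      by (intro integrable_continuous_mult continuous_intros cp f)
    have ig: "integrable circle_measure (\<lambda>z. of_real (g z) * f z)"
      by (intro integrable_continuous_mult continuous_intros g f)
    have "(\<integral>z. of_real (p z) * f z \<partial>circle_measure) = 0"
      using fourier_coeff_polynomial_mult_zero[OF p(1) f, of 0] by (simp add: fourier_coeff_def)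
    then have "(\<integral>z. of_real (g z) * f z \<partial>circle_measure) = (\<integral>z. of_real (g z) * f z - of_real (p z) * f z \<partial>circle_measure)"
      using ip ig by simp
    also have "norm \<dots> \<le> (\<integral>z. norm (of_real (g z) * f z - of_real (p z) * f z) \<partial>circle_measure)"
      by (rule integral_norm_bound)
    also have "\<dots> \<le> (\<integral>z. e * norm (f z) \<partial>circle_measure)"
    proof (rule integral_mono)
      fix z assume "z \<in> space circle_measure"
      then have "\<bar>g z - p z\<bar> \<le> e"
        using p(2)[of z] by simp
      moreover have "of_real (g z) * f z - of_real (p z) * f z = of_real (g z - p z) * f z"
        by (simp add: algebra_simps)
      ultimately show "norm (of_real (g z) * f z - of_real (p z) * f z) \<le> e * norm (f z)"
        by (simp only: norm_mult norm_of_real mult_right_mono norm_ge_zero)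
    qed (use ip ig f in auto)
    finally show ?thesis by simp
  qed
  moreover have "0 \<le> ?I"
    by simp
  ultimately have "norm (\<integral>z. of_real (g z) * f z \<partial>circle_measure) \<le> 0 + e" if "e > 0" for e
  proof -
    have aux: "e / (t + 1) * t \<le> e" if "0 \<le> t" for t :: real
      using that \<open>e > 0\<close> by (simp add: field_simps)
    \<comment> \<open>The denominator is \<open>?I + 1\<close> because the L^1 norm
      \<open>?I\<close> may be zero.\<close>
    have "e / (?I + 1) > 0" using that \<open>0 \<le> ?I\<close> by (intro divide_pos_pos) linarith+
    then have "norm (\<integral>z. of_real (g z) * f z \<partial>circle_measure) \<le> e / (?I + 1) * ?I"
      using \<open>\<And>e. e > 0 \<Longrightarrow> _\<close> by blast
    also have "\<dots> \<le> e"
      by (rule aux[OF \<open>0 \<le> ?I\<close>])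
    finally show ?thesis by simp
  qed
  then have "norm (\<integral>z. of_real (g z) * f z \<partial>circle_measure) \<le> 0"
    by (rule field_le_epsilon)
  then show ?thesis by simp
qed

text \<open>The indicator of a closed set is the pointwise limit of continuous functions of the
  distance to the set, all between 0 and 1, so dominated convergence applies.\<close>

lemma set_integral_closed_zero:
  fixes f :: "complex \<Rightarrow> complex"
  assumes f: "integrable circle_measure f" "\<And>n. fourier_coeff f n = 0"
    and C: "closed C"
  shows "(\<integral>z. indicator C z * f z \<partial>circle_measure) = 0"
\<comment> \<open>By convention \<open>infdist z {}\<close> is 0, so for empty \<open>C\<close> the
  functions \<open>g n\<close> would be constantly 1 instead of tending to 0.\<close>
proof (cases "C = {}")
  case False
  define g where "g n z = max 0 (1 - real n * infdist z C)" for n and z :: complex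
  have g: "continuous_on A (g n)" for n A
    unfolding g_def by (intro continuous_intros)
  have [measurable]: "(\<lambda>z. indicator C z :: complex) \<in> borel_measurable circle_measure"
  proof -
    have "(\<lambda>z. indicator C z :: complex) \<in> borel_measurable borel"
      using C by (intro borel_measurable_indicator) auto
    then show ?thesis
      by (metis measurable_restrict_space1 sets_circle measurable_cong_sets)
  qed
  have [measurable]: "g n \<in> borel_measurable circle_measure" for n
    by (rule continuous_measurable_circle[OF g])
  have "(\<lambda>n. \<integral>z. of_real (g n z) * f z \<partial>circle_measure) \<longlonglongrightarrow> (\<integral>z. indicator C z * f z \<partial>circle_measure)"
  proof (rule integral_dominated_convergence)
    show "integrable circle_measure (\<lambda>z. norm (f z))" using f by simp
    show "AE z in circle_measure. (\<lambda>n. of_real (g n z) * f z) \<longlonglongrightarrow> indicator C z * f z"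
    proof (rule AE_I2)
      fix z
      have "(\<lambda>n. g n z) \<longlonglongrightarrow> indicator C z"
      proof (cases "z \<in> C")
        case True
        then show ?thesis by (simp add: g_def)
      next
        case out: False
        then have d: "infdist z C > 0"
          using C False infdist_pos_not_in_closed by blast
        have "eventually (\<lambda>n. real n \<ge> 1 / infdist z C) sequentially"
          by (rule eventually_sequentiallyI[of "nat \<lceil>1 / infdist z C\<rceil>"]) linarith
        then have "eventually (\<lambda>n. g n z = indicator C z) sequentially"
          by eventually_elim (use d out in \<open>auto simp: g_def field_simps\<close>)
        then show ?thesis
          by (rule tendsto_eventually)
      qed
      then have "(\<lambda>n. complex_of_real (g n z) * f z) \<longlonglongrightarrow> of_real (indicator C z) * f z"
        by (intro tendsto_intros)
      moreover have "complex_of_real (indicator C z) = indicator C z"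
        by (simp add: indicator_def)
      ultimately show "(\<lambda>n. of_real (g n z) * f z) \<longlonglongrightarrow> indicator C z * f z"
        by simp
    qed
    show "AE z in circle_measure. norm (of_real (g n z) * f z) \<le> norm (f z)" for n
      by (rule AE_I2) (auto simp: norm_mult g_def infdist_nonneg intro!: mult_left_le_one_le)
  qed (use f in measurable)
  moreover have "(\<integral>z. of_real (g n z) * f z \<partial>circle_measure) = 0" for n
    by (rule integral_continuous_mult_zero[OF f g])
  ultimately show ?thesis
    by (simp add: LIMSEQ_const_iff)
qed simp

text \<open>Closed sets generate the Borel sets and are stable under intersection, so Dynkin's
  argument extends the vanishing of set integrals to all measurable sets. Uniqueness of densities is
  then applied separately to the real and imaginary parts.\<close>

theorem fourier_coeff_zero_imp_AE_zero:
  assumes f: "integrable circle_measure f" "\<And>n. fourier_coeff f n = 0"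
  shows "AE z in circle_measure. f z = 0"
proof -
  have A0: "(LINT z:A|circle_measure. f z) = 0" if "A \<in> sets circle_measure" for A
  proof -
    obtain B where B: "B \<in> sets borel" "A = sphere 0 1 \<inter> B"
      using \<open>A \<in> sets circle_measure\<close> by (auto simp: sets_circle sets_restrict_space)
    define P where "P B \<longleftrightarrow> (LINT z:(sphere 0 1 \<inter> B)|circle_measure. f z) = 0" for B
    have sets: "sphere 0 1 \<inter> B \<in> sets circle_measure" if "B \<in> sets borel" for B
      using that by (auto simp: sets_circle sets_restrict_space)
    have int: "set_integrable circle_measure A f" if "A \<in> sets circle_measure" for A
      using that f unfolding set_integrable_def by (intro integrable_mult_indicator) auto
    have closed: "P C" if "closed C" for C
    proof -
      have "(LINT z:(sphere 0 1 \<inter> C)|circle_measure. f z) = (\<integral>z. indicator C z * f z \<partial>circle_measure)"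
        unfolding set_lebesgue_integral_def
        by (rule Bochner_Integration.integral_cong) (auto simp: indicator_def)
      then show ?thesis
        using set_integral_closed_zero[OF f that] by (simp add: P_def)
    qed
    have "Int_stable (Collect closed :: complex set set)" "Collect closed \<subseteq> Pow (UNIV :: complex set)"
      "B \<in> sigma_sets UNIV (Collect closed)"
      using B by (auto simp: Int_stable_def borel_eq_closed)
    then have "P B"
    proof (induct B rule: sigma_sets_induct_disjoint)
      case (basic A)
      then show ?case using closed by simp
    next
      case empty
      then show ?case by (simp add: P_def set_lebesgue_integral_def)
    next
      case (compl A)
      have A: "A \<in> sets borel"
        using compl(1) by (simp add: borel_eq_closed)
      have "P UNIV" using closed by simp
      then have "(LINT z:(sphere 0 1)|circle_measure. f z) = 0"
        by (simp add: P_def)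
      moreover have "sphere 0 1 = (sphere 0 1 \<inter> A) \<union> (sphere 0 1 \<inter> (UNIV - A))"
        by auto
      ultimately have "0 = (LINT z:((sphere 0 1 \<inter> A) \<union> (sphere 0 1 \<inter> (UNIV - A)))|circle_measure. f z)"
        by simp
      also have "\<dots> = (LINT z:(sphere 0 1 \<inter> A)|circle_measure. f z) + (LINT z:(sphere 0 1 \<inter> (UNIV - A))|circle_measure. f z)"
        using A by (intro set_integral_Un int sets) auto
      finally show ?case
        using compl(2) by (simp add: P_def)
    next
      case (union A)
      have A: "A i \<in> sets borel" for i
        using union(2) by (auto simp: borel_eq_closed)
      have "(LINT z:(\<Union>i. sphere 0 1 \<inter> A i)|circle_measure. f z) = (\<Sum>i. (LINT z:(sphere 0 1 \<inter> A i)|circle_measure. f z))"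
      proof (rule lebesgue_integral_countable_add)
        show "sphere 0 1 \<inter> A i \<inter> (sphere 0 1 \<inter> A j) = {}" if "i \<noteq> j" for i j
          using union(1) that by (auto simp: disjoint_family_on_def)
        show "set_integrable circle_measure (\<Union>i. sphere 0 1 \<inter> A i) f"
          by (rule int) (use A sets in auto)
      qed (use A sets in auto)
      then show ?case
        using union(3) by (simp add: P_def)
    qed
    then show ?thesis
      using B by (simp add: P_def)
  qed
  have int: "set_integrable circle_measure A f" if "A \<in> sets circle_measure" for A
    using that f unfolding set_integrable_def by (intro integrable_mult_indicator) auto
  have "AE z in circle_measure. Re (f z) = 0"
  proof (rule density_unique_real)
    fix A assume A: "A \<in> sets circle_measure"
    have "(LINT z:A|circle_measure. Re (f z)) = (\<integral>z. Re (indicator A z *\<^sub>R f z) \<partial>circle_measure)"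
      by (simp add: set_lebesgue_integral_def)
    also have "\<dots> = Re (LINT z:A|circle_measure. f z)"
      unfolding set_lebesgue_integral_def
      by (rule integral_Re) (use int[OF A] in \<open>simp add: set_integrable_def\<close>)
    finally show "(LINT z:A|circle_measure. Re (f z)) = (LINT z:A|circle_measure. 0)"
      using A0[OF A] by (simp add: set_lebesgue_integral_def)
  qed (use f in \<open>auto intro: integrable_Re\<close>)
  moreover have "AE z in circle_measure. Im (f z) = 0"
  proof (rule density_unique_real)
    fix A assume A: "A \<in> sets circle_measure"
    have "(LINT z:A|circle_measure. Im (f z)) = (\<integral>z. Im (indicator A z *\<^sub>R f z) \<partial>circle_measure)"
      by (simp add: set_lebesgue_integral_def)
    also have "\<dots> = Im (LINT z:A|circle_measure. f z)"
      unfolding set_lebesgue_integral_def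
      by (rule integral_Im) (use int[OF A] in \<open>simp add: set_integrable_def\<close>)
    finally show "(LINT z:A|circle_measure. Im (f z)) = (LINT z:A|circle_measure. 0)"
      using A0[OF A] by (simp add: set_lebesgue_integral_def)
  qed (use f in \<open>auto intro: integrable_Im\<close>)
  ultimately show ?thesis
    by eventually_elim (simp add: complex_eq_iff)
qed

corollary fourier_coeff_unique:
  assumes "integrable circle_measure f" "integrable circle_measure g"
    and "\<And>n. fourier_coeff f n = fourier_coeff g n"
  shows "AE z in circle_measure. f z = g z"
  using fourier_coeff_zero_imp_AE_zero[of "\<lambda>z. f z - g z"] assms by (simp add: fourier_coeff_diff)

subsection \<open>The Riesz--Fischer theorem\<close>

text \<open>Fatou gives membership of the limit and its norm bound together.
  \<open>Riesz_Fischer\<close> uses it for the limit itself and for its distance to each partial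
  sum.\<close>

lemma L2_Fatou:
  fixes g :: "complex \<Rightarrow> complex"
  assumes u: "\<And>j::nat. u j \<in> L2_circle" "\<And>j. (\<integral>z. (norm (u j z))\<^sup>2 \<partial>circle_measure) \<le> B"
    and lim: "AE z in circle_measure. (\<lambda>j. u j z) \<longlonglongrightarrow> g z"
    and [measurable]: "g \<in> borel_measurable circle_measure"
  shows "g \<in> L2_circle" "(\<integral>z. (norm (g z))\<^sup>2 \<partial>circle_measure) \<le> B"
proof -
  note [measurable] = L2_measurable[OF u(1)]
  have "0 \<le> (\<integral>z. (norm (u 0 z))\<^sup>2 \<partial>circle_measure)"
    by (rule Bochner_Integration.integral_nonneg) simp
  then have B: "0 \<le> B" using u(2)[of 0] by linarith
  have "(\<integral>\<^sup>+z. ennreal ((norm (g z))\<^sup>2) \<partial>circle_measure) =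
      (\<integral>\<^sup>+z. liminf (\<lambda>j. ennreal ((norm (u j z))\<^sup>2)) \<partial>circle_measure)"
  proof (rule nn_integral_cong_AE)
    show "AE z in circle_measure. ennreal ((norm (g z))\<^sup>2) = liminf (\<lambda>j. ennreal ((norm (u j z))\<^sup>2))"
      using lim
    proof eventually_elim
      case (elim z)
      then have "(\<lambda>j. ennreal ((norm (u j z))\<^sup>2)) \<longlonglongrightarrow> ennreal ((norm (g z))\<^sup>2)"
        by (intro tendsto_intros)
      then show ?case
        by (subst lim_imp_Liminf) auto
    qed
  qed
  also have "\<dots> \<le> liminf (\<lambda>j. \<integral>\<^sup>+z. ennreal ((norm (u j z))\<^sup>2) \<partial>circle_measure)"
    by (rule nn_integral_liminf) measurable
  also have "\<dots> \<le> liminf (\<lambda>j. ennreal B)"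
    using u L2_sq_integrable[OF u(1)]
    by (intro Liminf_mono always_eventually) (auto simp: nn_integral_eq_integral intro!: ennreal_leI)
  also have "\<dots> = ennreal B"
    by (simp add: Liminf_const)
  finally have *: "(\<integral>\<^sup>+z. ennreal ((norm (g z))\<^sup>2) \<partial>circle_measure) \<le> ennreal B" .
  then have "integrable circle_measure (\<lambda>z. (norm (g z))\<^sup>2)"
    by (intro integrableI_bounded) (auto simp: top.not_eq_extremum[symmetric] top_unique)
  then show "g \<in> L2_circle" by (simp add: L2_circle_def)
  show "(\<integral>z. (norm (g z))\<^sup>2 \<partial>circle_measure) \<le> B"
    using * B by (intro integral_real_bounded) auto
qed

text \<open>The sum of the norms has finite integral, hence is finite almost everywhere. This
  replaces an appeal to completeness of a function space.\<close>

lemma AE_summable_of_L1_summable: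
  fixes v :: "nat \<Rightarrow> complex \<Rightarrow> complex"
  assumes [measurable]: "\<And>j. integrable circle_measure (v j)"
    and b: "\<And>j. (\<integral>z. norm (v j z) \<partial>circle_measure) \<le> b j" "summable b"
  shows "AE z in circle_measure. summable (\<lambda>j. v j z)"
proof -
  have b0: "0 \<le> b j" for j
    by (rule order_trans[OF _ b(1)]) simp
  have "(\<integral>\<^sup>+z. (\<Sum>j. ennreal (norm (v j z))) \<partial>circle_measure) = (\<Sum>j. \<integral>\<^sup>+z. ennreal (norm (v j z)) \<partial>circle_measure)"
    by (rule nn_integral_suminf) measurable
  also have "\<dots> \<le> (\<Sum>j. ennreal (b j))"
    using assms by (intro suminf_le) (auto simp: nn_integral_eq_integral intro!: ennreal_leI)
  also have "\<dots> < \<infinity>"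
    using b(2) b0 by (simp add: suminf_ennreal2 less_top)
  finally have "AE z in circle_measure. (\<Sum>j. ennreal (norm (v j z))) \<noteq> \<infinity>"
    by (intro nn_integral_noteq_infinite) auto
  then show ?thesis
  proof eventually_elim
    case (elim z)
    then have "summable (\<lambda>j. norm (v j z))"
      by (intro summable_suminf_not_top) auto
    then show ?case by (rule summable_norm_cancel)
  qed
qed

text \<open>A subsequence of the partial sums is made to converge almost everywhere, and its limit
  is shown to have the right coefficients. Carrying the bound \<open>B\<close> to the limit is what
  later yields the Parseval estimate.\<close>

theorem Riesz_Fischer:
  fixes c :: "int \<Rightarrow> complex"
  assumes B: "\<And>A. finite A \<Longrightarrow> (\<Sum>k\<in>A. (norm (c k))\<^sup>2) \<le> B"
  obtains g where "g \<in> L2_circle" "\<And>n. fourier_coeff g n = c n"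
    "(\<integral>z. (norm (g z))\<^sup>2 \<partial>circle_measure) \<le> B"
proof -
  define A where "A N = {- int N..int N}" for N
  define S where "S N = (\<Sum>k\<in>A N. (norm (c k))\<^sup>2)" for N
  define p where "p N z = (\<Sum>k\<in>A N. c k * z powi k)" for N z
  have fin: "finite (A N)" for N by (simp add: A_def)
  have sub: "A M \<subseteq> A N" if "M \<le> N" for M N using that by (auto simp: A_def)
  have pL2: "p N \<in> L2_circle" for N
    unfolding p_def by (rule trig_poly_L2)
  have diff: "(\<integral>z. (norm (p N z - p M z))\<^sup>2 \<partial>circle_measure) = S N - S M" if "M \<le> N" for M N
  proof -
    have "p N z - p M z = (\<Sum>k\<in>A N - A M. c k * z powi k)" for z
      unfolding p_def using sum_diff[OF fin sub[OF that]] by metis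
    moreover have "S N - S M = (\<Sum>k\<in>A N - A M. (norm (c k))\<^sup>2)"
      unfolding S_def using sum_diff[OF fin sub[OF that]] by metis
    ultimately show ?thesis
      using fin by (simp add: integral_norm_sq_trig_poly)
  qed
  have mono: "S M \<le> S N" if "M \<le> N" for M N
    unfolding S_def by (rule sum_mono2[OF fin sub[OF that]]) simp
  have "Bseq S"
  proof (rule BseqI')
    show "norm (S n) \<le> B" for n
      using B[OF fin] by (simp add: S_def sum_nonneg)
  qed
  then obtain s where s: "S \<longlonglongrightarrow> s"
    using Bseq_mono_convergent[of S] mono by (auto simp: convergent_def)
  have Ss: "S N \<le> s" for N
    using incseq_le[OF _ s] mono by (auto simp: incseq_def)
  \<comment> \<open>The differences of \<open>S\<close> are squared L^2 distances. A tail below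
    (1/4)^n makes the L^1 norm of the n-th increment at most (1/2)^n, which is summable.\<close>
  have "\<exists>r. \<forall>n. s - S (r n) < (1/4)^n \<and> r n < r (Suc n)"
  proof (rule dependent_nat_choice)
    have ev: "eventually (\<lambda>N. s - S N < e) sequentially" if "e > 0" for e
      using order_tendstoD(1)[OF s, of "s - e"] that by (auto elim!: eventually_mono)
    show "\<exists>x. s - S x < (1/4)^0"
      using ev[of 1] by (auto simp: eventually_sequentially)
    fix x n
    have "eventually (\<lambda>y. s - S y < (1/4)^Suc n \<and> x < y) sequentially"
      using ev[of "(1/4)^Suc n"] eventually_gt_at_top[of x] by (intro eventually_conj) auto
    then show "\<exists>y. s - S y < (1/4)^Suc n \<and> x < y"
      by (auto simp: eventually_sequentially)
  qed
  then obtain r where r: "\<And>n. s - S (r n) < (1/4)^n" "\<And>n. r n < r (Suc n)"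
    by blast
  have rm: "strict_mono r"
    using r(2) by (simp add: strict_mono_Suc_iff)
  define v where "v j z = p (r (Suc j)) z - p (r j) z" for j z
  have vL2: "v j \<in> L2_circle" for j
    unfolding v_def by (intro L2_diff pL2)
  have vb: "(\<integral>z. norm (v j z) \<partial>circle_measure) \<le> (1/2)^j" for j
  proof (rule power2_le_imp_le)
    have "(\<integral>z. norm (v j z) \<partial>circle_measure)\<^sup>2 \<le> (\<integral>z. (norm (v j z))\<^sup>2 \<partial>circle_measure)"
      by (rule circle_integral_norm_sq_le[OF vL2])
    also have "\<dots> = S (r (Suc j)) - S (r j)"
      unfolding v_def using r(2)[of j] by (intro diff) simp
    also have "\<dots> \<le> (1/4)^j"
      using r(1)[of j] Ss[of "r (Suc j)"] by simp
    also have "\<dots> = ((1/2)^j)\<^sup>2"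
      by (simp add: power_even_eq[symmetric] power_mult_distrib power2_eq_square flip: power_mult_distrib)
    finally show "(\<integral>z. norm (v j z) \<partial>circle_measure)\<^sup>2 \<le> ((1/2)^j)\<^sup>2" .
  qed simp
  define g where "g z = p (r 0) z + (\<Sum>j. v j z)" for z
  note [measurable] = L2_measurable[OF pL2] L2_measurable[OF vL2]
  have gm [measurable]: "g \<in> borel_measurable circle_measure"
    unfolding g_def by measurable
  have "AE z in circle_measure. summable (\<lambda>j. v j z)"
    by (rule AE_summable_of_L1_summable[where b = "\<lambda>j. (1/2)^j"]) (auto simp: vb L2_integrable[OF vL2])
  then have lim: "AE z in circle_measure. (\<lambda>j. p (r j) z) \<longlonglongrightarrow> g z"
  proof eventually_elim
    case (elim z)
    have "(\<lambda>n. \<Sum>j<n. v j z) \<longlonglongrightarrow> (\<Sum>j. v j z)"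
      by (rule summable_LIMSEQ[OF elim])
    moreover have "(\<Sum>j<n. v j z) = p (r n) z - p (r 0) z" for n
      unfolding v_def by (rule sum_lessThan_telescope)
    ultimately have "(\<lambda>n. p (r 0) z + (p (r n) z - p (r 0) z)) \<longlonglongrightarrow> g z"
      unfolding g_def by (intro tendsto_intros) simp
    then show ?case by simp
  qed
  have g: "g \<in> L2_circle" "(\<integral>z. (norm (g z))\<^sup>2 \<partial>circle_measure) \<le> B"
    using L2_Fatou[of "\<lambda>j. p (r j)", OF pL2 _ lim gm, of B] B[OF fin]
      integral_norm_sq_trig_poly[OF fin, of c] unfolding p_def by auto
  \<comment> \<open>Almost everywhere convergence is known along \<open>r\<close> only; Fatou
    applied to \<open>p (r (j + M)) - p M\<close> bounds the distance of \<open>g\<close> to every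
    \<open>p M\<close>. The shift by \<open>M\<close> guarantees that \<open>r (j + M)\<close> is at
    least \<open>M\<close>.\<close>
  have gp: "(\<integral>z. (norm (g z - p M z))\<^sup>2 \<partial>circle_measure) \<le> s - S M" for M
  proof (rule L2_Fatou(2)[where u = "\<lambda>j z. p (r (j + M)) z - p M z"])
    show "(\<lambda>z. p (r (j + M)) z - p M z) \<in> L2_circle" for j
      by (intro L2_diff pL2)
    have "M \<le> r (j + M)" for j
      using seq_suble[OF rm, of "j + M"] by simp
    then show "(\<integral>z. (norm (p (r (j + M)) z - p M z))\<^sup>2 \<partial>circle_measure) \<le> s - S M" for j
      using diff[of M "r (j + M)"] Ss[of "r (j + M)"] by simp
    show "AE z in circle_measure. (\<lambda>j. p (r (j + M)) z - p M z) \<longlonglongrightarrow> g z - p M z"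
      using lim by eventually_elim (intro tendsto_intros LIMSEQ_ignore_initial_segment)
  qed measurable
  have "fourier_coeff g n = c n" for n
  proof -
    have "(norm (fourier_coeff g n - c n))\<^sup>2 \<le> s - S M" if "nat \<bar>n\<bar> \<le> M" for M
    proof -
      have "n \<in> A M" using that by (auto simp: A_def)
      then have "fourier_coeff (p M) n = c n"
        unfolding p_def by (simp add: fourier_coeff_trig_poly fin)
      then have "fourier_coeff g n - c n = fourier_coeff (\<lambda>z. g z - p M z) n"
        by (simp add: fourier_coeff_diff L2_integrable[OF g(1)] L2_integrable[OF pL2])
      then have "norm (fourier_coeff g n - c n) \<le> (\<integral>z. norm (g z - p M z) \<partial>circle_measure)"
        using fourier_coeff_norm_le[OF L2_integrable[OF L2_diff[OF g(1) pL2]]] by simp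
      then have "(norm (fourier_coeff g n - c n))\<^sup>2 \<le> (\<integral>z. norm (g z - p M z) \<partial>circle_measure)\<^sup>2"
        by (intro power_mono) auto
      also have "\<dots> \<le> s - S M"
        using circle_integral_norm_sq_le[OF L2_diff[OF g(1) pL2]] gp[of M] by (rule order_trans)
      finally show ?thesis .
    qed
    moreover have "(\<lambda>M. s - S M) \<longlonglongrightarrow> s - s"
      by (intro tendsto_intros s)
    ultimately have "(norm (fourier_coeff g n - c n))\<^sup>2 \<le> s - s"
      by (intro LIMSEQ_le_const) auto
    then show ?thesis by simp
  qed
  with g show thesis by (intro that) auto
qed

text \<open>Here \<open>f\<close> is only assumed integrable: by uniqueness of coefficients it
  agrees almost everywhere with the function built by \<open>Riesz_Fischer\<close>, which brings
  both square integrability and the bound.\<close>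

lemma Parseval_le:
  assumes f: "integrable circle_measure f"
    and "\<And>A. finite A \<Longrightarrow> (\<Sum>k\<in>A. (norm (fourier_coeff f k))\<^sup>2) \<le> B"
  shows "f \<in> L2_circle" "(\<integral>z. (norm (f z))\<^sup>2 \<partial>circle_measure) \<le> B"
proof -
  obtain g where g: "g \<in> L2_circle" "\<And>n. fourier_coeff g n = fourier_coeff f n"
    "(\<integral>z. (norm (g z))\<^sup>2 \<partial>circle_measure) \<le> B"
    using Riesz_Fischer[OF assms(2)] by blast
  have ae: "AE z in circle_measure. f z = g z"
    using fourier_coeff_unique[OF f L2_integrable[OF g(1)]] g(2) by simp
  note [measurable] = borel_measurable_integrable[OF f] L2_measurable[OF g(1)]
  have "(\<integral>z. (norm (f z))\<^sup>2 \<partial>circle_measure) = (\<integral>z. (norm (g z))\<^sup>2 \<partial>circle_measure)"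
    using ae by (intro integral_cong_AE) (auto elim: eventually_mono)
  with g(3) show "(\<integral>z. (norm (f z))\<^sup>2 \<partial>circle_measure) \<le> B" by simp
  show "f \<in> L2_circle"
    by (rule L2_dominated[OF _ L2_sq_integrable[OF g(1)]]) (use ae in \<open>auto elim: eventually_mono\<close>)
qed

subsection \<open>Approximation by trigonometric polynomials\<close>

text \<open>A finite set \<open>A0\<close> comes within e of the supremum of all finite sums. A
  finite set disjoint from a window around \<open>A0\<close> can then contribute at most e, since
  its union with \<open>A0\<close> stays below the supremum.\<close>

lemma L2_coeff_tail:
  assumes "f \<in> L2_circle" "e > 0"
  obtains N :: nat where "\<And>A. finite A \<Longrightarrow> A \<inter> {- int N..int N} = {} \<Longrightarrow> (\<Sum>k\<in>A. (norm (fourier_coeff f k))\<^sup>2) \<le> e"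
proof -
  define S where "S A = (\<Sum>k\<in>A. (norm (fourier_coeff f k))\<^sup>2)" for A
  have bdd: "bdd_above (S ` {A. finite A})"
    using Bessel_inequality[OF assms(1)] by (auto simp: S_def intro!: bdd_aboveI)
  have "\<exists>A0\<in>{A. finite A}. (SUP A\<in>{A. finite A}. S A) - e < S A0"
    using assms(2) bdd by (subst less_cSUP_iff[symmetric]) auto
  then obtain A0 where A0: "finite A0" "(SUP A\<in>{A. finite A}. S A) - e < S A0"
    by auto
  \<comment> \<open>Inserting 0 keeps \<open>Max\<close> meaningful when \<open>A0\<close> is
    empty.\<close>
  define N where "N = nat (Max (insert 0 (abs ` A0)))"
  have "A0 \<subseteq> {- int N..int N}"
  proof
    fix k assume "k \<in> A0"
    then have "\<bar>k\<bar> \<le> Max (insert 0 (abs ` A0))"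
      using A0 by (intro Max_ge) auto
    then show "k \<in> {- int N..int N}"
      by (auto simp: N_def)
  qed
  show thesis
  proof (rule that[of N])
    fix A :: "int set" assume A: "finite A" "A \<inter> {- int N..int N} = {}"
    then have "S (A \<union> A0) = S A + S A0"
      unfolding S_def using A0 \<open>A0 \<subseteq> _\<close> by (intro sum.union_disjoint) auto
    moreover have "S (A \<union> A0) \<le> (SUP A\<in>{A. finite A}. S A)"
      using A A0 bdd by (intro cSUP_upper) auto
    ultimately show "(\<Sum>k\<in>A. (norm (fourier_coeff f k))\<^sup>2) \<le> e"
      using A0(2) by (simp add: S_def)
  qed
qed

lemma L2_trig_approx:
  assumes "f \<in> L2_circle" "e > 0"
  obtains N :: nat where "\<And>A. finite A \<Longrightarrow> {- int N..int N} \<subseteq> A \<Longrightarrow>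
    (\<integral>z. (norm (f z - (\<Sum>k\<in>A. fourier_coeff f k * z powi k)))\<^sup>2 \<partial>circle_measure) \<le> e"
proof -
  obtain N where N: "\<And>A. finite A \<Longrightarrow> A \<inter> {- int N..int N} = {} \<Longrightarrow> (\<Sum>k\<in>A. (norm (fourier_coeff f k))\<^sup>2) \<le> e"
    using L2_coeff_tail[OF assms] by blast
  show thesis
  proof (rule that[of N])
    fix A assume A: "finite A" "{- int N..int N} \<subseteq> A"
    let ?g = "\<lambda>z. f z - (\<Sum>k\<in>A. fourier_coeff f k * z powi k)"
    have g: "integrable circle_measure ?g"
      by (intro L2_integrable L2_diff assms trig_poly_L2)
    have c: "fourier_coeff ?g k = (if k \<in> A then 0 else fourier_coeff f k)" for k
      by (subst fourier_coeff_diff) (auto simp: fourier_coeff_trig_poly A intro: L2_integrable assms trig_poly_L2)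
    show "(\<integral>z. (norm (?g z))\<^sup>2 \<partial>circle_measure) \<le> e"
    proof (rule Parseval_le(2)[OF g])
      fix B :: "int set" assume B: "finite B"
      have "(\<Sum>k\<in>B. (norm (fourier_coeff ?g k))\<^sup>2) = (\<Sum>k\<in>B - A. (norm (fourier_coeff f k))\<^sup>2)"
        using B by (intro sum.mono_neutral_cong_right) (auto simp: c)
      also have "\<dots> \<le> e"
        using A B by (intro N) auto
      finally show "(\<Sum>k\<in>B. (norm (fourier_coeff ?g k))\<^sup>2) \<le> e" .
    qed
  qed
qed

lemma fourier_coeff_L2_tendsto:
  assumes "L2_tendsto u g F" "g \<in> L2_circle" "eventually (\<lambda>x. u x \<in> L2_circle) F"
  shows "((\<lambda>x. fourier_coeff (u x) n) \<longlongrightarrow> fourier_coeff g n) F"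
proof -
  have "((\<lambda>x. sqrt (\<integral>z. (norm (u x z - g z))\<^sup>2 \<partial>circle_measure)) \<longlongrightarrow> 0) F"
    using tendsto_real_sqrt[OF assms(1)[unfolded L2_tendsto_def]] by simp
  then have "((\<lambda>x. fourier_coeff (u x) n - fourier_coeff g n) \<longlongrightarrow> 0) F"
  proof (rule Lim_null_comparison[rotated])
    show "\<forall>\<^sub>F x in F. norm (fourier_coeff (u x) n - fourier_coeff g n) \<le> sqrt (\<integral>z. (norm (u x z - g z))\<^sup>2 \<partial>circle_measure)"
      using assms(3)
    proof eventually_elim
      case (elim x)
      have d: "(\<lambda>z. u x z - g z) \<in> L2_circle"
        by (intro L2_diff elim assms)
      have "norm (fourier_coeff (u x) n - fourier_coeff g n) = norm (fourier_coeff (\<lambda>z. u x z - g z) n)"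
        using elim assms by (simp add: fourier_coeff_diff L2_integrable)
      also have "\<dots> \<le> (\<integral>z. norm (u x z - g z) \<partial>circle_measure)"
        by (intro fourier_coeff_norm_le L2_integrable d)
      also have "\<dots> \<le> sqrt (\<integral>z. (norm (u x z - g z))\<^sup>2 \<partial>circle_measure)"
        by (intro real_le_rsqrt circle_integral_norm_sq_le d)
      finally show ?case .
    qed
  qed
  then show ?thesis
    using Lim_null by blast
qed

text \<open>Common core of the positive and the negative part. The hypothesis is on coefficients
  because \<open>chi\<close> is known only to be integrable when this is applied, and the conclusion
  is on coefficients because \<open>SOME\<close> fixes the limit only up to null sets.\<close>

lemma partial_sums_L2_limit:
  fixes T :: "int set" and J :: "nat \<Rightarrow> int set"
  assumes f: "\<And>A. finite A \<Longrightarrow> (\<Sum>k\<in>A. (norm (fourier_coeff f k))\<^sup>2) \<le> B"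
    and J: "\<And>N. J N = T \<inter> {- int N..int N}"
    and h: "h = (SOME g. g \<in> L2_circle \<and> L2_tendsto (\<lambda>N z. \<Sum>k\<in>J N. fourier_coeff f k * z powi k) g sequentially)"
  shows "h \<in> L2_circle \<and> fourier_coeff h n = (if n \<in> T then fourier_coeff f n else 0)"
proof -
  let ?u = "\<lambda>N z. \<Sum>k\<in>J N. fourier_coeff f k * z powi k"
  have fin: "finite (J N)" for N by (simp add: J)
  have "(\<Sum>k\<in>A. (norm (if k \<in> T then fourier_coeff f k else 0))\<^sup>2) \<le> B" if "finite A" for A
    using that by (intro order_trans[OF sum_mono f[OF that]]) auto
  then obtain g where g: "g \<in> L2_circle" "\<And>k. fourier_coeff g k = (if k \<in> T then fourier_coeff f k else 0)"
    using Riesz_Fischer[of "\<lambda>k. if k \<in> T then fourier_coeff f k else 0" B] by blast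
  have "L2_tendsto ?u g sequentially"
    unfolding L2_tendsto_def
  proof (rule tendstoI)
    fix e :: real assume "e > 0"
    then obtain N where N: "\<And>A. finite A \<Longrightarrow> {- int N..int N} \<subseteq> A \<Longrightarrow>
      (\<integral>z. (norm (g z - (\<Sum>k\<in>A. fourier_coeff g k * z powi k)))\<^sup>2 \<partial>circle_measure) \<le> e / 2"
      using L2_trig_approx[OF g(1), of "e / 2"] by auto
    show "\<forall>\<^sub>F M in sequentially. dist (\<integral>z. (norm (?u M z - g z))\<^sup>2 \<partial>circle_measure) 0 < e"
      using eventually_ge_at_top[of N]
    proof eventually_elim
      case (elim M)
      have "?u M z = (\<Sum>k\<in>{- int M..int M}. fourier_coeff g k * z powi k)" for z
        by (rule sum.mono_neutral_cong_left) (auto simp: g(2) J)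
      then have "(\<integral>z. (norm (?u M z - g z))\<^sup>2 \<partial>circle_measure) \<le> e / 2"
        using N[of "{- int M..int M}"] elim by (simp add: norm_minus_commute)
      then show ?case
        using \<open>e > 0\<close> by (simp add: abs_of_nonneg)
    qed
  qed
  with g(1) have "\<exists>g. g \<in> L2_circle \<and> L2_tendsto ?u g sequentially" by blast
  from someI_ex[OF this] have p: "h \<in> L2_circle" "L2_tendsto ?u h sequentially"
    unfolding h by auto
  have "(\<lambda>N. fourier_coeff (?u N) n) \<longlonglongrightarrow> fourier_coeff h n"
    using p by (intro fourier_coeff_L2_tendsto always_eventually allI trig_poly_L2) auto
  moreover have "(\<lambda>N. fourier_coeff (?u N) n) \<longlonglongrightarrow> (if n \<in> T then fourier_coeff f n else 0)"
  proof (rule tendsto_eventually)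
    show "\<forall>\<^sub>F N in sequentially. fourier_coeff (?u N) n = (if n \<in> T then fourier_coeff f n else 0)"
      using eventually_ge_at_top[of "nat \<bar>n\<bar>"]
      by eventually_elim (auto simp: fourier_coeff_trig_poly fin J)
  qed
  ultimately show ?thesis
    using p(1) LIMSEQ_unique by blast
qed

lemma pos_part_properties:
  assumes f: "\<And>A. finite A \<Longrightarrow> (\<Sum>k\<in>A. (norm (fourier_coeff f k))\<^sup>2) \<le> B"
  shows "pos_part f \<in> L2_circle \<and> fourier_coeff (pos_part f) n = (if n > 0 then fourier_coeff f n else 0)"
proof -
  have "(\<Sum>n=1..N. fourier_coeff f (int n) * z powi (int n)) = (\<Sum>k\<in>{1..int N}. fourier_coeff f k * z powi k)" for N z
    by (rule sum.reindex_bij_witness[of _ nat int]) auto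
  note * = partial_sums_L2_limit[OF f _ pos_part_def[of f, unfolded this], of "{0<..}"]
  have "{1..int N} = {0<..} \<inter> {- int N..int N}" for N by auto
  from *[OF _ this, of n] show ?thesis by simp
qed

lemma neg_part_properties:
  assumes f: "\<And>A. finite A \<Longrightarrow> (\<Sum>k\<in>A. (norm (fourier_coeff f k))\<^sup>2) \<le> B"
  shows "neg_part f \<in> L2_circle \<and> fourier_coeff (neg_part f) n = (if n < 0 then fourier_coeff f n else 0)"
proof -
  have "(\<Sum>n=1..N. fourier_coeff f (- int n) * z powi (- int n)) = (\<Sum>k\<in>{- int N..-1}. fourier_coeff f k * z powi k)" for N z
    by (rule sum.reindex_bij_witness[of _ "\<lambda>k. nat (- k)" "\<lambda>n. - int n"]) auto
  note * = partial_sums_L2_limit[OF f _ neg_part_def[of f, unfolded this], of "{..<0}"]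
  have "{- int N..-1} = {..<0} \<inter> {- int N..int N}" for N by auto
  from *[OF _ this, of n] show ?thesis by simp
qed

subsection \<open>The scalar Hardy space\<close>

text \<open>The coefficient description of H^2 makes closure properties computations with indices;
  \<open>boundary_values_imp_H2\<close> and \<open>H2_boundary_values\<close> translate to and from
  the radial limits of \<open>hardy\<close>.\<close>

definition H2_circle :: "(complex \<Rightarrow> complex) set" where
  "H2_circle = {f \<in> L2_circle. \<forall>n<0. fourier_coeff f n = 0}"

definition holo_ext :: "(complex \<Rightarrow> complex) \<Rightarrow> complex \<Rightarrow> complex" where
  "holo_ext f w = (\<Sum>n. fourier_coeff f (int n) * w ^ n)"

lemma H2_L2: "f \<in> H2_circle \<Longrightarrow> f \<in> L2_circle"
  by (simp add: H2_circle_def)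

lemma H2_coeff: "f \<in> H2_circle \<Longrightarrow> n < 0 \<Longrightarrow> fourier_coeff f n = 0"
  by (simp add: H2_circle_def)

text \<open>The sign \<open>s\<close> serves the two halves of the Poisson kernel:
  \<open>s = -1\<close> collects the coefficients of nonnegative index, \<open>s = 1\<close> those
  of nonpositive index.\<close>

lemma integral_geometric_mult:
  fixes w :: complex and s :: int
  assumes w: "norm w < 1" and f: "integrable circle_measure f"
  shows "(\<integral>z. (\<Sum>n. w ^ n * (z powi (s * int n) * f z)) \<partial>circle_measure) = (\<Sum>n. w ^ n * fourier_coeff f (- s * int n))"
    and "integrable circle_measure (\<lambda>z. \<Sum>n. w ^ n * (z powi (s * int n) * f z))"
proof -
  have i: "integrable circle_measure (\<lambda>z. w ^ n * (z powi (s * int n) * f z))" for n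
    using powi_mult_integrable[OF f] by simp
  have nrm: "norm (w ^ n * (z powi (s * int n) * f z)) = norm w ^ n * norm (f z)" if "norm z = 1" for n z
    using that by (simp add: norm_mult norm_power norm_powi_unit)
  have s1: "AE z in circle_measure. summable (\<lambda>n. norm (w ^ n * (z powi (s * int n) * f z)))"
    using w by (intro AE_sphere) (simp add: nrm summable_mult2 summable_geometric)
  have "(\<integral>z. norm (w ^ n * (z powi (s * int n) * f z)) \<partial>circle_measure) = norm w ^ n * (\<integral>z. norm (f z) \<partial>circle_measure)" for n
  proof -
    have "(\<integral>z. norm (w ^ n * (z powi (s * int n) * f z)) \<partial>circle_measure) = (\<integral>z. norm w ^ n * norm (f z) \<partial>circle_measure)"
      by (rule Bochner_Integration.integral_cong) (auto simp: nrm)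
    then show ?thesis by simp
  qed
  then have s2: "summable (\<lambda>n. \<integral>z. norm (w ^ n * (z powi (s * int n) * f z)) \<partial>circle_measure)"
    using w by (simp add: summable_mult2 summable_geometric)
  show "integrable circle_measure (\<lambda>z. \<Sum>n. w ^ n * (z powi (s * int n) * f z))"
    by (rule integrable_suminf[OF i s1 s2])
  show "(\<integral>z. (\<Sum>n. w ^ n * (z powi (s * int n) * f z)) \<partial>circle_measure) = (\<Sum>n. w ^ n * fourier_coeff f (- s * int n))"
    by (subst integral_suminf[OF i s1 s2]) (simp add: fourier_coeff_def)
qed

lemma fourier_coeff_power_series:
  assumes a: "summable (\<lambda>n. norm (a n))"
  shows "fourier_coeff (\<lambda>z. \<Sum>n. a n * z ^ n) k = (if k \<ge> 0 then a (nat k) else 0)"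
proof -
  have nrm: "norm (a n * (z powi (-k) * z ^ n)) = norm (a n)" if "norm z = 1" for n z
    using that by (simp add: norm_mult norm_power norm_powi_unit)
  have i: "integrable circle_measure (\<lambda>z. a n * (z powi (-k) * z ^ n))" for n
    by (intro continuous_integrable_circle continuous_intros)
  have s1: "AE z in circle_measure. summable (\<lambda>n. norm (a n * (z powi (-k) * z ^ n)))"
    using a by (intro AE_sphere) (simp only: nrm)
  have "(\<integral>z. norm (a n * (z powi (-k) * z ^ n)) \<partial>circle_measure) = (\<integral>z. norm (a n) \<partial>circle_measure)" for n
    by (rule Bochner_Integration.integral_cong) (auto simp: nrm simp del: norm_mult)
  then have s2: "summable (\<lambda>n. \<integral>z. norm (a n * (z powi (-k) * z ^ n)) \<partial>circle_measure)"
    using a circle.prob_space by (simp del: space_circle)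
  have "fourier_coeff (\<lambda>z. \<Sum>n. a n * z ^ n) k = (\<integral>z. (\<Sum>n. a n * (z powi (-k) * z ^ n)) \<partial>circle_measure)"
    unfolding fourier_coeff_def
  proof (rule Bochner_Integration.integral_cong)
    fix z :: complex assume "z \<in> space circle_measure"
    then have "summable (\<lambda>n. norm (a n * z ^ n))"
      using a by (simp add: norm_mult norm_power)
    then show "z powi (-k) * (\<Sum>n. a n * z ^ n) = (\<Sum>n. a n * (z powi (-k) * z ^ n))"
      by (subst suminf_mult[symmetric]) (auto intro: summable_norm_cancel simp: mult_ac)
  qed simp
  also have "\<dots> = (\<Sum>n. a n * fourier_coeff (\<lambda>z. z powi int n) k)"
    by (subst integral_suminf[OF i s1 s2]) (simp add: fourier_coeff_def)
  also have "\<dots> = (\<Sum>n. if k = int n then a n else 0)"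
    by (rule arg_cong[where f = suminf]) (simp add: fourier_coeff_powi fun_eq_iff del: power_int_of_nat)
  also have "\<dots> = (if k \<ge> 0 then a (nat k) else 0)"
  proof (cases "k \<ge> 0")
    case True
    then have "(\<lambda>n. if k = int n then a n else 0) = (\<lambda>n. if n = nat k then a n else 0)"
      by auto
    then show ?thesis
      using True sums_single[of "nat k" a] by (simp add: sums_iff)
  next
    case False
    then have "(\<lambda>n. if k = int n then a n else 0) = (\<lambda>n. 0)"
      by auto
    with False show ?thesis by simp
  qed
  finally show ?thesis .
qed

lemma continuous_on_dilation:
  assumes "F holomorphic_on ball 0 1" "0 \<le> r" "r < 1"
  shows "continuous_on (sphere 0 1) (\<lambda>z. F (of_real r * z))"
  by (rule continuous_on_compose2[OF holomorphic_on_imp_continuous_on[OF assms(1)]])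
     (use assms in \<open>auto intro!: continuous_intros simp: norm_mult\<close>)

lemma fourier_coeff_dilation_neg:
  assumes F: "F holomorphic_on ball 0 1" and r: "0 \<le> r" "r < 1" and n: "n < 0"
  shows "fourier_coeff (\<lambda>z. F (of_real r * z)) n = 0"
proof -
  define a where "a n = (deriv ^^ n) F 0 / fact n" for n
  have sums: "(\<lambda>n. a n * w ^ n) sums F w" if "norm w < 1" for w
    using holomorphic_power_series[OF F, of w] that by (simp add: a_def)
  \<comment> \<open>Convergence of the Taylor series at the larger radius \<open>t\<close> gives
    absolute convergence at \<open>r\<close>, as needed for integrating termwise over the
    circle.\<close>
  obtain t where t: "r < t" "t < 1" using dense r by blast
  have "summable (\<lambda>n. a n * (of_real t) ^ n)"
    using sums[of "of_real t"] t r by (simp add: sums_iff)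
  then have "summable (\<lambda>n. norm (a n * (of_real r) ^ n))"
    by (rule powser_insidea) (use r t in auto)
  then have "fourier_coeff (\<lambda>z. \<Sum>n. (a n * (of_real r) ^ n) * z ^ n) n = 0"
    using n by (simp add: fourier_coeff_power_series)
  moreover have "fourier_coeff (\<lambda>z. F (of_real r * z)) n = fourier_coeff (\<lambda>z. \<Sum>n. (a n * (of_real r) ^ n) * z ^ n) n"
    unfolding fourier_coeff_def
  proof (rule Bochner_Integration.integral_cong)
    fix z :: complex assume "z \<in> space circle_measure"
    then have "F (of_real r * z) = (\<Sum>n. a n * (of_real r * z) ^ n)"
      using sums[of "of_real r * z"] r by (simp add: norm_mult sums_iff)
    then show "z powi (-n) * F (of_real r * z) = z powi (-n) * (\<Sum>n. a n * of_real r ^ n * z ^ n)"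
      by (simp add: power_mult_distrib mult_ac)
  qed simp
  ultimately show ?thesis by simp
qed

lemma boundary_values_imp_H2:
  assumes "boundary_values F f"
  shows "f \<in> H2_circle"
proof -
  have F: "F holomorphic_on ball 0 1" and f: "f \<in> L2_circle"
    and lim: "L2_tendsto (\<lambda>r z. F (of_real r * z)) f (at_left 1)"
    using assms by (auto simp: boundary_values_def)
  have ev: "eventually (\<lambda>r::real. 0 \<le> r \<and> r < 1) (at_left 1)"
    by (rule eventually_at_leftI[of 0]) auto
  have "fourier_coeff f n = 0" if "n < 0" for n
  proof (rule tendsto_unique)
    show "((\<lambda>r. fourier_coeff (\<lambda>z. F (of_real r * z)) n) \<longlongrightarrow> fourier_coeff f n) (at_left 1)"
      by (rule fourier_coeff_L2_tendsto[OF lim f])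
         (use ev in \<open>auto elim!: eventually_mono intro!: L2_continuous continuous_on_dilation[OF F]\<close>)
    show "((\<lambda>r. fourier_coeff (\<lambda>z. F (of_real r * z)) n) \<longlongrightarrow> 0) (at_left 1)"
      by (rule tendsto_eventually)
         (use ev that in \<open>auto elim!: eventually_mono simp: fourier_coeff_dilation_neg[OF F]\<close>)
  qed simp
  with f show ?thesis by (simp add: H2_circle_def)
qed

lemma holo_ext_sums:
  assumes f: "integrable circle_measure f" and w: "norm w < 1"
  shows "(\<lambda>n. fourier_coeff f (int n) * w ^ n) sums holo_ext f w"
    and "summable (\<lambda>n. norm (fourier_coeff f (int n) * w ^ n))"
proof -
  show s: "summable (\<lambda>n. norm (fourier_coeff f (int n) * w ^ n))"
  proof (rule summable_comparison_test')
    show "summable (\<lambda>n. (\<integral>z. norm (f z) \<partial>circle_measure) * norm w ^ n)"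
      using w by (intro summable_mult summable_geometric) simp
    show "norm (norm (fourier_coeff f (int n) * w ^ n)) \<le> (\<integral>z. norm (f z) \<partial>circle_measure) * norm w ^ n" for n
      using fourier_coeff_norm_le[OF f] by (simp add: norm_mult norm_power mult_right_mono)
  qed
  show "(\<lambda>n. fourier_coeff f (int n) * w ^ n) sums holo_ext f w"
    unfolding holo_ext_def by (rule summable_sums[OF summable_norm_cancel[OF s]])
qed

lemma holo_ext_holomorphic:
  assumes "integrable circle_measure f"
  shows "holo_ext f holomorphic_on ball 0 1"
  by (rule power_series_holomorphic[where a = "\<lambda>n. fourier_coeff f (int n)"])
     (use holo_ext_sums(1)[OF assms] in simp)

text \<open>The n-th coefficient of the difference is that of \<open>f\<close> times r^n - 1.
  Finitely many low frequencies tend to zero with r, and the remaining ones are dominated by the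
  coefficient tail of \<open>f\<close>, uniformly in r.\<close>

lemma H2_boundary_values:
  assumes f: "f \<in> H2_circle"
  shows "boundary_values (holo_ext f) f"
proof -
  have fL: "f \<in> L2_circle" and fi: "integrable circle_measure f"
    using f by (auto intro: L2_integrable H2_L2)
  note F = holo_ext_holomorphic[OF fi]
  have "L2_tendsto (\<lambda>r z. holo_ext f (of_real r * z)) f (at_left 1)"
    unfolding L2_tendsto_def
  proof (rule tendstoI)
    fix e :: real assume e: "e > 0"
    obtain N where N: "\<And>A. finite A \<Longrightarrow> A \<inter> {- int N..int N} = {} \<Longrightarrow> (\<Sum>k\<in>A. (norm (fourier_coeff f k))\<^sup>2) \<le> e / 2"
      using L2_coeff_tail[OF fL, of "e / 2"] e by auto
    \<comment> \<open>This is the low frequency part of the squared distance, a polynomial in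
      \<open>r\<close> that vanishes at 1.\<close>
    define \<sigma> where "\<sigma> r = (\<Sum>k=0..N. (norm (fourier_coeff f (int k)) * (1 - r ^ k))\<^sup>2)" for r :: real
    have "(\<sigma> \<longlongrightarrow> \<sigma> 1) (at_left 1)"
      unfolding \<sigma>_def by (intro tendsto_intros)
    then have "\<forall>\<^sub>F r in at_left 1. \<sigma> r < e / 2"
      by (rule order_tendstoD) (use e in \<open>simp add: \<sigma>_def\<close>)
    moreover have "\<forall>\<^sub>F r::real in at_left 1. 0 \<le> r \<and> r < 1"
      by (rule eventually_at_leftI[of 0]) auto
    ultimately show "\<forall>\<^sub>F r in at_left 1. dist (\<integral>z. (norm (holo_ext f (of_real r * z) - f z))\<^sup>2 \<partial>circle_measure) 0 < e"
    proof eventually_elim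
      case (elim r)
      then have r: "0 \<le> r" "r < 1" by auto
      let ?g = "\<lambda>z. holo_ext f (of_real r * z) - f z"
      have h: "(\<lambda>z. holo_ext f (of_real r * z)) \<in> L2_circle"
        by (rule L2_continuous[OF continuous_on_dilation[OF F r]])
      have ch: "fourier_coeff (\<lambda>z. holo_ext f (of_real r * z)) k = (if k \<ge> 0 then fourier_coeff f k * r ^ nat k else 0)" for k
      proof -
        have "fourier_coeff (\<lambda>z. holo_ext f (of_real r * z)) k =
            fourier_coeff (\<lambda>z. \<Sum>n. (fourier_coeff f (int n) * of_real r ^ n) * z ^ n) k"
          by (simp add: holo_ext_def power_mult_distrib mult.assoc)
        also have "\<dots> = (if k \<ge> 0 then fourier_coeff f k * r ^ nat k else 0)"
          using holo_ext_sums(2)[OF fi, of "of_real r"] r by (subst fourier_coeff_power_series) auto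
        finally show ?thesis .
      qed
      have cg: "fourier_coeff ?g k = (if k \<ge> 0 then fourier_coeff f k * (r ^ nat k - 1) else 0)" for k
        using H2_coeff[OF f, of k] L2_integrable[OF h] fi
        by (subst fourier_coeff_diff) (simp_all add: ch right_diff_distrib)
      have pow: "norm (complex_of_real r ^ n - 1) = 1 - r ^ n" for n
      proof -
        have "complex_of_real r ^ n - 1 = of_real (r ^ n - 1)" by simp
        then have "norm (complex_of_real r ^ n - 1) = \<bar>r ^ n - 1\<bar>"
          by (simp only: norm_of_real)
        then show ?thesis
          using r power_le_one[of r n] by simp
      qed
      have "(\<integral>z. (norm (?g z))\<^sup>2 \<partial>circle_measure) \<le> \<sigma> r + e / 2"
      proof (rule Parseval_le(2))
        show "integrable circle_measure ?g"
          by (intro L2_integrable L2_diff h fL)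
        fix A :: "int set" assume A: "finite A"
        have "(\<Sum>k\<in>A. (norm (fourier_coeff ?g k))\<^sup>2) =
            (\<Sum>k\<in>A \<inter> {- int N..int N}. (norm (fourier_coeff ?g k))\<^sup>2) + (\<Sum>k\<in>A - {- int N..int N}. (norm (fourier_coeff ?g k))\<^sup>2)"
          using A by (subst sum.Int_Diff[of A _ "{- int N..int N}"]) auto
        also have "(\<Sum>k\<in>A \<inter> {- int N..int N}. (norm (fourier_coeff ?g k))\<^sup>2) \<le> (\<Sum>k\<in>{- int N..int N}. (norm (fourier_coeff ?g k))\<^sup>2)"
          by (rule sum_mono2) auto
        also have "(\<Sum>k\<in>{- int N..int N}. (norm (fourier_coeff ?g k))\<^sup>2) = (\<Sum>k\<in>{0..int N}. (norm (fourier_coeff ?g k))\<^sup>2)"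
          by (rule sum.mono_neutral_right) (auto simp: cg)
        also have "\<dots> = \<sigma> r"
          unfolding \<sigma>_def
          by (rule sum.reindex_bij_witness[of _ int nat])
             (use pow in \<open>auto simp: cg norm_mult\<close>)
        also have "(\<Sum>k\<in>A - {- int N..int N}. (norm (fourier_coeff ?g k))\<^sup>2) \<le> (\<Sum>k\<in>A - {- int N..int N}. (norm (fourier_coeff f k))\<^sup>2)"
        proof (rule sum_mono)
          fix k
          have "norm (fourier_coeff ?g k) \<le> norm (fourier_coeff f k)"
          proof -
            have "norm (complex_of_real r ^ nat k - 1) \<le> 1" 
              using r by (simp add: pow)
            then show ?thesis
              by (simp add: cg norm_mult mult_left_le)
          qed
          then show "(norm (fourier_coeff ?g k))\<^sup>2 \<le> (norm (fourier_coeff f k))\<^sup>2"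
            by (intro power_mono) auto
        qed
        also have "\<dots> \<le> e / 2"
          using A by (intro N) auto
        finally show "(\<Sum>k\<in>A. (norm (fourier_coeff ?g k))\<^sup>2) \<le> \<sigma> r + e / 2"
          by simp
      qed
      then show ?case
        using elim by (simp add: abs_of_nonneg)
    qed
  qed
  with F fL show ?thesis by (simp add: boundary_values_def)
qed

subsection \<open>Products and exponentials in the Hardy space\<close>

lemma H2I: "f \<in> L2_circle \<Longrightarrow> (\<And>n. n < 0 \<Longrightarrow> fourier_coeff f n = 0) \<Longrightarrow> f \<in> H2_circle"
  by (simp add: H2_circle_def)

lemma H2_add: "f \<in> H2_circle \<Longrightarrow> g \<in> H2_circle \<Longrightarrow> (\<lambda>z. f z + g z) \<in> H2_circle"
  by (intro H2I L2_add) (auto simp: fourier_coeff_add H2_coeff L2_integrable H2_L2)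

lemma H2_cmult: "f \<in> H2_circle \<Longrightarrow> (\<lambda>z. c * f z) \<in> H2_circle"
  by (intro H2I L2_cmult) (auto simp: fourier_coeff_cmult H2_coeff H2_L2)

lemma H2_cong_AE:
  assumes "f \<in> H2_circle" "g \<in> borel_measurable circle_measure" "AE z in circle_measure. f z = g z"
  shows "g \<in> H2_circle"
proof (rule H2I)
  show "g \<in> L2_circle"
    by (rule L2_dominated[OF assms(2) L2_sq_integrable[OF H2_L2[OF assms(1)]]])
       (use assms(3) in \<open>auto elim: eventually_mono\<close>)
  show "fourier_coeff g n = 0" if "n < 0" for n
    using fourier_coeff_cong_AE[OF assms(3) L2_measurable[OF H2_L2[OF assms(1)]] assms(2)] H2_coeff[OF assms(1) that]
    by simp
qed

lemma H2_mult_coeff_neg: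
  assumes f: "f \<in> H2_circle" and g: "g \<in> H2_circle" and n: "n < 0"
  shows "fourier_coeff (\<lambda>z. f z * g z) n = 0"
proof -
  note fL = H2_L2[OF f] and gL = H2_L2[OF g]
  let ?C = "(\<integral>z. (norm (f z))\<^sup>2 \<partial>circle_measure) + 1"
  have C: "?C \<ge> 1" by simp
  have bd: "norm (fourier_coeff (\<lambda>z. f z * g z) n) \<le> t * ?C" if t: "t > 0" for t
  proof -
    \<comment> \<open>The error is split by the weighted inequality x y \<le> t x^2 + y^2/t, so
      accuracy t^2 in the squared norm leaves a second term of size t.\<close>
    obtain N where N: "\<And>A. finite A \<Longrightarrow> {- int N..int N} \<subseteq> A \<Longrightarrow>
      (\<integral>z. (norm (g z - (\<Sum>k\<in>A. fourier_coeff g k * z powi k)))\<^sup>2 \<partial>circle_measure) \<le> t\<^sup>2"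
      using L2_trig_approx[OF gL, of "t\<^sup>2"] t by auto
    define p where "p z = (\<Sum>k\<in>{- int N..int N}. fourier_coeff g k * z powi k)" for z
    have pL: "p \<in> L2_circle" unfolding p_def by (rule trig_poly_L2)
    have gp: "(\<lambda>z. g z - p z) \<in> L2_circle" by (intro L2_diff gL pL)
    have "(\<lambda>z. f z * p z) = (\<lambda>z. \<Sum>k\<in>{- int N..int N}. fourier_coeff g k * (z powi k * f z))"
      by (simp add: p_def sum_distrib_left mult_ac)
    then have "fourier_coeff (\<lambda>z. f z * p z) n = (\<Sum>k\<in>{- int N..int N}. fourier_coeff (\<lambda>z. fourier_coeff g k * (z powi k * f z)) n)"
      using powi_mult_integrable[OF L2_integrable[OF fL]] by (simp add: fourier_coeff_sum)
    also have "\<dots> = 0"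
    proof (intro sum.neutral ballI)
      fix k
      show "fourier_coeff (\<lambda>z. fourier_coeff g k * (z powi k * f z)) n = 0"
        using H2_coeff[OF g, of k] H2_coeff[OF f, of "n - k"] n
        unfolding fourier_coeff_cmult fourier_coeff_powi_mult by (cases "k < 0") auto
    qed
    finally have "fourier_coeff (\<lambda>z. f z * g z) n = fourier_coeff (\<lambda>z. f z * g z) n - fourier_coeff (\<lambda>z. f z * p z) n"
      by simp
    also have "\<dots> = fourier_coeff (\<lambda>z. f z * (g z - p z)) n"
      by (subst fourier_coeff_diff[symmetric])
         (auto intro: L2_mult_integrable fL gL pL simp: right_diff_distrib)
    finally have "norm (fourier_coeff (\<lambda>z. f z * g z) n) \<le> (\<integral>z. norm (f z * (g z - p z)) \<partial>circle_measure)"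
      using fourier_coeff_norm_le[OF L2_mult_integrable[OF fL gp], of n] by simp
    also have "\<dots> \<le> (\<integral>z. t * (norm (f z))\<^sup>2 + (norm (g z - p z))\<^sup>2 / t \<partial>circle_measure)"
    proof (rule integral_mono)
      show "integrable circle_measure (\<lambda>z. norm (f z * (g z - p z)))"
        by (intro integrable_norm L2_mult_integrable fL gp)
      show "integrable circle_measure (\<lambda>z. t * (norm (f z))\<^sup>2 + (norm (g z - p z))\<^sup>2 / t)"
        by (intro Bochner_Integration.integrable_add integrable_mult_right integrable_divide_zero L2_sq_integrable fL gp)
      fix z
      have aux: "x * y \<le> t * x\<^sup>2 + y\<^sup>2 / t" if "x \<ge> 0" "y \<ge> 0" for x y :: real
      proof -
        have "(t * x) * y \<le> (t * x)\<^sup>2 + y\<^sup>2"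
          using norm_mult_le_sq[of "t * x" y] that t by simp
        also have "\<dots> = t * (t * x\<^sup>2 + y\<^sup>2 / t)"
          using t by (simp add: distrib_left power2_eq_square)
        finally have "t * (x * y) \<le> t * (t * x\<^sup>2 + y\<^sup>2 / t)"
          by (simp only: mult.assoc)
        then show ?thesis using t by (simp only: mult_le_cancel_left_pos)
      qed
      show "norm (f z * (g z - p z)) \<le> t * (norm (f z))\<^sup>2 + (norm (g z - p z))\<^sup>2 / t"
        unfolding norm_mult by (rule aux) auto
    qed
    also have "\<dots> = t * (\<integral>z. (norm (f z))\<^sup>2 \<partial>circle_measure) + (\<integral>z. (norm (g z - p z))\<^sup>2 \<partial>circle_measure) / t"
      using L2_sq_integrable[OF fL] L2_sq_integrable[OF gp] by simp
    also have "\<dots> \<le> t * (\<integral>z. (norm (f z))\<^sup>2 \<partial>circle_measure) + t\<^sup>2 / t"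
      using N[of "{- int N..int N}"] t unfolding p_def by (intro add_left_mono divide_right_mono) auto
    also have "\<dots> = t * ?C"
      using t by (simp add: power2_eq_square algebra_simps)
    finally show ?thesis .
  qed
  have "norm (fourier_coeff (\<lambda>z. f z * g z) n) \<le> 0 + e" if "e > 0" for e
    using bd[of "e / ?C"] that C by (simp add: divide_pos_pos)
  then have "norm (fourier_coeff (\<lambda>z. f z * g z) n) \<le> 0"
    by (rule field_le_epsilon)
  then show "fourier_coeff (\<lambda>z. f z * g z) n = 0"
    by simp
qed

lemma H2_mult:
  assumes "f \<in> H2_circle" "g \<in> H2_circle" "(\<lambda>z. f z * g z) \<in> L2_circle"
  shows "(\<lambda>z. f z * g z) \<in> H2_circle"
  by (rule H2I) (use assms H2_mult_coeff_neg in auto)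

text \<open>For |z| = 1 this is the usual (1 - |w|^2) / |z - w|^2, written so that it splits into
  two geometric series.\<close>

definition poisson_kernel :: "complex \<Rightarrow> complex \<Rightarrow> real" where
  "poisson_kernel w z = 2 * Re (1 / (1 - w * cnj z)) - 1"

text \<open>With u = 1 - w cnj z, the bound |1 - u| < 1 gives |u|^2 \<le> 2 Re u, which says that Re
  (1/u) is at least 1/2.\<close>

lemma poisson_kernel_nonneg:
  assumes w: "norm w < 1" and z: "norm z = 1"
  shows "poisson_kernel w z \<ge> 0"
proof -
  define u where "u = 1 - w * cnj z"
  have "norm (1 - u) < 1"
    using w z by (simp add: u_def norm_mult)
  then have u0: "u \<noteq> 0" and "(norm (1 - u))\<^sup>2 \<le> 1"
    by (auto simp: power_le_one)
  then have "(norm u)\<^sup>2 \<le> 2 * Re u"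
    unfolding cmod_power2 by (simp add: power2_eq_square algebra_simps)
  moreover have "Re (1 / u) = Re u / (norm u)\<^sup>2"
    by (simp add: Re_divide cmod_power2)
  moreover have "(norm u)\<^sup>2 > 0"
    using u0 by simp
  ultimately have "(norm u)\<^sup>2 * 1 \<le> (norm u)\<^sup>2 * (2 * Re (1 / u))"
    by simp
  with \<open>(norm u)\<^sup>2 > 0\<close> have "1 \<le> 2 * Re (1 / u)"
    by (simp only: mult_le_cancel_left_pos)
  then show ?thesis
    by (simp add: poisson_kernel_def u_def[symmetric])
qed

lemma continuous_poisson_kernel:
  assumes w: "norm w < 1"
  shows "continuous_on (sphere 0 1) (poisson_kernel w)"
proof -
  have "1 - w * cnj z \<noteq> 0" if "norm z = 1" for z
  proof
    assume "1 - w * cnj z = 0"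
    then have "norm (w * cnj z) = 1" by (metis eq_iff_diff_eq_0 norm_one)
    with w that show False by (simp add: norm_mult)
  qed
  then show ?thesis
    unfolding poisson_kernel_def by (intro continuous_intros) auto
qed

text \<open>The series in \<open>w\<close> reproduces \<open>holo_ext f w\<close>. The conjugate
  series meets only coefficients of nonpositive index, so just its constant term survives, and the
  summand -1 of the kernel cancels it.\<close>

lemma poisson_integral:
  assumes f: "integrable circle_measure f" "\<And>n. n < 0 \<Longrightarrow> fourier_coeff f n = 0" and w: "norm w < 1"
  shows "(\<integral>z. of_real (poisson_kernel w z) * f z \<partial>circle_measure) = holo_ext f w"
proof -
  let ?K = "\<lambda>z. \<Sum>n. w ^ n * (z powi ((-1) * int n) * f z)"
  let ?L = "\<lambda>z. \<Sum>n. cnj w ^ n * (z powi (1 * int n) * f z)"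
  have w': "norm (cnj w) < 1" using w by simp
  note K = integral_geometric_mult[OF w f(1), of "-1"]
  note L = integral_geometric_mult[OF w' f(1), of 1]
  have eq: "of_real (poisson_kernel w z) * f z = ?K z + ?L z - f z" if z: "norm z = 1" for z
  proof -
    have nz: "norm (w * cnj z) < 1" "norm (cnj w * z) < 1"
      using w z by (auto simp: norm_mult)
    have "(\<lambda>n. (w * cnj z) ^ n * f z) sums (1 / (1 - w * cnj z) * f z)"
      by (intro sums_mult2 geometric_sums nz)
    moreover have "(w * cnj z) ^ n * f z = w ^ n * (z powi ((-1) * int n) * f z)" for n
      using cnj_powi_unit[OF z, of "int n"] by (simp add: power_mult_distrib)
    ultimately have 1: "?K z = 1 / (1 - w * cnj z) * f z"
      by (simp add: sums_iff)
    have "(\<lambda>n. (cnj w * z) ^ n * f z) sums (1 / (1 - cnj w * z) * f z)"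
      by (intro sums_mult2 geometric_sums nz)
    then have 2: "?L z = 1 / (1 - cnj w * z) * f z"
      by (simp add: sums_iff power_mult_distrib mult_ac)
    have "of_real (2 * Re (1 / (1 - w * cnj z))) = 1 / (1 - w * cnj z) + cnj (1 / (1 - w * cnj z))"
      by (simp only: complex_add_cnj)
    also have "cnj (1 / (1 - w * cnj z)) = 1 / (1 - cnj w * z)"
      by simp
    finally have 3: "of_real (poisson_kernel w z) = 1 / (1 - w * cnj z) + 1 / (1 - cnj w * z) - 1"
      by (simp add: poisson_kernel_def)
    show ?thesis
      unfolding 1 2 3 by (simp only: left_diff_distrib distrib_right mult_1)
  qed
  have "(\<integral>z. of_real (poisson_kernel w z) * f z \<partial>circle_measure) = (\<integral>z. ?K z + ?L z - f z \<partial>circle_measure)"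
    by (rule Bochner_Integration.integral_cong) (use eq in auto)
  also have "\<dots> = (\<integral>z. ?K z \<partial>circle_measure) + (\<integral>z. ?L z \<partial>circle_measure) - (\<integral>z. f z \<partial>circle_measure)"
    using K(2) L(2) f(1) by simp
  also have "(\<integral>z. ?K z \<partial>circle_measure) = holo_ext f w"
    unfolding K(1) holo_ext_def by (simp add: mult.commute)
  also have "(\<integral>z. ?L z \<partial>circle_measure) = (\<Sum>n. if n = 0 then fourier_coeff f 0 else 0)"
    unfolding L(1) by (rule arg_cong[where f = suminf]) (auto simp: fun_eq_iff f(2))
  also have "\<dots> = fourier_coeff f 0"
    using sums_single[of 0 "\<lambda>_. fourier_coeff f 0"] by (simp add: sums_iff)
  also have "\<dots> = (\<integral>z. f z \<partial>circle_measure)"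
    by (simp add: fourier_coeff_def)
  finally show ?thesis by simp
qed

lemma integral_poisson_kernel:
  assumes w: "norm w < 1"
  shows "(\<integral>z. poisson_kernel w z \<partial>circle_measure) = 1"
proof -
  have c: "fourier_coeff (\<lambda>z. 1) n = (if n = 0 then 1 else 0)" for n
    using fourier_coeff_powi[of 0 n] by simp
  have "holo_ext (\<lambda>z. 1) w = (\<Sum>n. if n = 0 then 1 else 0)"
    unfolding holo_ext_def by (rule arg_cong[where f = suminf]) (auto simp: fun_eq_iff c)
  also have "\<dots> = 1"
    using sums_single[of 0 "\<lambda>_. 1 :: complex"] by (simp add: sums_iff)
  finally have "(\<integral>z. of_real (poisson_kernel w z) * (1::complex) \<partial>circle_measure) = 1"
    by (subst poisson_integral[OF _ _ w]) (auto simp: c)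
  then have "complex_of_real (\<integral>z. poisson_kernel w z \<partial>circle_measure) = 1"
    by simp
  then show ?thesis
    using of_real_eq_1_iff by blast
qed

text \<open>The kernel is nonnegative with mass one, so the value in the disk is an average of
  boundary values. This upper bound on the real part is what fails for inverses of singular inner
  functions.\<close>

lemma Re_holo_ext_le:
  assumes f: "f \<in> H2_circle" and M: "AE z in circle_measure. Re (f z) \<le> M" and w: "norm w < 1"
  shows "Re (holo_ext f w) \<le> M"
proof -
  have fi: "integrable circle_measure f" using f by (auto intro: L2_integrable H2_L2)
  have i: "integrable circle_measure (\<lambda>z. of_real (poisson_kernel w z) * f z)"
    by (intro integrable_continuous_mult continuous_intros continuous_poisson_kernel w fi)
  have "Re (holo_ext f w) = Re (\<integral>z. of_real (poisson_kernel w z) * f z \<partial>circle_measure)"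
    using poisson_integral[OF fi H2_coeff[OF f] w] by simp
  also have "\<dots> = (\<integral>z. Re (of_real (poisson_kernel w z) * f z) \<partial>circle_measure)"
    by (rule integral_Re[OF i, symmetric])
  also have "\<dots> \<le> (\<integral>z. poisson_kernel w z * M \<partial>circle_measure)"
  proof (rule integral_mono_AE)
    have "AE z in circle_measure. norm z = 1"
      by (rule AE_I2) simp
    with M show "AE z in circle_measure. Re (of_real (poisson_kernel w z) * f z) \<le> poisson_kernel w z * M"
      by eventually_elim (use poisson_kernel_nonneg[OF w] in \<open>auto intro: mult_left_mono\<close>)
    show "integrable circle_measure (\<lambda>z. Re (of_real (poisson_kernel w z) * f z))"
      by (rule integrable_Re[OF i])
    show "integrable circle_measure (\<lambda>z. poisson_kernel w z * M)"
      by (intro continuous_integrable_circle continuous_intros continuous_poisson_kernel w)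
  qed
  also have "\<dots> = M"
    by (simp add: integral_poisson_kernel[OF w])
  finally show ?thesis .
qed

section \<open>Almost everywhere limits and exponentials bounded above\<close>

lemma L2_tendsto_AE_subseq:
  fixes u :: "nat \<Rightarrow> complex \<Rightarrow> 'a::euclidean_space"
  assumes u: "\<And>n. u n \<in> L2_circle" and g: "g \<in> L2_circle" and lim: "L2_tendsto u g sequentially"
  obtains s :: "nat \<Rightarrow> nat" where "strict_mono s" "AE z in circle_measure. (\<lambda>n. u (s n) z) \<longlonglongrightarrow> g z"
proof -
  have "\<exists>s::nat\<Rightarrow>nat. strict_mono s \<and> (AE z in circle_measure. (\<lambda>n. (norm (u (s n) z - g z))\<^sup>2) \<longlonglongrightarrow> 0)"
    by (rule tendsto_L1_AE_subseq) (use lim L2_sq_integrable[OF L2_diff[OF u g]] in \<open>auto simp: L2_tendsto_def\<close>)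
  then obtain s :: "nat \<Rightarrow> nat" where s: "strict_mono s" and
    "AE z in circle_measure. (\<lambda>n. (norm (u (s n) z - g z))\<^sup>2) \<longlonglongrightarrow> 0"
    by blast
  from this(2) have "AE z in circle_measure. (\<lambda>n. u (s n) z) \<longlonglongrightarrow> g z"
  proof eventually_elim
    case (elim z)
    from tendsto_real_sqrt[OF elim] have "(\<lambda>n. norm (u (s n) z - g z)) \<longlonglongrightarrow> 0"
      by simp
    then show ?case
      using Lim_null tendsto_norm_zero_iff by blast
  qed
  with s show thesis by (rule that)
qed

lemma fourier_coeff_dominated_limit:
  assumes "integrable circle_measure b"
    and [measurable]: "\<And>j::nat. u j \<in> borel_measurable circle_measure" "g \<in> borel_measurable circle_measure"
    and lim: "AE z in circle_measure. (\<lambda>j. u j z) \<longlonglongrightarrow> g z"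
    and bound: "\<And>j. AE z in circle_measure. norm (u j z) \<le> b z"
  shows "(\<lambda>j. fourier_coeff (u j) n) \<longlonglongrightarrow> fourier_coeff g n"
  unfolding fourier_coeff_def
proof (rule integral_dominated_convergence[OF _ _ assms(1)])
  show "AE z in circle_measure. (\<lambda>j. z powi (-n) * u j z) \<longlonglongrightarrow> z powi (-n) * g z"
    using lim by eventually_elim (intro tendsto_intros)
  show "AE z in circle_measure. norm (z powi (-n) * u j z) \<le> b z" for j
  proof -
    have "AE z in circle_measure. norm z = 1"
      by (rule AE_I2) simp
    with bound[of j] show ?thesis
      by eventually_elim (simp add: norm_mult norm_powi_unit)
  qed
qed measurable

text \<open>The dilations of exp (\<open>holo_ext x\<close>) have no negative coefficients and are
  bounded by exp \<open>M\<close> uniformly in the radius, by \<open>Re_holo_ext_le\<close>.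
  Dominated convergence along radii with almost everywhere convergence carries this to the
  boundary.\<close>

lemma exp_H2_bounded_above:
  assumes x: "x \<in> H2_circle" and M: "AE z in circle_measure. Re (x z) \<le> M"
  shows "(\<lambda>z. exp (x z)) \<in> H2_circle"
proof (rule H2I)
  have xL: "x \<in> L2_circle" using x by (rule H2_L2)
  note [measurable] = L2_measurable[OF xL]
  show "(\<lambda>z. exp (x z)) \<in> L2_circle"
    by (rule L2_bounded[of _ "exp M"]) (use M in \<open>auto elim: eventually_mono\<close>)
  fix n :: int assume n: "n < 0"
  have F: "holo_ext x holomorphic_on ball 0 1"
    by (rule holo_ext_holomorphic[OF L2_integrable[OF xL]])
  define r where "r j = 1 - 1 / (real j + 2)" for j :: nat
  have r: "0 \<le> r j" "r j < 1" for j by (auto simp: r_def field_simps)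
  have "r \<longlonglongrightarrow> 1" unfolding r_def by real_asymp
  then have rlim: "filterlim r (at_left 1) sequentially"
    using r by (simp add: filterlim_at less_imp_neq)
  have "L2_tendsto (\<lambda>r z. holo_ext x (of_real r * z)) x (at_left 1)"
    using H2_boundary_values[OF x] by (simp add: boundary_values_def)
  then have "L2_tendsto (\<lambda>j z. holo_ext x (of_real (r j) * z)) x sequentially"
    unfolding L2_tendsto_def by (rule filterlim_compose) (rule rlim)
  then obtain s :: "nat \<Rightarrow> nat" where s: "AE z in circle_measure. (\<lambda>j. holo_ext x (of_real (r (s j)) * z)) \<longlonglongrightarrow> x z"
    by (rule L2_tendsto_AE_subseq[rotated 2]) (use r in \<open>auto intro!: L2_continuous continuous_on_dilation F xL\<close>)
  have cont: "continuous_on (sphere 0 1) (\<lambda>z. exp (holo_ext x (of_real (r j) * z)))" for j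
    by (intro continuous_intros continuous_on_dilation F r)
  have "(\<lambda>j. fourier_coeff (\<lambda>z. exp (holo_ext x (of_real (r (s j)) * z))) n) \<longlonglongrightarrow> fourier_coeff (\<lambda>z. exp (x z)) n"
  proof (rule fourier_coeff_dominated_limit[of "\<lambda>_. exp M"])
    show "AE z in circle_measure. (\<lambda>j. exp (holo_ext x (of_real (r (s j)) * z))) \<longlonglongrightarrow> exp (x z)"
      using s by eventually_elim (intro tendsto_intros)
    show "AE z in circle_measure. norm (exp (holo_ext x (of_real (r (s j)) * z))) \<le> exp M" for j
      using Re_holo_ext_le[OF x M] r by (intro AE_sphere) (simp add: norm_mult)
  qed (auto intro!: continuous_measurable_circle cont)
  moreover have "fourier_coeff (\<lambda>z. exp (holo_ext x (of_real (r j) * z))) n = 0" for j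
    using fourier_coeff_dilation_neg[of "\<lambda>w. exp (holo_ext x w)", OF _ r n] F
    by (auto intro: holomorphic_intros)
  ultimately show "fourier_coeff (\<lambda>z. exp (x z)) n = 0"
    by (simp add: LIMSEQ_const_iff)
qed

text \<open>\<open>V\<close> is v plus i times its conjugate function. Doubling the positive
  frequencies and dropping the negative ones makes V + cnj V = 2 v, because the coefficients of a
  real function are conjugate symmetric. The 4 is the square of the doubling.\<close>

lemma analytic_completion:
  fixes v :: "complex \<Rightarrow> real"
  assumes v: "(\<lambda>z. complex_of_real (v z)) \<in> L2_circle"
  obtains V where "V \<in> H2_circle" "AE z in circle_measure. Re (V z) = v z"
    "(\<integral>z. (norm (V z))\<^sup>2 \<partial>circle_measure) \<le> 4 * (\<integral>z. (v z)\<^sup>2 \<partial>circle_measure)"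
proof -
  let ?v = "\<lambda>z. complex_of_real (v z)"
  let ?c = "\<lambda>n. if n > 0 then 2 * fourier_coeff ?v n else if n = 0 then fourier_coeff ?v 0 else 0"
  have "(\<Sum>k\<in>A. (norm (?c k))\<^sup>2) \<le> 4 * (\<integral>z. (v z)\<^sup>2 \<partial>circle_measure)" if "finite A" for A
  proof -
    have "(\<Sum>k\<in>A. (norm (?c k))\<^sup>2) \<le> (\<Sum>k\<in>A. 4 * (norm (fourier_coeff ?v k))\<^sup>2)"
      by (rule sum_mono) (auto simp: norm_mult power_mult_distrib)
    also have "\<dots> \<le> 4 * (\<integral>z. (norm (?v z))\<^sup>2 \<partial>circle_measure)"
      using Bessel_inequality[OF v that] by (simp add: sum_distrib_left[symmetric])
    finally show ?thesis by simp
  qed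
  then obtain V where V: "V \<in> L2_circle" "\<And>n. fourier_coeff V n = ?c n"
    "(\<integral>z. (norm (V z))\<^sup>2 \<partial>circle_measure) \<le> 4 * (\<integral>z. (v z)\<^sup>2 \<partial>circle_measure)"
    using Riesz_Fischer[of ?c "4 * (\<integral>z. (v z)\<^sup>2 \<partial>circle_measure)"] by blast
  have sym: "cnj (fourier_coeff ?v (- n)) = fourier_coeff ?v n" for n
    using fourier_coeff_cnj[of ?v n] by simp
  have "AE z in circle_measure. V z + cnj (V z) = 2 * ?v z"
  proof (rule fourier_coeff_unique)
    show "integrable circle_measure (\<lambda>z. V z + cnj (V z))"
      by (intro L2_integrable L2_add L2_cnj V)
    show "integrable circle_measure (\<lambda>z. 2 * ?v z)"
      by (intro L2_integrable L2_cmult v)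
    show "fourier_coeff (\<lambda>z. V z + cnj (V z)) n = fourier_coeff (\<lambda>z. 2 * ?v z) n" for n
      using sym[of n] sym[of 0]
      by (subst fourier_coeff_add)
         (auto simp: fourier_coeff_cnj fourier_coeff_cmult V(2) intro: L2_integrable L2_cnj V(1))
  qed
  then have "AE z in circle_measure. Re (V z) = v z"
  proof eventually_elim
    case (elim z)
    then have "Re (V z + cnj (V z)) = Re (2 * ?v z)" by (simp only:)
    then show ?case by simp
  qed
  moreover have "V \<in> H2_circle"
    using V by (intro H2I) auto
  ultimately show thesis
    using V(3) that by blast
qed

text \<open>Truncation from above: if \<open>v\<^sub>j = min 0 (j - Re x)\<close> is the real part of \<open>V\<^sub>j \<in> H\<^sup>2\<close>, then
  \<open>exp (V\<^sub>j + x)\<close> is bounded, and \<open>exp V\<^sub>j\<close> is a contraction tending to \<open>1\<close>.\<close>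

theorem H2_exp_mult:
  assumes x: "x \<in> H2_circle" and \<phi>: "\<phi> \<in> H2_circle" and y: "(\<lambda>z. exp (x z) * \<phi> z) \<in> L2_circle"
  shows "(\<lambda>z. exp (x z) * \<phi> z) \<in> H2_circle"
proof -
  note xL = H2_L2[OF x] and \<phi>L = H2_L2[OF \<phi>]
  note [measurable] = L2_measurable[OF xL] L2_measurable[OF \<phi>L]
  define v where "v j z = min 0 (real j - Re (x z))" for j :: nat and z
  have [measurable]: "v j \<in> borel_measurable circle_measure" for j
    unfolding v_def by measurable
  have vx: "(v j z)\<^sup>2 \<le> (norm (x z))\<^sup>2" for j z
  proof -
    have "\<bar>v j z\<bar> \<le> \<bar>norm (x z)\<bar>"
      using complex_Re_le_cmod[of "x z"] by (auto simp: v_def min_def)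
    then show ?thesis by (simp only: abs_le_square_iff)
  qed
  have vL: "(\<lambda>z. complex_of_real (v j z)) \<in> L2_circle" for j
    by (rule L2_dominated[OF _ L2_sq_integrable[OF xL]]) (use vx in auto)
  have vlim: "(\<lambda>j. \<integral>z. (v j z)\<^sup>2 \<partial>circle_measure) \<longlonglongrightarrow> 0"
  proof -
    have "(\<lambda>j. \<integral>z. (v j z)\<^sup>2 \<partial>circle_measure) \<longlonglongrightarrow> (\<integral>z. 0 \<partial>circle_measure)"
    proof (rule integral_dominated_convergence[OF _ _ L2_sq_integrable[OF xL]])
      show "AE z in circle_measure. (\<lambda>j. (v j z)\<^sup>2) \<longlonglongrightarrow> 0"
      proof (rule AE_I2)
        fix z
        have "eventually (\<lambda>j. real j \<ge> Re (x z)) sequentially"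
          by (rule eventually_sequentiallyI[of "nat \<lceil>Re (x z)\<rceil>"]) linarith
        then have "eventually (\<lambda>j. (v j z)\<^sup>2 = 0) sequentially"
          by eventually_elim (auto simp: v_def)
        then show "(\<lambda>j. (v j z)\<^sup>2) \<longlonglongrightarrow> 0"
          by (rule tendsto_eventually)
      qed
      show "AE z in circle_measure. norm ((v j z)\<^sup>2) \<le> (norm (x z))\<^sup>2" for j
        using vx by (intro AE_I2) simp
    qed measurable
    then show ?thesis by simp
  qed
  have "\<exists>V. \<forall>j. V j \<in> H2_circle \<and> (AE z in circle_measure. Re (V j z) = v j z) \<and>
      (\<integral>z. (norm (V j z))\<^sup>2 \<partial>circle_measure) \<le> 4 * (\<integral>z. (v j z)\<^sup>2 \<partial>circle_measure)"
  proof (rule choice, rule allI)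
    fix j
    show "\<exists>V. V \<in> H2_circle \<and> (AE z in circle_measure. Re (V z) = v j z) \<and>
      (\<integral>z. (norm (V z))\<^sup>2 \<partial>circle_measure) \<le> 4 * (\<integral>z. (v j z)\<^sup>2 \<partial>circle_measure)"
      by (rule analytic_completion[OF vL[of j]]) blast
  qed
  then obtain V where V: "\<And>j. V j \<in> H2_circle" "\<And>j. AE z in circle_measure. Re (V j z) = v j z"
      "\<And>j. (\<integral>z. (norm (V j z))\<^sup>2 \<partial>circle_measure) \<le> 4 * (\<integral>z. (v j z)\<^sup>2 \<partial>circle_measure)"
    by blast
  note [measurable] = L2_measurable[OF H2_L2[OF V(1)]]
  \<comment> \<open>The truncation controls only Re (\<open>V j\<close>) pointwise. The imaginary
    part is controlled in L^2 through the norm bound of the completion, so a subsequence is needed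
    for pointwise convergence.\<close>
  have "L2_tendsto V (\<lambda>_. 0) sequentially"
    unfolding L2_tendsto_def diff_zero
  proof (rule tendsto_sandwich[where f = "\<lambda>_. 0"])
    show "(\<lambda>j. 4 * (\<integral>z. (v j z)\<^sup>2 \<partial>circle_measure)) \<longlonglongrightarrow> 0"
      using tendsto_mult_left[OF vlim, of 4] by simp
  qed (use V(3) in auto)
  then obtain s :: "nat \<Rightarrow> nat" where s: "AE z in circle_measure. (\<lambda>j. V (s j) z) \<longlonglongrightarrow> 0"
    by (rule L2_tendsto_AE_subseq[rotated 2]) (auto intro: H2_L2 V L2_continuous)
  have zero: "fourier_coeff (\<lambda>z. exp (V j z + x z) * \<phi> z) n = 0" if "n < 0" for j n
  proof -
    have b: "AE z in circle_measure. Re (V j z + x z) \<le> real j"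
      using V(2)[of j] by eventually_elim (simp add: v_def)
    have "(\<lambda>z. exp (V j z + x z)) \<in> H2_circle"
      by (rule exp_H2_bounded_above[OF H2_add[OF V(1) x] b])
    moreover have "(\<lambda>z. exp (V j z + x z) * \<phi> z) \<in> L2_circle"
      by (rule L2_bounded_mult[OF \<phi>L, of _ "exp (real j)"]) (use b in \<open>auto elim: eventually_mono\<close>)
    ultimately show ?thesis
      using H2_mult \<phi> H2_coeff that by blast
  qed
  show ?thesis
  proof (rule H2I[OF y])
    fix n :: int assume n: "n < 0"
    have "(\<lambda>j. fourier_coeff (\<lambda>z. exp (V (s j) z + x z) * \<phi> z) n) \<longlonglongrightarrow> fourier_coeff (\<lambda>z. exp (x z) * \<phi> z) n"
    \<comment> \<open>Since Re (\<open>V (s j)\<close>) \<le> 0, the target product dominates all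
      approximants; its integrability comes from the hypothesis \<open>y\<close>.\<close>
    proof (rule fourier_coeff_dominated_limit)
      show "integrable circle_measure (\<lambda>z. norm (exp (x z) * \<phi> z))"
        by (intro integrable_norm L2_integrable y)
      show "AE z in circle_measure. (\<lambda>j. exp (V (s j) z + x z) * \<phi> z) \<longlonglongrightarrow> exp (x z) * \<phi> z"
        using s
      proof eventually_elim
        case (elim z)
        then have "(\<lambda>j. exp (V (s j) z + x z) * \<phi> z) \<longlonglongrightarrow> exp (0 + x z) * \<phi> z"
          by (intro tendsto_intros)
        then show ?case by simp
      qed
      show "AE z in circle_measure. norm (exp (V (s j) z + x z) * \<phi> z) \<le> norm (exp (x z) * \<phi> z)" for j
        using V(2)[of "s j"]
        by eventually_elim (auto simp: norm_mult v_def intro!: mult_right_mono)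
    qed measurable
    then show "fourier_coeff (\<lambda>z. exp (x z) * \<phi> z) n = 0"
      using zero[OF n] by (simp add: LIMSEQ_const_iff)
  qed
qed

subsection \<open>Fourier coefficients of functions of vanishing mean oscillation\<close>

definition avg :: "(real \<Rightarrow> complex) \<Rightarrow> real \<Rightarrow> real \<Rightarrow> complex" where
  "avg F s l = (LINT x:{s..s+l}|lborel. F x) /\<^sub>R l"

text \<open>\<open>sqsum F n s l a\<close> is the integral of \<open>|F\<^sub>n - a|\<^sup>2\<close> over \<open>[s, s + l]\<close>, where \<open>F\<^sub>n\<close> averages \<open>F\<close>
  over the \<open>2\<^sup>n\<close> dyadic pieces.\<close>

fun sqsum :: "(real \<Rightarrow> complex) \<Rightarrow> nat \<Rightarrow> real \<Rightarrow> real \<Rightarrow> complex \<Rightarrow> real" where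
  "sqsum F 0 s l a = l * (norm (avg F s l - a))\<^sup>2"
| "sqsum F (Suc n) s l a = sqsum F n s (l/2) a + sqsum F n (s + l/2) (l/2) a"

lemma set_integral_halves:
  fixes F :: "real \<Rightarrow> 'a::{banach, second_countable_topology}"
  assumes "set_integrable lborel {s..s+l} F" "0 < l"
  shows "(LINT x:{s..s+l}|lborel. F x) = (LINT x:{s..s+l/2}|lborel. F x) + (LINT x:{s+l/2..s+l/2+l/2}|lborel. F x)"
    and "set_integrable lborel {s..s+l/2} F" "set_integrable lborel {s+l/2..s+l/2+l/2} F"
proof -
  show 1: "set_integrable lborel {s..s+l/2} F" and 2: "set_integrable lborel {s+l/2..s+l/2+l/2} F"
    by (rule set_integrable_subset[OF assms(1)]; use assms(2) in auto)+
  have "{s..s+l} = {s..s+l/2} \<union> {s+l/2..s+l/2+l/2}"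
    using assms(2) by auto
  then have "(LINT x:{s..s+l}|lborel. F x) = (LINT x:({s..s+l/2} \<union> {s+l/2..s+l/2+l/2})|lborel. F x)"
    by simp
  also have "\<dots> = (LINT x:{s..s+l/2}|lborel. F x) + (LINT x:{s+l/2..s+l/2+l/2}|lborel. F x)"
  proof (rule set_integral_Un_AE[OF _ _ _ 1 2])
    have "AE x in lborel. x \<noteq> s + l/2"
      by (rule AE_lborel_singleton)
    then show "AE x in lborel. \<not> (x \<in> {s..s+l/2} \<and> x \<in> {s+l/2..s+l/2+l/2})"
      by eventually_elim auto
  qed auto
  finally show "(LINT x:{s..s+l}|lborel. F x) = (LINT x:{s..s+l/2}|lborel. F x) + (LINT x:{s+l/2..s+l/2+l/2}|lborel. F x)" .
qed

lemma avg_halves: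
  assumes "set_integrable lborel {s..s+l} F" "0 < l"
  shows "avg F s l = (avg F s (l/2) + avg F (s + l/2) (l/2)) / 2"
  unfolding avg_def set_integral_halves(1)[OF assms]
  using assms(2) by (simp add: scaleR_conv_of_real field_simps)

lemma set_integral_eq_avg:
  "0 < l \<Longrightarrow> (LINT x:{s..s+l}|lborel. F x) = of_real l * avg F s l"
  by (simp add: avg_def scaleR_conv_of_real)

lemma set_integrable_interval_const:
  "set_integrable lborel {s..s+l::real} (\<lambda>_. c::'a::{banach, second_countable_topology})"
  by (rule borel_integrable_atLeastAtMost') (rule continuous_on_const)

lemma set_integral_interval_const:
  "0 \<le> l \<Longrightarrow> (LINT x:{s..s+l::real}|lborel. c::complex) = of_real l * c"
  by (simp add: set_lebesgue_integral_def scaleR_conv_of_real)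

lemma set_integral_norm_le:
  fixes F :: "real \<Rightarrow> complex"
  assumes "set_integrable lborel A F"
  shows "norm (LINT x:A|lborel. F x) \<le> (LINT x:A|lborel. norm (F x))"
proof -
  have "norm (LINT x:A|lborel. F x) \<le> (\<integral>x. norm (indicator A x *\<^sub>R F x) \<partial>lborel)"
    unfolding set_lebesgue_integral_def by (rule integral_norm_bound)
  then show ?thesis
    by (simp add: set_lebesgue_integral_def)
qed

lemma norm_avg_diff_le:
  assumes F: "set_integrable lborel {s..s+l} F" and l: "0 < l"
  shows "l * norm (avg F s l - a) \<le> (LINT x:{s..s+l}|lborel. norm (F x - a))"
proof -
  have i: "set_integrable lborel {s..s+l} (\<lambda>x. F x - a)"
    by (intro set_integral_diff F set_integrable_interval_const)
  have "of_real l * (avg F s l - a) = (LINT x:{s..s+l}|lborel. F x - a)"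
    using l set_integral_diff(2)[OF F set_integrable_interval_const[of s l a]]
    by (simp add: set_integral_eq_avg[OF l, of s F] set_integral_interval_const right_diff_distrib)
  then have "l * norm (avg F s l - a) = norm (LINT x:{s..s+l}|lborel. F x - a)"
    using l by (metis abs_of_pos norm_mult norm_of_real)
  also have "\<dots> \<le> (LINT x:{s..s+l}|lborel. norm (F x - a))"
    by (rule set_integral_norm_le[OF i])
  finally show ?thesis .
qed

lemma Re_mult_cnj_self: "Re (a * cnj a) = (norm a)\<^sup>2"
  unfolding cmod_power2 by (simp add: power2_eq_square)

lemma set_integral_mono_subset:
  fixes h :: "real \<Rightarrow> real"
  assumes h: "set_integrable lborel B h" "\<And>x. 0 \<le> h x" and "A \<subseteq> B" "A \<in> sets lborel"
  shows "(LINT x:A|lborel. h x) \<le> (LINT x:B|lborel. h x)"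
  unfolding set_lebesgue_integral_def
proof (rule integral_mono)
  show "integrable lborel (\<lambda>x. indicator A x *\<^sub>R h x)"
    using set_integrable_subset[OF h(1) assms(4,3)] by (simp add: set_integrable_def)
  show "integrable lborel (\<lambda>x. indicator B x *\<^sub>R h x)"
    using h(1) by (simp add: set_integrable_def)
  show "indicator A x *\<^sub>R h x \<le> indicator B x *\<^sub>R h x" for x
    using assms(2,3) by (auto simp: indicator_def)
qed

lemma Re_complex_of_real_mult: "Re (of_real l * w) = l * Re w"
  by simp

text \<open>The averages over the dyadic pieces have the same mean as F over the whole interval, so
  the linear and constant terms in \<open>a\<close> do not depend on \<open>n\<close>.\<close>

lemma sqsum_expand:
  assumes "set_integrable lborel {s..s+l} F" "0 < l"
  shows "sqsum F n s l a = sqsum F n s l 0 - 2 * l * Re (avg F s l * cnj a) + l * (norm a)\<^sup>2"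
  using assms
proof (induction n arbitrary: s l)
  case 0
  have "(norm (avg F s l - a))\<^sup>2 = (norm (avg F s l))\<^sup>2 + (norm a)\<^sup>2 - 2 * Re (avg F s l * cnj a)"
    by (rule norm_diff_sq)
  then show ?case
    unfolding sqsum.simps diff_zero by (simp only: right_diff_distrib distrib_left mult_ac)
next
  case (Suc n)
  note h = set_integral_halves(2,3)[OF Suc.prems]
  have "Re (avg F s l * cnj a) = (Re (avg F s (l/2) * cnj a) + Re (avg F (s + l/2) (l/2) * cnj a)) / 2"
    unfolding avg_halves[OF Suc.prems] by (simp add: field_simps)
  then show ?case
    using Suc.IH[OF h(1)] Suc.IH[OF h(2)] Suc.prems(2) by (simp add: field_simps)
qed

text \<open>The parallel axis theorem: among all centres the mean is optimal, and any other centre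
  costs the squared distance times the length.\<close>

lemma sqsum_shift:
  assumes "set_integrable lborel {s..s+l} F" "0 < l"
  shows "sqsum F n s l a = sqsum F n s l (avg F s l) + l * (norm (avg F s l - a))\<^sup>2"
proof -
  have "Re (avg F s l * cnj (avg F s l)) = (norm (avg F s l))\<^sup>2"
    by (rule Re_mult_cnj_self)
  then show ?thesis
    unfolding sqsum_expand[OF assms, of n a] sqsum_expand[OF assms, of n "avg F s l"] norm_diff_sq
    by (simp add: algebra_simps)
qed

text \<open>The term linear in \<open>|F - a|\<close> pays for recentring at a dyadic piece whose average has moved away
  from \<open>a\<close> by more than \<open>2 C\<close>; this replaces the stopping time of the John--Nirenberg inequality.\<close>

lemma sqsum_le_mean_oscillation:
  assumes F: "set_integrable lborel {s..s+l} F" "0 < l" and C: "0 \<le> C"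
    and osc: "\<And>s' l'. 0 < l' \<Longrightarrow> s \<le> s' \<Longrightarrow> s' + l' \<le> s + l \<Longrightarrow>
      (LINT x:{s'..s'+l'}|lborel. norm (F x - avg F s' l')) \<le> C * l'"
    and a: "norm (avg F s l - a) \<le> 2 * C"
  shows "sqsum F n s l a \<le> 4 * C\<^sup>2 * l + 16 * C * (LINT x:{s..s+l}|lborel. norm (F x - a))"
  using assms
proof (induction n arbitrary: s l a)
  case 0
  have "(norm (avg F s l - a))\<^sup>2 \<le> (2 * C)\<^sup>2"
    by (intro power_mono 0) auto
  then have "l * (norm (avg F s l - a))\<^sup>2 \<le> 4 * C\<^sup>2 * l"
    using mult_left_mono[of "(norm (avg F s l - a))\<^sup>2" "4 * C\<^sup>2" l] 0 by (simp add: power_mult_distrib mult.commute)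
  moreover have "0 \<le> (LINT x:{s..s+l}|lborel. norm (F x - a))"
    unfolding set_lebesgue_integral_def by (rule Bochner_Integration.integral_nonneg) simp
  then have "0 \<le> 16 * C * (LINT x:{s..s+l}|lborel. norm (F x - a))"
    using 0 by simp
  ultimately show ?case by simp
next
  case (Suc n)
  let ?m = "avg F s l"
  have id: "set_integrable lborel {s..s+l} (\<lambda>x. norm (F x - b))" for b
    by (intro set_integrable_norm set_integral_diff Suc.prems set_integrable_interval_const)
  have child: "sqsum F n s' (l/2) a \<le> 4 * C\<^sup>2 * (l/2) + 16 * C * (LINT x:{s'..s'+l/2}|lborel. norm (F x - a))"
    if s': "s' = s \<or> s' = s + l/2" for s'
  proof -
    have sub: "s \<le> s'" "s' + l/2 \<le> s + l" and l2: "0 < l/2"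
      using s' Suc.prems(2) by auto
    have F': "set_integrable lborel {s'..s'+l/2} F"
      by (rule set_integrable_subset[OF Suc.prems(1)]) (use sub in auto)
    have osc': "(LINT x:{t..t+k}|lborel. norm (F x - avg F t k)) \<le> C * k"
      if "0 < k" "s' \<le> t" "t + k \<le> s' + l/2" for t k
      using that sub by (intro Suc.prems(4)) auto
    let ?m' = "avg F s' (l/2)"
    \<comment> \<open>A half carries at most the whole oscillation \<open>C * l\<close> on half the
      length, so its mean moves by at most 2 C. Together with the 2 C allowed for \<open>a\<close>
      this gives the bound 4 C below.\<close>
    have "l/2 * norm (?m' - ?m) \<le> (LINT x:{s'..s'+l/2}|lborel. norm (F x - ?m))"
      by (rule norm_avg_diff_le[OF F' l2])
    also have "\<dots> \<le> (LINT x:{s..s+l}|lborel. norm (F x - ?m))"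
      by (rule set_integral_mono_subset[OF id]) (use sub in auto)
    also have "\<dots> \<le> C * l"
      using Suc.prems(2) by (intro Suc.prems(4)) auto
    finally have "l * norm (?m' - ?m) \<le> l * (2 * C)"
      by (simp add: mult_ac)
    then have "norm (?m' - ?m) \<le> 2 * C"
      using Suc.prems(2) by (simp only: mult_le_cancel_left_pos)
    then have m'a: "norm (?m' - a) \<le> 4 * C"
      using Suc.prems(5) norm_triangle_ineq[of "?m' - ?m" "?m - a"] by simp
    show ?thesis
    \<comment> \<open>In the second case recentring at \<open>?m'\<close> costs at most 16 C^2 per
      unit length, and the new linear term at most another 16 C^2. Both are paid by the old linear
      term, which is at least 16 C times 2 C per unit length because \<open>?m'\<close> is more than
      2 C from \<open>a\<close>. This balance fixes the constant 16.\<close>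
    proof (cases "norm (?m' - a) \<le> 2 * C")
      case True
      show ?thesis
        by (rule Suc.IH[OF F' l2 C osc' True])
    next
      case False
      have "sqsum F n s' (l/2) ?m' \<le> 4 * C\<^sup>2 * (l/2) + 16 * C * (LINT x:{s'..s'+l/2}|lborel. norm (F x - ?m'))"
        using C by (intro Suc.IH[OF F' l2 C osc']) auto
      moreover have "16 * C * (LINT x:{s'..s'+l/2}|lborel. norm (F x - ?m')) \<le> 16 * C * (C * (l/2))"
        by (intro mult_left_mono osc' l2) (use C in auto)
      moreover have "l/2 * (norm (?m' - a))\<^sup>2 \<le> l/2 * (4 * C)\<^sup>2"
        by (intro mult_left_mono power_mono m'a) (use l2 in auto)
      moreover have "16 * C * (l/2 * (2 * C)) \<le> 16 * C * (l/2 * norm (?m' - a))"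
        using False C l2 by (intro mult_left_mono) auto
      moreover have "16 * C * (l/2 * norm (?m' - a)) \<le> 16 * C * (LINT x:{s'..s'+l/2}|lborel. norm (F x - a))"
        by (intro mult_left_mono norm_avg_diff_le F' l2) (use C in auto)
      ultimately show ?thesis
        unfolding sqsum_shift[OF F' l2, of n a] by (simp add: power2_eq_square)
    qed
  qed
  have "sqsum F (Suc n) s l a \<le> 4 * C\<^sup>2 * l + 16 * C * ((LINT x:{s..s+l/2}|lborel. norm (F x - a)) +
      (LINT x:{s+l/2..s+l/2+l/2}|lborel. norm (F x - a)))"
    using child[of s] child[of "s + l/2"] by (simp add: algebra_simps)
  then show ?case
    unfolding set_integral_halves(1)[OF id Suc.prems(2)] .
qed

text \<open>Oscillation is controlled only on intervals shorter than \<delta>. After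
  \<open>k\<close> halvings the pieces are that short; there the sums are bounded around the mean
  and moved back to centre 0.\<close>

lemma sqsum_bounded:
  assumes F: "set_integrable lborel {s..s+l} F" "0 < l" and C: "0 \<le> C" and \<delta>: "l < \<delta> * 2 ^ k"
    and osc: "\<And>s' l'. 0 < l' \<Longrightarrow> l' < \<delta> \<Longrightarrow> s \<le> s' \<Longrightarrow> s' + l' \<le> s + l \<Longrightarrow>
      (LINT x:{s'..s'+l'}|lborel. norm (F x - avg F s' l')) \<le> C * l'"
  shows "\<exists>B. \<forall>n. sqsum F n s l 0 \<le> B"
  using assms
proof (induction k arbitrary: s l)
  case 0
  have "sqsum F n s l 0 \<le> 4 * C\<^sup>2 * l + 16 * C * (LINT x:{s..s+l}|lborel. norm (F x - avg F s l)) + l * (norm (avg F s l - 0))\<^sup>2" for n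
    unfolding sqsum_shift[OF 0(1,2), of n 0]
    using 0 by (intro add_right_mono sqsum_le_mean_oscillation) auto
  then show ?case by blast
next
  case (Suc k)
  note h = set_integral_halves(2,3)[OF Suc.prems(1,2)]
  have "\<exists>B. \<forall>n. sqsum F n s (l/2) 0 \<le> B"
    using Suc.prems by (intro Suc.IH h(1)) auto
  moreover have "\<exists>B. \<forall>n. sqsum F n (s + l/2) (l/2) 0 \<le> B"
    using Suc.prems by (intro Suc.IH h(2)) auto
  ultimately obtain B1 B2 where B: "\<And>n. sqsum F n s (l/2) 0 \<le> B1" "\<And>n. sqsum F n (s + l/2) (l/2) 0 \<le> B2"
    by blast
  \<comment> \<open>The bounds on the halves concern only positive depth; depth 0 enters through the
    maximum.\<close>
  have "sqsum F n s l 0 \<le> max (sqsum F 0 s l 0) (B1 + B2)" for n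
  proof (cases n)
    case (Suc m)
    then show ?thesis using B(1)[of m] B(2)[of m] by simp
  qed simp
  then show ?case by blast
qed

section \<open>Pairing an integrable function with a continuous one\<close>

lemma continuous_set_integrable:
  fixes g :: "real \<Rightarrow> 'a::{banach, second_countable_topology}"
  assumes "continuous_on UNIV g"
  shows "set_integrable lborel {s..s+l} g"
  by (rule borel_integrable_atLeastAtMost') (rule continuous_on_subset[OF assms], simp)

lemma set_integrable_mult_continuous:
  fixes F g :: "real \<Rightarrow> complex"
  assumes F: "set_integrable lborel {s..s+l} F" and g: "continuous_on UNIV g"
  shows "set_integrable lborel {s..s+l} (\<lambda>x. F x * g x)"
proof -
  have "compact (g ` {s..s+l})"
    by (intro compact_continuous_image continuous_on_subset[OF g]) auto
  then obtain K where K: "\<And>x. x \<in> {s..s+l} \<Longrightarrow> norm (g x) \<le> K"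
    using compact_imp_bounded bounded_iff by (metis imageI)
  have [measurable]: "g \<in> borel_measurable lborel"
    using g by (simp add: borel_measurable_continuous_onI)
  have [measurable]: "(\<lambda>x. indicator {s..s+l} x *\<^sub>R F x) \<in> borel_measurable lborel"
    using F by (auto simp: set_integrable_def)
  have eq: "indicator {s..s+l} x *\<^sub>R (F x * g x) = (indicator {s..s+l} x *\<^sub>R F x) * g x" for x
    by simp
  show ?thesis
    unfolding set_integrable_def eq
  proof (rule Bochner_Integration.integrable_bound)
    show "integrable lborel (\<lambda>x. K * norm (indicator {s..s+l} x *\<^sub>R F x))"
      using F unfolding set_integrable_def by (intro integrable_mult_right integrable_norm)
    show "AE x in lborel. norm ((indicator {s..s+l} x *\<^sub>R F x) * g x) \<le> norm (K * norm (indicator {s..s+l} x *\<^sub>R F x))"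
    proof (rule AE_I2)
      fix x
      show "norm ((indicator {s..s+l} x *\<^sub>R F x) * g x) \<le> norm (K * norm (indicator {s..s+l} x *\<^sub>R F x))"
        using K[of x] mult_right_mono[of "norm (g x)" "\<bar>K\<bar>" "norm (F x)"]
        by (cases "x \<in> {s..s+l}") (auto simp: norm_mult abs_mult mult.commute)
    qed
  qed measurable
qed

text \<open>On each dyadic piece \<open>g\<close> is replaced by its mean, an error of at most
  \<epsilon>. What remains pairs the averages of \<open>F\<close> with those of \<open>g\<close>,
  and 2 |u v| \<le> |u|^2 + |v|^2 separates them. Thus dyadic averages test \<open>F\<close> against
  \<open>g\<close> without square integrability of \<open>F\<close>.\<close>

lemma pairing_le_sqsum:
  assumes F: "set_integrable lborel {s..s+l} F" "0 < l" and g: "continuous_on UNIV g"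
    and \<epsilon>: "\<And>x y. x \<in> {s..s+l} \<Longrightarrow> y \<in> {s..s+l} \<Longrightarrow> \<bar>x - y\<bar> \<le> l / 2 ^ n \<Longrightarrow> norm (g x - g y) \<le> \<epsilon>"
  shows "norm (LINT x:{s..s+l}|lborel. F x * g x) \<le>
    sqsum F n s l 0 / 2 + (LINT x:{s..s+l}|lborel. (norm (g x))\<^sup>2) / 2 + \<epsilon> * (LINT x:{s..s+l}|lborel. norm (F x))"
  using assms
proof (induction n arbitrary: s l)
  case 0
  note F = 0(1) and l = 0(2)
  let ?I = "{s..s+l}"
  let ?m = "avg g s l"
  have gi: "set_integrable lborel ?I g"
    by (rule continuous_set_integrable[OF g])
  have gm: "continuous_on UNIV (\<lambda>x. g x - ?m)"
    by (intro continuous_intros g)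
  have \<epsilon>': "norm (g x - ?m) \<le> \<epsilon>" if x: "x \<in> ?I" for x
  proof -
    have "l * norm (?m - g x) \<le> (LINT y:?I|lborel. norm (g y - g x))"
      by (rule norm_avg_diff_le[OF gi l])
    also have "\<dots> \<le> (LINT y:?I|lborel. \<epsilon>)"
    proof (rule set_integral_mono)
      show "set_integrable lborel ?I (\<lambda>y. norm (g y - g x))"
        by (intro continuous_set_integrable continuous_intros g)
      show "set_integrable lborel ?I (\<lambda>y. \<epsilon>)"
        by (rule set_integrable_interval_const)
      show "norm (g y - g x) \<le> \<epsilon>" if "y \<in> ?I" for y
        using x that by (intro 0(4)) auto
    qed
    also have "\<dots> = l * \<epsilon>"
      using l by (simp add: set_lebesgue_integral_def)
    finally have "norm (?m - g x) \<le> \<epsilon>"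
      using l by (simp only: mult_le_cancel_left_pos)
    then show ?thesis by (simp add: norm_minus_commute)
  qed
  have Jensen: "l * (norm ?m)\<^sup>2 \<le> (LINT x:?I|lborel. (norm (g x))\<^sup>2)"
  proof -
    have r: "(LINT x:?I|lborel. Re (g x * cnj ?m)) = l * (norm ?m)\<^sup>2"
    proof -
      have i: "set_integrable lborel ?I (\<lambda>x. g x * cnj ?m)"
        by (intro continuous_set_integrable continuous_intros g)
      have "(LINT x:?I|lborel. Re (g x * cnj ?m)) = Re (LINT x:?I|lborel. g x * cnj ?m)"
        unfolding set_lebesgue_integral_def
        by (subst integral_Re[symmetric]) (use i in \<open>auto simp: set_integrable_def\<close>)
      also have "(LINT x:?I|lborel. g x * cnj ?m) = of_real l * ?m * cnj ?m"
        using set_integral_eq_avg[OF l, of s g] by simp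
      also have "Re \<dots> = l * (norm ?m)\<^sup>2"
        using Re_mult_cnj_self[of ?m] by (simp only: mult.assoc Re_complex_of_real_mult)
      finally show ?thesis .
    qed
    have i2: "set_integrable lborel ?I (\<lambda>x. (norm (g x))\<^sup>2)" "set_integrable lborel ?I (\<lambda>x. Re (g x * cnj ?m))"
      by (intro continuous_set_integrable continuous_intros g)+
    have "(LINT x:?I|lborel. 2 * Re (g x * cnj ?m)) \<le> (LINT x:?I|lborel. (norm (g x))\<^sup>2 + (norm ?m)\<^sup>2)"
    proof (rule set_integral_mono)
      show "set_integrable lborel ?I (\<lambda>x. 2 * Re (g x * cnj ?m))" "set_integrable lborel ?I (\<lambda>x. (norm (g x))\<^sup>2 + (norm ?m)\<^sup>2)"
        by (intro continuous_set_integrable continuous_intros g)+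
      show "2 * Re (g x * cnj ?m) \<le> (norm (g x))\<^sup>2 + (norm ?m)\<^sup>2" for x
        using norm_diff_sq[of "g x" ?m] zero_le_power2[of "norm (g x - ?m)"] by linarith
    qed
    also have "\<dots> = (LINT x:?I|lborel. (norm (g x))\<^sup>2) + l * (norm ?m)\<^sup>2"
      using set_integral_add(2)[OF i2(1) set_integrable_interval_const[of s l "(norm ?m)\<^sup>2"]] l
      by (simp add: set_lebesgue_integral_def)
    finally have "2 * (LINT x:?I|lborel. Re (g x * cnj ?m)) \<le> (LINT x:?I|lborel. (norm (g x))\<^sup>2) + l * (norm ?m)\<^sup>2"
      by (simp only: set_integral_mult_right)
    then show ?thesis
      unfolding r by simp
  qed
  have "(LINT x:?I|lborel. F x * g x) = (LINT x:?I|lborel. F x * ?m + F x * (g x - ?m))"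
    by (simp add: algebra_simps)
  also have "\<dots> = (LINT x:?I|lborel. F x * ?m) + (LINT x:?I|lborel. F x * (g x - ?m))"
    using F by (intro set_integral_add set_integrable_mult_continuous gm continuous_intros)
  also have "(LINT x:?I|lborel. F x * ?m) = of_real l * (avg F s l * ?m)"
    using set_integral_eq_avg[OF l, of s F] by simp
  finally have "norm (LINT x:?I|lborel. F x * g x) \<le>
      norm (of_real l * (avg F s l * ?m)) + norm (LINT x:?I|lborel. F x * (g x - ?m))"
    by (simp only: norm_triangle_ineq)
  moreover have "norm (of_real l * (avg F s l * ?m)) \<le> l * (norm (avg F s l))\<^sup>2 / 2 + l * (norm ?m)\<^sup>2 / 2"
  proof -
    have "norm (avg F s l) * norm ?m \<le> (norm (avg F s l))\<^sup>2 / 2 + (norm ?m)\<^sup>2 / 2"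
      using sum_squares_bound[of "norm (avg F s l)" "norm ?m"] by simp
    from mult_left_mono[OF this, of l] l show ?thesis
      by (simp add: norm_mult algebra_simps)
  qed
  moreover have "norm (LINT x:?I|lborel. F x * (g x - ?m)) \<le> \<epsilon> * (LINT x:?I|lborel. norm (F x))"
  proof -
    have i: "set_integrable lborel ?I (\<lambda>x. F x * (g x - ?m))"
      by (rule set_integrable_mult_continuous[OF F gm])
    have "norm (LINT x:?I|lborel. F x * (g x - ?m)) \<le> (LINT x:?I|lborel. norm (F x * (g x - ?m)))"
      by (rule set_integral_norm_le[OF i])
    also have "\<dots> \<le> (LINT x:?I|lborel. \<epsilon> * norm (F x))"
    proof (rule set_integral_mono)
      show "set_integrable lborel ?I (\<lambda>x. norm (F x * (g x - ?m)))"
        by (rule set_integrable_norm[OF i])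
      show "set_integrable lborel ?I (\<lambda>x. \<epsilon> * norm (F x))"
        by (intro set_integrable_mult_right set_integrable_norm F)
      show "norm (F x * (g x - ?m)) \<le> \<epsilon> * norm (F x)" if "x \<in> ?I" for x
        using mult_right_mono[OF \<epsilon>'[OF that], of "norm (F x)"] by (simp add: norm_mult mult.commute)
    qed
    finally show ?thesis by simp
  qed
  ultimately show ?case
    using Jensen by simp
next
  case (Suc n)
  note h = set_integral_halves(2,3)[OF Suc.prems(1,2)]
  have sub: "{s..s+l/2} \<subseteq> {s..s+l}" "{s+l/2..s+l/2+l/2} \<subseteq> {s..s+l}"
    using Suc.prems(2) by auto
  note fg = set_integral_halves(1)[OF set_integrable_mult_continuous[OF Suc.prems(1) g] Suc.prems(2)]
  have gg: "set_integrable lborel {s..s+l} (\<lambda>x. (norm (g x))\<^sup>2)"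
    by (intro continuous_set_integrable continuous_intros g)
  note gg = set_integral_halves(1)[OF gg Suc.prems(2)]
  note ff = set_integral_halves(1)[OF set_integrable_norm[OF Suc.prems(1)] Suc.prems(2)]
  \<comment> \<open>Halving the interval while lowering the depth by one keeps the mesh l / 2^n, so
    the hypothesis on \<open>g\<close> passes to both halves.\<close>
  have 1: "norm (LINT x:{s..s+l/2}|lborel. F x * g x) \<le>
    sqsum F n s (l/2) 0 / 2 + (LINT x:{s..s+l/2}|lborel. (norm (g x))\<^sup>2) / 2 + \<epsilon> * (LINT x:{s..s+l/2}|lborel. norm (F x))"
    using Suc.prems(2) sub(1) by (intro Suc.IH h g Suc.prems(4)) auto
  have 2: "norm (LINT x:{s+l/2..s+l/2+l/2}|lborel. F x * g x) \<le>
    sqsum F n (s+l/2) (l/2) 0 / 2 + (LINT x:{s+l/2..s+l/2+l/2}|lborel. (norm (g x))\<^sup>2) / 2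
      + \<epsilon> * (LINT x:{s+l/2..s+l/2+l/2}|lborel. norm (F x))"
    using Suc.prems(2) sub(2) by (intro Suc.IH h g Suc.prems(4)) auto
  show ?case
    unfolding fg gg ff
    using 1 2 norm_triangle_ineq[of "LINT x:{s..s+l/2}|lborel. F x * g x" "LINT x:{s+l/2..s+l/2+l/2}|lborel. F x * g x"]
    by (simp add: algebra_simps add_divide_distrib)
qed

section \<open>Arcs on the circle and intervals of the parameter\<close>

lemma cis_eq_in_period:
  assumes "cis x = cis y" "0 < x" "x < 2*pi" "0 \<le> y" "y \<le> 2*pi"
  shows "x = y"
proof -
  have "cis (x - y) = 1"
    using assms(1) by (simp add: cis_divide[symmetric])
  then have "cos (x - y) = 1"
    by (metis cis.sel(1) one_complex.sel(1))
  then obtain k :: int where k: "x - y = of_int k * 2 * pi"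
    using cos_one_2pi_int by blast
  have "\<bar>x - y\<bar> < 2 * pi"
    using assms by linarith
  then have "\<bar>of_int k\<bar> * (2 * pi) < 1 * (2 * pi)"
    unfolding k by (simp add: abs_mult mult.assoc)
  then have "\<bar>of_int k\<bar> < (1::real)"
    using pi_gt_zero by (simp only: mult_less_cancel_right_pos)
  then have "k = 0" by linarith
  with k show ?thesis by simp
qed

text \<open>\<open>circle_arc\<close> takes a centre and a half width, hence the arguments
  \<open>s + l/2\<close> and \<open>l/2\<close> for the parameter interval from \<open>s\<close> to
  \<open>s + l\<close>.\<close>

lemma set_integral_arc:
  fixes f :: "complex \<Rightarrow> 'a::{banach, second_countable_topology}"
  assumes [measurable]: "f \<in> borel_measurable circle_measure" and sl: "0 \<le> s" "0 < l" "s + l \<le> 2*pi"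
  shows "(LINT z:circle_arc (s + l/2) (l/2)|circle_measure. f z) = (1/(2*pi)) *\<^sub>R (LINT x:{s..s+l}|lborel. f (cis x))"
    and "circle_arc (s + l/2) (l/2) \<in> sets circle_measure"
proof -
  let ?A = "circle_arc (s + l/2) (l/2)"
  have "s + l/2 - l/2 = s" "s + l/2 + l/2 = s + l" by auto
  then have A: "?A = cis ` {s..s+l}"
    unfolding circle_arc_def by (simp only:)
  have "compact ?A"
    unfolding A by (intro compact_continuous_image continuous_intros) auto
  then have "?A \<in> sets borel" by (simp add: compact_imp_closed borel_closed)
  moreover have "?A \<subseteq> sphere 0 1" by (auto simp: A)
  ultimately show [measurable]: "?A \<in> sets circle_measure"
    by (auto simp: sets_circle sets_restrict_space image_iff intro!: bexI[of _ ?A])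
  have [measurable]: "(\<lambda>x. f (cis x)) \<in> borel_measurable lborel"
    by (rule measurable_comp_cis) fact
  have mA: "(\<lambda>z. indicator ?A z *\<^sub>R f z) \<in> borel_measurable circle_measure"
    by measurable
  have [measurable]: "(\<lambda>x. indicator ?A (cis x) *\<^sub>R f (cis x)) \<in> borel_measurable lborel"
    using measurable_comp_cis[OF mA] .
  have "(LINT z:?A|circle_measure. f z) = (1/(2*pi)) *\<^sub>R (LINT x:{0..2*pi}|lborel. indicator ?A (cis x) *\<^sub>R f (cis x))"
    unfolding set_lebesgue_integral_def[of circle_measure] by (rule integral_circle_eq[OF mA])
  also have "(LINT x:{0..2*pi}|lborel. indicator ?A (cis x) *\<^sub>R f (cis x)) = (LINT x:{s..s+l}|lborel. f (cis x))"
    unfolding set_lebesgue_integral_def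
  proof (rule integral_cong_AE)
    \<comment> \<open>\<open>cis\<close> identifies 0 and 2 pi, so an arc that starts at 0 also
      contains the image of 2 pi. Away from these two parameters \<open>cis x\<close> lies in the
      arc exactly when \<open>x\<close> lies in the interval.\<close>
    have "AE x in lborel. x \<noteq> 0" "AE x in lborel. x \<noteq> 2*pi"
      by (rule AE_lborel_singleton)+
    then show "AE x in lborel. indicat_real {0..2*pi} x *\<^sub>R indicat_real ?A (cis x) *\<^sub>R f (cis x) =
        indicat_real {s..s+l} x *\<^sub>R f (cis x)"
    proof eventually_elim
      case (elim x)
      show ?case
      proof (cases "x \<in> {0..2*pi}")
        case True
        have "cis x \<in> ?A \<longleftrightarrow> x \<in> {s..s+l}"
          unfolding A using cis_eq_in_period[of x] True elim sl by fastforce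
        with True show ?thesis by (simp add: indicator_def)
      qed (use sl in \<open>auto simp: indicator_def\<close>)
    qed
  qed measurable
  finally show "(LINT z:?A|circle_measure. f z) = (1/(2*pi)) *\<^sub>R (LINT x:{s..s+l}|lborel. f (cis x))" .
qed

lemma arc_mean_eq:
  fixes f :: "complex \<Rightarrow> 'a::{banach, second_countable_topology}"
  assumes f: "f \<in> borel_measurable circle_measure" and sl: "0 \<le> s" "0 < l" "s + l \<le> 2*pi"
  shows "arc_mean f (circle_arc (s + l/2) (l/2)) = (LINT x:{s..s+l}|lborel. f (cis x)) /\<^sub>R l"
proof -
  let ?A = "circle_arc (s + l/2) (l/2)"
  have "(LINT z:?A|circle_measure. (1::real)) = l / (2*pi)"
    using sl by (subst set_integral_arc(1)) (auto simp: set_lebesgue_integral_def)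
  moreover have "(LINT z:?A|circle_measure. (1::real)) = measure circle_measure ?A"
    using set_integral_arc(2)[OF f sl] sets.sets_into_space[OF set_integral_arc(2)[OF f sl]]
    by (simp add: set_lebesgue_integral_def Int_absorb2)
  ultimately have "measure circle_measure ?A = l / (2*pi)" by simp
  moreover have "inverse (l / (2*pi)) * (1 / (2*pi)) = inverse l"
    using sl(2) by (simp add: field_simps)
  ultimately show ?thesis
    unfolding arc_mean_def set_integral_arc(1)[OF f sl] by (simp only: scaleR_scaleR)
qed

text \<open>Pair \<open>f\<close> with its own partial Fourier sum. Both the pairing and the squared
  norm of that sum equal 2 pi S, so \<open>pairing_le_sqsum\<close> has 2 pi S on the left and only
  half of it on the right, and S can be absorbed.\<close>

theorem VMO_fourier_coeff_square_summable:
  assumes f: "f \<in> VMO K"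
  obtains B where "\<And>A. finite A \<Longrightarrow> (\<Sum>k\<in>A. (norm (fourier_coeff f k))\<^sup>2) \<le> B"
proof -
  have fi: "integrable circle_measure f" using f by (simp add: VMO_def)
  then have fm: "f \<in> borel_measurable circle_measure" by simp
  define F where "F x = f (cis x)" for x
  \<comment> \<open>Writing \<open>0+2*pi\<close> keeps the form \<open>s + l\<close> in which the
    interval lemmas are stated.\<close>
  have F: "set_integrable lborel {0..0+2*pi} F"
    using fi integrable_circle_iff[OF fm] by (simp add: F_def[abs_def])
  obtain \<delta> where \<delta>: "\<delta> > 0" "\<And>t h. 0 < h \<Longrightarrow> h < \<delta> \<Longrightarrow> mean_oscillation f (circle_arc t h) < 1"
    using f unfolding VMO_def by (auto dest: spec[of _ 1])
  have osc: "(LINT x:{s..s+l}|lborel. norm (F x - avg F s l)) \<le> 1 * l"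
    if "0 < l" "l < \<delta>" "0 \<le> s" "s + l \<le> 0 + 2*pi" for s l
  proof -
    have sl: "0 \<le> s" "0 < l" "s + l \<le> 2*pi" using that by auto
    let ?A = "circle_arc (s + l/2) (l/2)"
    have m: "arc_mean f ?A = avg F s l"
      by (simp add: arc_mean_eq[OF fm sl] avg_def F_def)
    have "(\<lambda>z. norm (f z - avg F s l)) \<in> borel_measurable circle_measure"
      using fm by measurable
    note arc_mean_eq[OF this sl]
    then have "mean_oscillation f ?A = (LINT x:{s..s+l}|lborel. norm (F x - avg F s l)) / l"
      unfolding mean_oscillation_def m F_def by (simp only: real_scaleR_def divide_inverse_commute)
    moreover have "mean_oscillation f ?A < 1"
      using that by (intro \<delta>) auto
    ultimately have "(LINT x:{s..s+l}|lborel. norm (F x - avg F s l)) / l < 1"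
      by (simp only:)
    then have "(LINT x:{s..s+l}|lborel. norm (F x - avg F s l)) < l"
      by (rule divide_less_eq_1_pos[OF that(1), THEN iffD1])
    then show ?thesis by simp
  qed
  obtain k where k: "2*pi / \<delta> < 2 ^ k"
    using real_arch_pow[of 2 "2*pi / \<delta>"] by auto
  have "\<exists>B. \<forall>n. sqsum F n 0 (2*pi) 0 \<le> B"
  proof (rule sqsum_bounded[where C = 1 and \<delta> = \<delta> and k = k])
    show "2*pi < \<delta> * 2 ^ k"
      using k \<delta>(1) by (simp add: field_simps)
  qed (use F osc in simp_all)
  then obtain B where B: "\<And>n. sqsum F n 0 (2*pi) 0 \<le> B" by blast
  show thesis
  proof (rule that[of "B / (2*pi)"])
    fix A :: "int set" assume A: "finite A"
    define S where "S = (\<Sum>k\<in>A. (norm (fourier_coeff f k))\<^sup>2)"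
    define p where "p z = (\<Sum>k\<in>A. fourier_coeff f k * z powi k)" for z
    define g where "g x = cnj (p (cis x))" for x
    have pc: "continuous_on (sphere 0 1) p"
      unfolding p_def by (intro continuous_intros)
    have g: "continuous_on UNIV g"
      unfolding g_def by (intro continuous_on_cnj continuous_on_compose2[OF pc] continuous_intros) auto
    have "(\<integral>z. f z * cnj (p z) \<partial>circle_measure) = of_real S"
      unfolding p_def S_def using integral_mult_trig_poly[OF fi, of "fourier_coeff f" A]
      by (simp only: complex_norm_square of_real_sum)
    moreover have "(\<lambda>z. f z * cnj (p z)) \<in> borel_measurable circle_measure"
      using fm continuous_measurable_circle[OF pc] by measurable
    ultimately have fg: "(LINT x:{0..0+2*pi}|lborel. F x * g x) = of_real (2*pi*S)"
      using integral_circle_eq[of "\<lambda>z. f z * cnj (p z)"]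
      by (simp add: F_def g_def scaleR_conv_of_real field_simps)
    have "(\<integral>z. (norm (p z))\<^sup>2 \<partial>circle_measure) = S"
      unfolding p_def S_def by (rule integral_norm_sq_trig_poly[OF A])
    moreover have "(\<lambda>z. (norm (p z))\<^sup>2) \<in> borel_measurable circle_measure"
      using continuous_measurable_circle[OF pc] by measurable
    ultimately have gg: "(LINT x:{0..0+2*pi}|lborel. (norm (g x))\<^sup>2) = 2*pi*S"
      using integral_circle_eq[of "\<lambda>z. (norm (p z))\<^sup>2"]
      by (simp add: g_def field_simps)
    let ?N = "LINT x:{0..0+2*pi}|lborel. norm (F x)"
    have S0: "0 \<le> S" unfolding S_def by (simp add: sum_nonneg)
    have N0: "0 \<le> ?N"
      unfolding set_lebesgue_integral_def by (rule Bochner_Integration.integral_nonneg) simp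
    \<comment> \<open>Uniform continuity of the trigonometric polynomial determines the depth
      \<open>n\<close> for a given \<epsilon>. The bound \<open>B\<close> holds at every depth, so
      \<epsilon> can afterwards tend to 0.\<close>
    have bd: "2*pi*S \<le> B/2 + pi*S + \<epsilon> * ?N" if \<epsilon>: "\<epsilon> > 0" for \<epsilon>
    proof -
      have "uniformly_continuous_on {0..0+2*pi} g"
        by (rule compact_uniformly_continuous[OF continuous_on_subset[OF g]]) auto
      then obtain \<eta> where \<eta>: "\<eta> > 0" "\<And>x y. x \<in> {0..0+2*pi} \<Longrightarrow> y \<in> {0..0+2*pi} \<Longrightarrow> dist y x < \<eta> \<Longrightarrow> dist (g y) (g x) < \<epsilon>"
        using \<epsilon> unfolding uniformly_continuous_on_def by metis
      obtain n where n: "2*pi / \<eta> < 2 ^ n"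
        using real_arch_pow[of 2 "2*pi / \<eta>"] by auto
      have "2*pi / 2 ^ n < \<eta>"
        using n \<eta>(1) by (simp add: field_simps)
      then have "norm (g x - g y) \<le> \<epsilon>" if "x \<in> {0..0+2*pi}" "y \<in> {0..0+2*pi}" "\<bar>x - y\<bar> \<le> 2*pi / 2 ^ n" for x y
        using \<eta>(2)[OF that(2,1)] that(3) by (simp add: dist_norm)
      then have "norm (LINT x:{0..0+2*pi}|lborel. F x * g x) \<le>
        sqsum F n 0 (2*pi) 0 / 2 + (LINT x:{0..0+2*pi}|lborel. (norm (g x))\<^sup>2) / 2 + \<epsilon> * ?N"
        by (intro pairing_le_sqsum F g) auto
      then show ?thesis
        unfolding fg gg norm_of_real using B[of n] S0 by simp
    qed
    have "pi * S \<le> B/2 + e" if "e > 0" for e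
    proof -
      have aux: "e / (t + 1) * t \<le> e" if "t \<ge> 0" for t
        using that \<open>e > 0\<close> by (simp add: field_simps)
      have "e / (?N + 1) > 0" using that N0 by (intro divide_pos_pos) linarith+
      from bd[OF this] have "pi * S \<le> B/2 + e / (?N + 1) * ?N"
        by (simp only: mult_2 distrib_right)
      also have "\<dots> \<le> B/2 + e" using aux[OF N0] by simp
      finally show ?thesis .
    qed
    then have "pi * S \<le> B / 2"
      by (rule field_le_epsilon)
    then show "(\<Sum>k\<in>A. (norm (fourier_coeff f k))\<^sup>2) \<le> B / (2*pi)"
      unfolding S_def[symmetric] by (simp add: field_simps)
  qed
qed

subsection \<open>The vector valued Hardy space\<close>

lemma H2_powi: "0 \<le> n \<Longrightarrow> (\<lambda>z. z powi n) \<in> H2_circle"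
  by (intro H2I L2_continuous continuous_intros) (simp add: fourier_coeff_powi)

lemma H2_zero: "(\<lambda>z. 0) \<in> H2_circle"
  by (intro H2I L2_continuous continuous_intros) (simp add: fourier_coeff_def)

lemma H2_AE_zero:
  assumes "f \<in> H2_circle" "\<And>n. n \<ge> 0 \<Longrightarrow> fourier_coeff f n = 0"
  shows "AE z in circle_measure. f z = 0"
proof (rule fourier_coeff_zero_imp_AE_zero)
  show "integrable circle_measure f" using assms(1) by (auto intro: L2_integrable H2_L2)
  show "fourier_coeff f n = 0" for n
    using assms H2_coeff[of f n] by (cases "n \<ge> 0") auto
qed

lemma H2_diff: "f \<in> H2_circle \<Longrightarrow> g \<in> H2_circle \<Longrightarrow> (\<lambda>z. f z - g z) \<in> H2_circle"
  using H2_add[of f "\<lambda>z. - 1 * g z"] H2_cmult[of g "- 1"] by simp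

text \<open>The conjugate of \<open>q\<close> has frequencies at least 1. Dividing by z keeps it in
  H^2 and records that even the constant coefficient of \<open>q\<close> vanishes.\<close>

lemma H2_cnj_shift:
  assumes q: "q \<in> L2_circle" "\<And>n. n \<ge> 0 \<Longrightarrow> fourier_coeff q n = 0"
  shows "(\<lambda>z. z powi (-1) * cnj (q z)) \<in> H2_circle"
proof (rule H2I)
  show "(\<lambda>z. z powi (-1) * cnj (q z)) \<in> L2_circle"
    by (intro L2_powi_mult L2_cnj q)
  show "fourier_coeff (\<lambda>z. z powi (-1) * cnj (q z)) n = 0" if "n < 0" for n
    unfolding fourier_coeff_powi_mult fourier_coeff_cnj using that q(2)[of "- (n - (-1))"] by simp
qed

text \<open>Up to conjugation the integral is the coefficient of index -1 of a product of two H^2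
  functions, by the shift in \<open>H2_cnj_shift\<close>.\<close>

lemma integral_mult_cnj_H2_zero:
  assumes q: "q \<in> L2_circle" "\<And>n. n \<ge> 0 \<Longrightarrow> fourier_coeff q n = 0" and h: "h \<in> H2_circle"
  shows "(\<integral>z. q z * cnj (h z) \<partial>circle_measure) = 0"
proof -
  have "fourier_coeff (\<lambda>z. (z powi (-1) * cnj (q z)) * h z) (-1) = 0"
    by (rule H2_mult_coeff_neg[OF H2_cnj_shift[OF q] h]) auto
  then have "fourier_coeff (\<lambda>z. cnj (q z * cnj (h z))) 0 = 0"
    using fourier_coeff_powi_mult[of "-1" "\<lambda>z. cnj (q z) * h z" "-1"] by (simp add: mult.assoc)
  then have "fourier_coeff (\<lambda>z. q z * cnj (h z)) 0 = 0"
    unfolding fourier_coeff_cnj by simp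
  then show ?thesis
    by (simp add: fourier_coeff_def)
qed

lemma measurable_vec_iff:
  fixes f :: "'b \<Rightarrow> complex^'n"
  shows "f \<in> borel_measurable M \<longleftrightarrow> (\<forall>i. (\<lambda>x. f x $ i) \<in> borel_measurable M)"
proof safe
  fix i assume "f \<in> borel_measurable M"
  then show "(\<lambda>x. f x $ i) \<in> borel_measurable M"
    by (rule borel_measurable_continuous_on[rotated]) (intro continuous_intros)
next
  assume *: "\<forall>i. (\<lambda>x. f x $ i) \<in> borel_measurable M"
  show "f \<in> borel_measurable M"
    unfolding borel_measurable_euclidean_space[of f]
  proof
    fix b :: "complex^'n" assume "b \<in> Basis"
    then obtain i u where b: "b = axis i u" by (auto simp: Basis_vec_def)
    have "(\<lambda>x. f x $ i \<bullet> u) \<in> borel_measurable M"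
      using * by (intro borel_measurable_inner) auto
    then show "(\<lambda>x. f x \<bullet> b) \<in> borel_measurable M"
      by (simp add: b inner_axis)
  qed
qed

lemma norm_vec_sq: "(norm (v :: complex^'n))\<^sup>2 = (\<Sum>i\<in>UNIV. (norm (v $ i))\<^sup>2)"
  by (simp add: norm_vec_def L2_set_def sum_nonneg)

lemma L2_vec_iff:
  fixes f :: "complex \<Rightarrow> complex^'n"
  shows "f \<in> L2_circle \<longleftrightarrow> (\<forall>i. (\<lambda>z. f z $ i) \<in> L2_circle)"
proof safe
  fix i assume f: "f \<in> L2_circle"
  show "(\<lambda>z. f z $ i) \<in> L2_circle"
  proof (rule L2_dominated[OF _ L2_sq_integrable[OF f]])
    show "(\<lambda>z. f z $ i) \<in> borel_measurable circle_measure"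
      using L2_measurable[OF f] by (simp add: measurable_vec_iff)
    show "AE z in circle_measure. (norm (f z $ i))\<^sup>2 \<le> (norm (f z))\<^sup>2"
      by (intro AE_I2 power_mono Finite_Cartesian_Product.norm_nth_le) auto
  qed
next
  assume f: "\<forall>i. (\<lambda>z. f z $ i) \<in> L2_circle"
  then have "f \<in> borel_measurable circle_measure"
    by (simp add: measurable_vec_iff L2_measurable)
  moreover have "integrable circle_measure (\<lambda>z. (norm (f z))\<^sup>2)"
    unfolding norm_vec_sq using f by (intro Bochner_Integration.integrable_sum L2_sq_integrable) auto
  ultimately show "f \<in> L2_circle" by (simp add: L2_circle_def)
qed

lemma hardy_iff: "f \<in> hardy \<longleftrightarrow> (\<forall>i. (\<lambda>z. f z $ i) \<in> H2_circle)"
proof safe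
  fix i assume "f \<in> hardy"
  then show "(\<lambda>z. f z $ i) \<in> H2_circle"
    unfolding hardy_def using boundary_values_imp_H2 by blast
next
  assume f: "\<forall>i. (\<lambda>z. f z $ i) \<in> H2_circle"
  then have "f \<in> L2_circle"
    by (simp add: L2_vec_iff H2_L2)
  moreover have "\<forall>i. boundary_values (\<lambda>w. (\<chi> j. holo_ext (\<lambda>z. f z $ j) w) $ i) (\<lambda>z. f z $ i)"
    using f H2_boundary_values by (simp add: eta_contract_eq)
  ultimately show "f \<in> hardy"
    unfolding hardy_def by (auto intro!: exI[of _ "\<lambda>w. \<chi> j. holo_ext (\<lambda>z. f z $ j) w"])
qed

lemma hardy_L2: "f \<in> hardy \<Longrightarrow> f \<in> L2_circle"
  by (simp add: hardy_def)

text \<open>\<open>proj_plus\<close> is specified by \<open>SOME\<close>, so existence comes first,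
  by cutting off the negative coefficients of each component. Orthogonality is then converted to
  coefficients, the form in which all later steps use it.\<close>

lemma proj_plus_properties:
  fixes f :: "complex \<Rightarrow> complex^2"
  assumes f: "f \<in> L2_circle"
  shows "proj_plus f \<in> hardy" and "n \<ge> 0 \<Longrightarrow> fourier_coeff (\<lambda>z. f z $ i - proj_plus f z $ i) n = 0"
proof -
  have fi: "(\<lambda>z. f z $ i) \<in> L2_circle" for i
    using f by (simp add: L2_vec_iff)
  have "\<exists>g. g \<in> H2_circle \<and> (\<forall>n\<ge>0. fourier_coeff (\<lambda>z. f z $ i - g z) n = 0)" for i
  proof -
    let ?c = "fourier_coeff (\<lambda>z. f z $ i)"
    define c' where "c' k = (if k \<ge> 0 then ?c k else 0)" for k
    have "(\<Sum>k\<in>A. (norm (c' k))\<^sup>2) \<le> (\<integral>z. (norm (f z $ i))\<^sup>2 \<partial>circle_measure)"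
      if "finite A" for A
      by (intro order_trans[OF sum_mono Bessel_inequality[OF fi that]]) (auto simp: c'_def)
    from Riesz_Fischer[OF this] obtain g where g: "g \<in> L2_circle" "\<And>k. fourier_coeff g k = c' k"
      by blast
    then show ?thesis
      using fi by (intro exI[of _ g]) (simp add: H2_circle_def fourier_coeff_diff L2_integrable c'_def)
  qed
  then obtain g where g: "\<And>i. g i \<in> H2_circle"
    "\<And>i n. n \<ge> 0 \<Longrightarrow> fourier_coeff (\<lambda>z. f z $ i - g i z) n = 0"
    by metis
  let ?g = "\<lambda>z. \<chi> i. g i z"
  have "?g \<in> hardy"
    using g(1) by (simp add: hardy_iff eta_contract_eq)
  moreover have "inner_L2 (\<lambda>z. f z - ?g z) h = 0" if h: "h \<in> hardy" for h
  proof -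
    have hi: "(\<lambda>z. h z $ i) \<in> H2_circle" for i using h by (simp add: hardy_iff)
    have d: "(\<lambda>z. f z $ i - g i z) \<in> L2_circle" for i
      by (intro L2_diff fi H2_L2 g)
    have "inner_L2 (\<lambda>z. f z - ?g z) h = (\<Sum>i\<in>UNIV. \<integral>z. (f z $ i - g i z) * cnj (h z $ i) \<partial>circle_measure)"
      unfolding inner_L2_def
      using L2_mult_integrable[OF d L2_cnj[OF H2_L2[OF hi]]]
      by (subst Bochner_Integration.integral_sum[symmetric]) simp_all
    also have "\<dots> = 0"
      by (intro sum.neutral ballI integral_mult_cnj_H2_zero d g hi)
    finally show ?thesis .
  qed
  ultimately have "\<exists>g. g \<in> hardy \<and> (\<forall>h\<in>hardy. inner_L2 (\<lambda>z. f z - g z) h = 0)"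
    by blast
  from someI_ex[OF this] have p: "proj_plus f \<in> hardy"
    "\<And>h. h \<in> hardy \<Longrightarrow> inner_L2 (\<lambda>z. f z - proj_plus f z) h = 0"
    unfolding proj_plus_def by auto
  show "proj_plus f \<in> hardy" by fact
  assume n: "n \<ge> 0"
  \<comment> \<open>Testing against the monomial in component \<open>i\<close> makes the inner
    product equal to the n-th Fourier coefficient of that component.\<close>
  define e where "e z = (\<chi> j. if j = i then z powi n else 0)" for z :: complex
  have "(\<lambda>z. e z $ j) \<in> H2_circle" for j
    using H2_powi[OF n] H2_zero by (cases "j = i") (simp_all add: e_def)
  then have "e \<in> hardy" by (simp add: hardy_iff)
  then have "0 = inner_L2 (\<lambda>z. f z - proj_plus f z) e"
    using p(2) by simp
  also have "\<dots> = (\<integral>z. (f z $ i - proj_plus f z $ i) * cnj (z powi n) \<partial>circle_measure)"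
    unfolding inner_L2_def e_def
    by (rule arg_cong[where f = "integral\<^sup>L circle_measure"])
       (simp add: fun_eq_iff if_distrib[of cnj] if_distrib[of "\<lambda>x. _ * x"] sum.delta cong: if_cong)
  also have "\<dots> = fourier_coeff (\<lambda>z. f z $ i - proj_plus f z $ i) n"
    unfolding fourier_coeff_def
    by (rule Bochner_Integration.integral_cong) (auto simp: cnj_powi_unit mult.commute)
  finally show "fourier_coeff (\<lambda>z. f z $ i - proj_plus f z $ i) n = 0" by simp
qed

lemma AE_vec_eqI:
  fixes f g :: "'b \<Rightarrow> 'c^'n"
  assumes "\<And>i. AE z in M. f z $ i = g z $ i"
  shows "AE z in M. f z = g z"
proof -
  have "AE z in M. \<forall>i\<in>UNIV. f z $ i = g z $ i"
    using assms by (intro AE_finite_allI) auto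
  then show ?thesis
    by eventually_elim (simp add: vec_eq_iff)
qed

text \<open>Two candidates differ by an H^2 function whose nonnegative coefficients also vanish,
  hence by zero almost everywhere.\<close>

lemma proj_plus_eqI:
  fixes f p :: "complex \<Rightarrow> complex^2"
  assumes f: "f \<in> L2_circle" and p: "p \<in> hardy"
    and "\<And>i n. n \<ge> 0 \<Longrightarrow> fourier_coeff (\<lambda>z. f z $ i - p z $ i) n = 0"
  shows "AE z in circle_measure. proj_plus f z = p z"
proof (rule AE_vec_eqI)
  fix i
  have fi: "(\<lambda>z. f z $ i) \<in> L2_circle" using f by (simp add: L2_vec_iff)
  have P: "(\<lambda>z. proj_plus f z $ i) \<in> H2_circle" and pi: "(\<lambda>z. p z $ i) \<in> H2_circle"
    using proj_plus_properties(1)[OF f] p by (auto simp: hardy_iff)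
  have "AE z in circle_measure. proj_plus f z $ i - p z $ i = 0"
  proof (rule H2_AE_zero[OF H2_diff[OF P pi]])
    fix n :: int assume "n \<ge> 0"
    then have "fourier_coeff (\<lambda>z. f z $ i - p z $ i) n = 0" "fourier_coeff (\<lambda>z. f z $ i - proj_plus f z $ i) n = 0"
      using assms(3) proj_plus_properties(2)[OF f] by auto
    then show "fourier_coeff (\<lambda>z. proj_plus f z $ i - p z $ i) n = 0"
      using fi P pi by (simp add: fourier_coeff_diff L2_integrable H2_L2)
  qed
  then show "AE z in circle_measure. proj_plus f z $ i = p z $ i"
    by eventually_elim simp
qed

lemma proj_plus_hardy:
  assumes "f \<in> hardy"
  shows "AE z in circle_measure. proj_plus f z = f z"
  by (rule proj_plus_eqI[OF hardy_L2[OF assms] assms]) (simp add: fourier_coeff_def)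

lemma proj_plus_cong_coeff:
  fixes f g :: "complex \<Rightarrow> complex^2"
  assumes f: "f \<in> L2_circle" and g: "g \<in> L2_circle"
    and fg: "\<And>i n. n \<ge> 0 \<Longrightarrow> fourier_coeff (\<lambda>z. f z $ i - g z $ i) n = 0"
  shows "AE z in circle_measure. proj_plus f z = proj_plus g z"
proof (rule proj_plus_eqI[OF f proj_plus_properties(1)[OF g]])
  fix i and n :: int assume n: "n \<ge> 0"
  have "(\<lambda>z. f z $ i) \<in> L2_circle" "(\<lambda>z. g z $ i) \<in> L2_circle" "(\<lambda>z. proj_plus g z $ i) \<in> L2_circle"
    using f g hardy_L2[OF proj_plus_properties(1)[OF g]] by (simp_all add: L2_vec_iff)
  then show "fourier_coeff (\<lambda>z. f z $ i - proj_plus g z $ i) n = 0"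
    using fg[OF n, of i] proj_plus_properties(2)[OF g n, of i] by (simp add: fourier_coeff_diff L2_integrable)
qed

text \<open>The function \<open>z\<^sup>-\<^sup>1 cnj w\<close> is a product of the form considered in \<open>H2_exp_mult\<close>.\<close>

lemma antianalytic_product_coeff:
  assumes a: "a \<in> H2_circle" "AE z in circle_measure. norm (a z) \<le> K"
    and y: "(\<lambda>z. cnj (y z)) \<in> H2_circle"
    and q: "q \<in> L2_circle" "\<And>n. n \<ge> 0 \<Longrightarrow> fourier_coeff q n = 0"
    and w: "w \<in> L2_circle" "AE z in circle_measure. w z = \<gamma> * (cnj (a z) * (exp (y z) * q z))"
    and n: "n \<ge> 0"
  shows "fourier_coeff w n = 0"
proof -
  let ?r = "\<lambda>z. z powi (-1) * cnj (q z)"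
  let ?\<phi> = "\<lambda>z. cnj \<gamma> * (a z * ?r z)"
  have r: "?r \<in> H2_circle" by (rule H2_cnj_shift[OF q])
  have "(\<lambda>z. a z * ?r z) \<in> L2_circle"
    by (rule L2_bounded_mult[OF H2_L2[OF r] L2_measurable[OF H2_L2[OF a(1)]] a(2)])
  then have \<phi>: "?\<phi> \<in> H2_circle"
    by (intro H2_cmult H2_mult a r)
  have w': "(\<lambda>z. z powi (-1) * cnj (w z)) \<in> L2_circle"
    by (intro L2_powi_mult L2_cnj w)
  \<comment> \<open>Conjugating and dividing by z turns the antianalytic factors into analytic ones.
    Folding them into \<open>Y\<close> and \<open>\<Phi>\<close> gives the product the shape of
    \<open>H2_exp_mult\<close>.\<close>
  define Y \<Phi> where "Y z = cnj (y z)" and "\<Phi> z = ?\<phi> z" for z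
  have Y: "Y \<in> H2_circle" and \<Phi>: "\<Phi> \<in> H2_circle"
    using y \<phi> by (simp_all only: Y_def[abs_def] \<Phi>_def[abs_def])
  have eq: "AE z in circle_measure. z powi (-1) * cnj (w z) = exp (Y z) * \<Phi> z"
    unfolding Y_def \<Phi>_def
    using w(2) by eventually_elim (simp only: complex_cnj_mult complex_cnj_cnj exp_cnj mult_ac)
  note [measurable] = L2_measurable[OF H2_L2[OF Y]] L2_measurable[OF H2_L2[OF \<Phi>]]
  have "(\<lambda>z. exp (Y z) * \<Phi> z) \<in> L2_circle"
    by (rule L2_cong_AE[OF w' _ eq]) measurable
  then have "(\<lambda>z. exp (Y z) * \<Phi> z) \<in> H2_circle"
    by (rule H2_exp_mult[OF Y \<Phi>])
  then have "(\<lambda>z. z powi (-1) * cnj (w z)) \<in> H2_circle"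
    by (rule H2_cong_AE[OF _ L2_measurable[OF w'] AE_symmetric[OF eq]])
  \<comment> \<open>Conjugation sends index n to -n and the factor 1/z lowers it by one more, so n =
    0 lands on the negative index -1.\<close>
  then have "fourier_coeff (\<lambda>z. z powi (-1) * cnj (w z)) (- n - 1) = 0"
    using n by (intro H2_coeff) auto
  then show ?thesis
    unfolding fourier_coeff_powi_mult fourier_coeff_cnj by simp
qed

subsection \<open>Two by two matrices\<close>

lemma mat2_nth [simp]:
  "mat2 a b c d $ 1 $ 1 = a" "mat2 a b c d $ 1 $ 2 = b"
  "mat2 a b c d $ 2 $ 1 = c" "mat2 a b c d $ 2 $ 2 = d"
  by (simp_all add: mat2_def)

lemma matrix_vector_mult_2:
  fixes A :: "complex^2^2"
  shows "(A *v v) $ 1 = A $ 1 $ 1 * v $ 1 + A $ 1 $ 2 * v $ 2"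
    and "(A *v v) $ 2 = A $ 2 $ 1 * v $ 1 + A $ 2 $ 2 * v $ 2"
  by (simp_all add: matrix_vector_mult_def sum_2)

lemma adjoint_mat_nth [simp]:
  fixes A :: "complex^2^2"
  shows "adjoint_mat A $ i $ j = cnj (A $ j $ i)"
  by (simp add: adjoint_mat_def)

lemma measurable_matrix_vector_mult:
  fixes A :: "'b \<Rightarrow> complex^2^2" and v :: "'b \<Rightarrow> complex^2"
  assumes "\<And>i j. (\<lambda>x. A x $ i $ j) \<in> borel_measurable M" "\<And>i. (\<lambda>x. v x $ i) \<in> borel_measurable M"
  shows "(\<lambda>x. (A x *v v x) $ i) \<in> borel_measurable M"
  unfolding matrix_vector_mult_def using assms by simp

lemma measurable_exp_diag:
  assumes [measurable]: "u \<in> borel_measurable M"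
  shows "(\<lambda>x. exp_diag u x $ i $ j) \<in> borel_measurable M"
  using exhaust_2[of i] exhaust_2[of j] by (auto simp: exp_diag_def)

lemma measurable_matrix_nth:
  fixes A :: "'b \<Rightarrow> complex^2^2"
  assumes "A \<in> borel_measurable M"
  shows "(\<lambda>x. A x $ i $ j) \<in> borel_measurable M"
  by (rule borel_measurable_continuous_on[OF _ assms]) (intro continuous_intros)

lemma SU2_mat2_entries:
  assumes "mat2 a b (- cnj b) (cnj a) \<in> SU2"
  shows "norm a \<le> 1" "norm b \<le> 1"
proof -
  have "det (mat2 a b (- cnj b) (cnj a)) = 1"
    using assms by (simp add: SU2_def)
  then have "complex_of_real ((norm a)\<^sup>2 + (norm b)\<^sup>2) = of_real 1"
    by (simp add: det_2 complex_norm_square del: of_real_power)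
  then have "(norm a)\<^sup>2 + (norm b)\<^sup>2 = 1"
    by (simp only: of_real_eq_iff)
  then have "(norm a)\<^sup>2 \<le> 1" "(norm b)\<^sup>2 \<le> 1"
    using zero_le_power2[of "norm a"] zero_le_power2[of "norm b"] by linarith+
  then show "norm a \<le> 1" "norm b \<le> 1"
    by (simp_all add: abs_square_le_1)
qed

lemma VMO_SU2_entries:
  fixes k :: "complex \<Rightarrow> complex^2^2"
  assumes k: "k \<in> VMO SU2"
    and ab: "AE z in circle_measure. k z = mat2 (a z) (b z) (- cnj (b z)) (cnj (a z))"
  shows "AE z in circle_measure. norm (a z) \<le> 1" "AE z in circle_measure. norm (b z) \<le> 1"
    "\<And>i j. (\<lambda>z. k z $ i $ j) \<in> borel_measurable circle_measure"
proof -
  have "AE z in circle_measure. k z \<in> SU2" using k by (simp add: VMO_def)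
  with ab have *: "AE z in circle_measure. norm (a z) \<le> 1 \<and> norm (b z) \<le> 1"
    by eventually_elim (use SU2_mat2_entries in metis)
  show "AE z in circle_measure. norm (a z) \<le> 1" "AE z in circle_measure. norm (b z) \<le> 1"
    using * by (auto elim: eventually_mono)
  show "(\<lambda>z. k z $ i $ j) \<in> borel_measurable circle_measure" for i j
    using k by (intro measurable_matrix_nth borel_measurable_integrable) (simp add: VMO_def)
qed

text \<open>Square summability of the coefficients makes both parts genuine L^2 functions, after
  which the decomposition is uniqueness of Fourier coefficients. For the negative part it is the
  conjugate that is analytic.\<close>

lemma VMO_parts:
  assumes "chi \<in> VMO {w. Re w = 0}"
  shows "(\<lambda>z. pos_part chi z) \<in> H2_circle" "(\<lambda>z. cnj (neg_part chi z)) \<in> H2_circle"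
    "AE z in circle_measure. chi z = neg_part chi z + fourier_coeff chi 0 + pos_part chi z"
proof -
  have i: "integrable circle_measure chi" using assms by (simp add: VMO_def)
  obtain B where B: "\<And>A. finite A \<Longrightarrow> (\<Sum>k\<in>A. (norm (fourier_coeff chi k))\<^sup>2) \<le> B"
    using VMO_fourier_coeff_square_summable[OF assms] by blast
  note P = pos_part_properties[OF B] and N = neg_part_properties[OF B]
  show "(\<lambda>z. pos_part chi z) \<in> H2_circle"
    using P by (intro H2I) auto
  show "(\<lambda>z. cnj (neg_part chi z)) \<in> H2_circle"
    using N by (intro H2I L2_cnj) (auto simp: fourier_coeff_cnj)
  let ?c = "\<lambda>z::complex. fourier_coeff chi 0"
  have ci: "integrable circle_measure ?c" by simp
  have ni: "integrable circle_measure (neg_part chi)" and pi: "integrable circle_measure (pos_part chi)"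
    using P N by (auto intro: L2_integrable)
  show "AE z in circle_measure. chi z = neg_part chi z + fourier_coeff chi 0 + pos_part chi z"
  proof (rule fourier_coeff_unique[OF i])
    show "integrable circle_measure (\<lambda>z. neg_part chi z + fourier_coeff chi 0 + pos_part chi z)"
      using ni pi by simp
    show "fourier_coeff chi n = fourier_coeff (\<lambda>z. neg_part chi z + fourier_coeff chi 0 + pos_part chi z) n" for n
    proof -
      have "fourier_coeff ?c n = (if n = 0 then fourier_coeff chi 0 else 0)"
        using fourier_coeff_cmult[of "fourier_coeff chi 0" "\<lambda>z. z powi 0" n] fourier_coeff_powi[of 0 n] by simp
      then show ?thesis
        using P[of n] N[of n] ni pi ci by (simp add: fourier_coeff_add)
    qed
  qed
qed

lemma mult_exp_diag_2:
  "(exp_diag u z *v v) $ 1 = exp (u z) * v $ 1" "(exp_diag u z *v v) $ 2 = exp (- u z) * v $ 2"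
  by (simp_all add: matrix_vector_mult_2 exp_diag_def)

text \<open>The last three hypotheses are the natural domain of the composition, innermost operator
  first. Equality is almost everywhere because \<open>proj_plus\<close> selects a
  representative.\<close>

theorem mainTheorem2:
  fixes k1 k2 :: "complex \<Rightarrow> complex^2^2" and chi :: "complex \<Rightarrow> complex"
    and f :: "complex \<Rightarrow> complex^2"
  assumes "VMO_type_I1 k1" and "VMO_type_II1 k2"
    and "chi \<in> VMO {w. Re w = 0}"
    and "f \<in> toeplitz_dom (\<lambda>z. exp_diag (pos_part chi) z ** k2 z)"
    and "toeplitz (\<lambda>z. exp_diag (pos_part chi) z ** k2 z) f
           \<in> toeplitz_dom (exp_diag (\<lambda>_. fourier_coeff chi 0))"
    and "toeplitz (exp_diag (\<lambda>_. fourier_coeff chi 0))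
             (toeplitz (\<lambda>z. exp_diag (pos_part chi) z ** k2 z) f)
           \<in> toeplitz_dom (\<lambda>z. adjoint_mat (k1 z) ** exp_diag (neg_part chi) z)"
  shows "f \<in> toeplitz_dom (\<lambda>z. adjoint_mat (k1 z) ** exp_diag chi z ** k2 z) \<and>
    (AE z in circle_measure.
       toeplitz (\<lambda>z. adjoint_mat (k1 z) ** exp_diag chi z ** k2 z) f z =
       toeplitz (\<lambda>z. adjoint_mat (k1 z) ** exp_diag (neg_part chi) z)
         (toeplitz (exp_diag (\<lambda>_. fourier_coeff chi 0))
           (toeplitz (\<lambda>z. exp_diag (pos_part chi) z ** k2 z) f)) z)"
proof -
  define x y c0 where "x = pos_part chi" and "y = neg_part chi" and "c0 = fourier_coeff chi 0"
  have x: "x \<in> H2_circle" and y: "(\<lambda>z. cnj (y z)) \<in> H2_circle"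
    and chi: "AE z in circle_measure. chi z = y z + c0 + x z"
    using VMO_parts[OF assms(3)] by (simp_all add: x_def y_def c0_def)
  have chi_im: "AE z in circle_measure. Re (chi z) = 0" and chim: "chi \<in> borel_measurable circle_measure"
    using assms(3) by (auto simp: VMO_def)
  obtain a b where a: "a \<in> H2_circle" and b: "b \<in> H2_circle" and k1V: "k1 \<in> VMO SU2"
    and k1: "AE z in circle_measure. k1 z = mat2 (a z) (b z) (- cnj (b z)) (cnj (a z))"
    using assms(1) boundary_values_imp_H2 unfolding VMO_type_I1_def by blast
  obtain c d where c: "c \<in> H2_circle" and d: "d \<in> H2_circle" and k2V: "k2 \<in> VMO SU2"
    and k2: "AE z in circle_measure. k2 z = mat2 (cnj (d z)) (- cnj (c z)) (c z) (d z)"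
    using assms(2) boundary_values_imp_H2 unfolding VMO_type_II1_def by blast
  note ab1 = VMO_SU2_entries(1,2)[OF k1V k1] and k1m = VMO_SU2_entries(3)[OF k1V k1]
  \<comment> \<open>A loop of the second type fits the pattern of \<open>VMO_SU2_entries\<close>
    with first row \<open>cnj d\<close>, \<open>- cnj c\<close>, so the same bounds apply.\<close>
  have k2': "AE z in circle_measure. k2 z = mat2 (cnj (d z)) (- cnj (c z)) (- cnj (- cnj (c z))) (cnj (cnj (d z)))"
    using k2 by simp
  have cd1: "AE z in circle_measure. norm (c z) \<le> 1" "AE z in circle_measure. norm (d z) \<le> 1"
    using VMO_SU2_entries(1,2)[OF k2V k2'] by simp_all
  note k2m = VMO_SU2_entries(3)[OF k2V k2']

  \<comment> \<open>\<open>g\<close>, \<open>e\<close> and \<open>k\<close> are the three successive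
    products before projection, \<open>v\<close> and \<open>u\<close> the projections in between;
    \<open>h\<close> is the single product on the left. The claim becomes that \<open>h\<close> and
    \<open>k\<close> have the same projection.\<close>
  define g where "g z = exp_diag x z *v (k2 z *v f z)" for z
  define v where "v = proj_plus g"
  define e where "e z = exp_diag (\<lambda>_. c0) z *v v z" for z
  define u where "u = proj_plus e"
  define h where "h z = adjoint_mat (k1 z) *v (exp_diag chi z *v (k2 z *v f z))" for z
  define k where "k z = adjoint_mat (k1 z) *v (exp_diag y z *v u z)" for z
  have f: "f \<in> hardy" and g: "g \<in> L2_circle"
    using assms(4) by (simp_all add: toeplitz_dom_def g_def[abs_def] x_def matrix_vector_mul_assoc)
  have v_eq: "toeplitz (\<lambda>z. exp_diag (pos_part chi) z ** k2 z) f = v"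
    by (simp add: toeplitz_def v_def g_def[abs_def] x_def matrix_vector_mul_assoc)
  have u_eq: "toeplitz (exp_diag (\<lambda>_. fourier_coeff chi 0)) v = u"
    by (simp add: toeplitz_def u_def e_def[abs_def] c0_def)
  have k: "k \<in> L2_circle"
    using assms(6) unfolding v_eq u_eq
    by (simp add: toeplitz_dom_def k_def[abs_def] y_def matrix_vector_mul_assoc)
  have f_i: "(\<lambda>z. f z $ i) \<in> H2_circle" for i
    using f by (simp add: hardy_iff)
  have v_i: "(\<lambda>z. v z $ i) \<in> H2_circle" for i
    using proj_plus_properties(1)[OF g] by (simp add: hardy_iff v_def)
  note f_L2 = H2_L2[OF f_i]

  \<comment> \<open>Since \<open>chi\<close> is imaginary, \<open>exp_diag chi\<close> has
    unimodular diagonal, and the entries of both loops are bounded by 1.\<close>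
  have "h \<in> L2_circle"
  proof -
    have "(\<lambda>z. (k2 z *v f z) $ i) \<in> borel_measurable circle_measure" for i
      by (rule measurable_matrix_vector_mult[OF k2m L2_measurable[OF f_L2]])
    then have "(\<lambda>z. (exp_diag chi z *v (k2 z *v f z)) $ i) \<in> borel_measurable circle_measure" for i
      by (rule measurable_matrix_vector_mult[OF measurable_exp_diag[OF chim]])
    then have hm: "(\<lambda>z. h z $ i) \<in> borel_measurable circle_measure" for i
      unfolding h_def by (rule measurable_matrix_vector_mult[rotated]) (use k1m in simp)
    have bound: "AE z in circle_measure. norm (h z $ i) \<le> 2 * (norm (f z $ 1) + norm (f z $ 2))" for i
      using k1 k2 ab1 cd1 chi_im
    proof eventually_elim
      case (elim z)
      have nm: "norm (s * t) \<le> r" if "norm s \<le> 1" "norm t \<le> r" for s t :: complex and r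
        using mult_mono[OF that] by (simp add: norm_mult)
      let ?N = "norm (f z $ 1) + norm (f z $ 2)"
      have k2f: "norm ((k2 z *v f z) $ 1) \<le> ?N" "norm ((k2 z *v f z) $ 2) \<le> ?N"
        unfolding matrix_vector_mult_2 elim(2) mat2_nth
        by (rule norm_triangle_le, rule add_mono; rule nm; use elim in simp)+
      have ek: "norm ((exp_diag chi z *v (k2 z *v f z)) $ 1) \<le> ?N" "norm ((exp_diag chi z *v (k2 z *v f z)) $ 2) \<le> ?N"
        unfolding mult_exp_diag_2 by (rule nm; use elim k2f in simp)+
      have "norm (h z $ 1) \<le> ?N + ?N" "norm (h z $ 2) \<le> ?N + ?N"
        unfolding h_def matrix_vector_mult_2[of "adjoint_mat (k1 z)"] adjoint_mat_nth
        unfolding elim(1) mat2_nth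
        by (rule norm_triangle_le, rule add_mono; rule nm; use elim ek in simp)+
      then show ?case
        using exhaust_2[of i] by auto
    qed
    have "(\<lambda>z. h z $ i) \<in> L2_circle" for i
    proof (rule L2_dominated[OF hm])
      show "integrable circle_measure (\<lambda>z. 8 * (norm (f z $ 1))\<^sup>2 + 8 * (norm (f z $ 2))\<^sup>2)"
        using L2_sq_integrable[OF f_L2] by simp
      show "AE z in circle_measure. (norm (h z $ i))\<^sup>2 \<le> 8 * (norm (f z $ 1))\<^sup>2 + 8 * (norm (f z $ 2))\<^sup>2"
        using bound[of i]
      proof eventually_elim
        case (elim z)
        have "(norm (h z $ i))\<^sup>2 \<le> (2 * (norm (f z $ 1) + norm (f z $ 2)))\<^sup>2"
          using elim by (intro power_mono) auto
        also have "\<dots> \<le> 8 * (norm (f z $ 1))\<^sup>2 + 8 * (norm (f z $ 2))\<^sup>2"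
          using sum_squares_bound[of "norm (f z $ 1)" "norm (f z $ 2)"] by (simp add: power_mult_distrib power2_sum)
        finally show ?case .
      qed
    qed
    then show ?thesis by (simp add: L2_vec_iff)
  qed

  text \<open>The second component of \<open>e\<^bsup>\<chi>\<^sub>+\<^esup> k\<^sub>2 f\<close> is already analytic, so that projecting changes only the first.\<close>
  define q where "q z = g z $ 1 - v z $ 1" for z
  have q: "q \<in> L2_circle" "\<And>n. n \<ge> 0 \<Longrightarrow> fourier_coeff q n = 0"
    unfolding q_def v_def using proj_plus_properties(2)[OF g] g hardy_L2[OF proj_plus_properties(1)[OF g]]
    by (auto simp: L2_vec_iff intro!: L2_diff)
  \<comment> \<open>The combination of \<open>f\<close> with the second row of \<open>k2\<close> is
    in H^2 because \<open>c\<close> and \<open>d\<close> are bounded; the factor exp (- x) may be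
    unbounded, and the product is square integrable by the domain hypothesis on
    \<open>g\<close>.\<close>
  have g2: "(\<lambda>z. g z $ 2) \<in> H2_circle"
  proof -
    have gL: "(\<lambda>z. g z $ 2) \<in> L2_circle" using g by (simp add: L2_vec_iff)
    have "(\<lambda>z. c z * f z $ 1) \<in> H2_circle"
      by (rule H2_mult[OF c f_i L2_bounded_mult[OF f_L2 L2_measurable[OF H2_L2[OF c]] cd1(1)]])
    moreover have "(\<lambda>z. d z * f z $ 2) \<in> H2_circle"
      by (rule H2_mult[OF d f_i L2_bounded_mult[OF f_L2 L2_measurable[OF H2_L2[OF d]] cd1(2)]])
    ultimately have p: "(\<lambda>z. c z * f z $ 1 + d z * f z $ 2) \<in> H2_circle"
      by (rule H2_add)
    have nx: "(\<lambda>z. - x z) \<in> H2_circle"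
      using H2_cmult[OF x, of "-1"] by simp
    have eq: "AE z in circle_measure. g z $ 2 = exp (- x z) * (c z * f z $ 1 + d z * f z $ 2)"
      using k2 by eventually_elim (simp only: g_def mult_exp_diag_2(2) matrix_vector_mult_2(2)[of "mat2 _ _ _ _"] mat2_nth)
    note [measurable] = L2_measurable[OF H2_L2[OF x]] L2_measurable[OF H2_L2[OF p]]
    have "(\<lambda>z. exp (- x z) * (c z * f z $ 1 + d z * f z $ 2)) \<in> L2_circle"
      by (rule L2_cong_AE[OF gL _ eq]) measurable
    then have "(\<lambda>z. exp (- x z) * (c z * f z $ 1 + d z * f z $ 2)) \<in> H2_circle"
      by (rule H2_exp_mult[OF nx p])
    then show ?thesis
      by (rule H2_cong_AE[OF _ L2_measurable[OF gL] AE_symmetric[OF eq]])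
  qed
  have "AE z in circle_measure. g z $ 2 - v z $ 2 = 0"
    using proj_plus_properties(2)[OF g, of _ 2] by (intro H2_AE_zero H2_diff g2 v_i) (simp add: v_def)
  \<comment> \<open>A constant diagonal matrix preserves the Hardy space, so the middle projection
    changes nothing.\<close>
  moreover have "AE z in circle_measure. u z = e z"
  proof -
    have "(\<lambda>z. e z $ i) \<in> H2_circle" for i
      using exhaust_2[of i] by (auto simp: e_def mult_exp_diag_2 intro!: H2_cmult v_i)
    then show ?thesis
      unfolding u_def by (intro proj_plus_hardy) (simp add: hardy_iff)
  qed
  \<comment> \<open>Both components have the form required by
    \<open>antianalytic_product_coeff\<close>, with exp \<open>c0\<close> as its constant
    \<gamma>.\<close>
  ultimately have diff: "AE z in circle_measure.
      h z $ 1 - k z $ 1 = exp c0 * (cnj (a z) * (exp (y z) * q z)) \<and>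
      h z $ 2 - k z $ 2 = exp c0 * (cnj (b z) * (exp (y z) * q z))"
    using chi k1
  proof eventually_elim
    case (elim z)
    have e1: "exp (chi z) * (k2 z *v f z) $ 1 = exp (y z) * (exp c0 * g z $ 1)"
      by (simp add: elim g_def mult_exp_diag_2 exp_add mult_ac)
    have "- chi z = (- y z) + (- c0) + (- x z)" by (simp add: elim)
    then have e2: "exp (- chi z) * (k2 z *v f z) $ 2 = exp (- y z) * (exp (- c0) * g z $ 2)"
      by (simp only: g_def mult_exp_diag_2 exp_add mult_ac)
    have g2: "g z $ 2 = v z $ 2" using elim by simp
    have g1: "g z $ 1 = v z $ 1 + q z" by (simp add: q_def)
    show ?case
      unfolding h_def k_def matrix_vector_mult_2[of "adjoint_mat (k1 z)"] mult_exp_diag_2 e1 e2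
      by (simp add: elim(2,4) e_def mult_exp_diag_2 g1 g2 algebra_simps)
  qed
  have "AE z in circle_measure. proj_plus h z = proj_plus k z"
  proof (rule proj_plus_cong_coeff[OF \<open>h \<in> L2_circle\<close> k])
    fix i :: 2 and n :: int assume n: "n \<ge> 0"
    \<comment> \<open>The domain hypothesis for the last factor enters here: the unbounded product
      exp y times q, multiplied by the entries of \<open>k1\<close>, is square integrable as a
      difference of \<open>h\<close> and \<open>k\<close>.\<close>
    have L: "(\<lambda>z. h z $ i - k z $ i) \<in> L2_circle"
      using \<open>h \<in> L2_circle\<close> k by (intro L2_diff) (simp_all add: L2_vec_iff)
    consider "i = 1" | "i = 2" using exhaust_2 by blast
    then show "fourier_coeff (\<lambda>z. h z $ i - k z $ i) n = 0"
    proof cases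
      case 1
      show ?thesis
        by (rule antianalytic_product_coeff[OF a ab1(1) y q L _ n]) (use diff 1 in \<open>auto elim: eventually_mono\<close>)
    next
      case 2
      show ?thesis
        by (rule antianalytic_product_coeff[OF b ab1(2) y q L _ n]) (use diff 2 in \<open>auto elim: eventually_mono\<close>)
    qed
  qed
  moreover have "toeplitz (\<lambda>z. adjoint_mat (k1 z) ** exp_diag chi z ** k2 z) f = proj_plus h"
    by (simp add: toeplitz_def h_def[abs_def] matrix_vector_mul_assoc matrix_mul_assoc)
  moreover have "toeplitz (\<lambda>z. adjoint_mat (k1 z) ** exp_diag (neg_part chi) z) u = proj_plus k"
    by (simp add: toeplitz_def k_def[abs_def] y_def matrix_vector_mul_assoc)
  moreover have "f \<in> toeplitz_dom (\<lambda>z. adjoint_mat (k1 z) ** exp_diag chi z ** k2 z)"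
    using f \<open>h \<in> L2_circle\<close> by (simp add: toeplitz_dom_def h_def[abs_def] matrix_vector_mul_assoc matrix_mul_assoc)
  ultimately show ?thesis
    unfolding v_eq u_eq by simp
qed

end
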